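(* The queueing-inventory process $Z$ is ergodic if and only if for all $j\in\overline{J}$ $$\sum_{n_j\in\mathbb{N}_0}\prod_{\ell=1}^{n_j}\frac{\lambda_j}{\mu_j(\ell)}<\infty .$$ If $Z$ is ergodic, then its unique limiting and stationary distribution $\pi=(\pi(\mathbf{n},\mathbf{k}):(\mathbf{n},\mathbf{k})\in E)$ is $$\pi(\mathbf{n},\mathbf{k})=\xi(\mathbf{n})\cdot\theta(\mathbf{k}),$$ with $$\xi(\mathbf{n})=\prod_{j\in\overline{J}}\xi_j(n_j),\qquad \xi_j(n_j)=C_j^{-1}\prod_{\ell=1}^{n_j}\frac{\lambda_j}{\mu_j(\ell)},\quad n_j\in\mathbb{N}_0,\ j\in\overline{J},\qquad C_j=\sum_{n_j\in\mathbb{N}_0}\prod_{\ell=1}^{n_j}\frac{\lambda_j}{\mu_j(\ell)},$$ and $\theta=(\theta(\mathbf{k}):\mathbf{k}\in K)$ is the probability solution (nonnegative, summing to $1$ over $K$) of the system of equations, for all $\mathbf{k}\in K$, $$\theta(\mathbf{k})\Big(\sum_{i\in\overline{J}}\lambda_i 1_{\{k_i>0\}}+\sum_{i\in\overline{J}}\nu\, p_i(\mathbf{k})1_{\{k_i<b_i\}}\Big)=\sum_{i\in\overline{J}}\theta(\mathbf{k}+\mathbf{e}_i-\mathbf{e}_{J+1})\lambda_i 1_{\{k_i<b_i\}}+\sum_{i\in\overline{J}}\theta(\mathbf{k}-\mathbf{e}_i+\mathbf{e}_{J+1})\,\nu\, p_i(\mathbf{k}-\mathbf{e}_i+\mathbf{e}_{J+1})1_{\{k_i>0\}}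 .$$
   Context: Let $J>1$ be an integer, $\overline{J}=\{1,\dots,J\}$ (locations). Parameters: arrival rates $\lambda_j>0$, queue-length-dependent service rates $\mu_j(n)>0$ for $n\in\mathbb{N}=\{1,2,\dots\}$, base stock levels $b_j\in\mathbb{N}$ ($j\in\overline{J}$), and a supplier rate $\nu>0$. $\mathbb{N}_0=\{0\}\cup\mathbb{N}$; $\mathbf{e}_i$ is the $i$-th unit vector of appropriate dimension; $1_{\{\cdot\}}$ is the indicator (a term whose indicator vanishes is $0$); empty products are $1$ and empty sums are $0$. Let $$K=\Big\{(k_1,\dots,k_J,k_{J+1})\in\mathbb{N}_0^{J+1}: 0\le k_j\le b_j,\ j=1,\dots,J,\ k_{J+1}=\sum_{j=1}^J (b_j-k_j)\Big\},\qquad E=\{(\mathbf{n},\mathbf{k}):\mathbf{n}\in\mathbb{N}_0^J,\ \mathbf{k}\in K\}.$$ Routing probabilities (strict priorities): for $\mathbf{k}\in K$ let $A(\mathbf{k})=\arg\max_{i\in\overline{J}}(b_i-k_i)$ (the set of all maximizers), and $p_j(\mathbf{k})=1/|A(\mathbf{k})|$ if $j\in A(\mathbf{k})$, $p_j(\mathbf{k})=0$ otherwise. $Z=((X_1(t),\dots,X_J(t),Y_1(t),\dots,Y_J(t),W_{J+1}(t)):t\ge 0)$ is the continuous-time homogeneous Markov jump process on $E$ (with $X_j$ the number of customers at location $j$, $Y_j$ the inventory at location $j$, $W_{J+1}$ the number of orders at the supplier) whose generator $\mathbf{Q}=(q(z;\tilde z))_{z,\tilde z\in E}$ has the following rates for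 $(\mathbf{n},\mathbf{k})\in E$, $i\in\overline{J}$: - $q((\mathbf{n},\mathbf{k});(\mathbf{n}+\mathbf{e}_i,\mathbf{k}))=\lambda_i 1_{\{k_i>0\}}$, - $q((\mathbf{n},\mathbf{k});(\mathbf{n}-\mathbf{e}_i,\mathbf{k}-\mathbf{e}_i+\mathbf{e}_{J+1}))=\mu_i(n_i)1_{\{n_i>0\}}1_{\{k_i>0\}}$, - $q((\mathbf{n},\mathbf{k});(\mathbf{n},\mathbf{k}+\mathbf{e}_i-\mathbf{e}_{J+1}))=\nu\, p_i(\mathbf{k})1_{\{k_i<b_i\}}$, $q(z;\tilde z)=0$ for every other pair $z\ne\tilde z$, and $q(z;z)=-\sum_{\tilde z\ne z}q(z;\tilde z)$. $Z$ is assumed irreducible and regular (non-explosive, with conservative and stable generator). Ergodic means (irreducible and) positive recurrent. When the limiting distribution exists, $\pi(\mathbf{n},\mathbf{k})=\lim_{t\to\infty}P(Z(t)=(\mathbf{n},\mathbf{k}))$, and $\xi(\mathbf{n})=\lim_{t\to\infty}P((X_1(t),\dots,X_J(t))=\mathbf{n})$ and $\theta(\mathbf{k})=\lim_{t\to\infty}P((Y_1(t),\dots,Y_J(t),W_{J+1}(t))=\mathbf{k})$ denote the corresponding marginal limiting distributions. *)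

theory Defs
  imports "HOL-Probability.Probability"
begin

section \<open>Markov jump processes on a discrete state space\<close>

text \<open>
  A Markov jump process is rendered as a family: \<open>P x\<close> is the probability measure under which
  the process \<open>Z\<close> starts in \<open>x\<close>. The law for an arbitrary initial distribution is the
  corresponding mixture, see \<open>init_prob\<close>.
\<close>

definition trans_prob :: "('s \<Rightarrow> 'w measure) \<Rightarrow> (real \<Rightarrow> 'w \<Rightarrow> 's) \<Rightarrow> 's \<Rightarrow> real \<Rightarrow> 's \<Rightarrow> real" where
  "trans_prob P Z x t y = \<P>(\<omega> in P x. Z t \<omega> = y)"

text \<open>
  The clauses are: random variables with values in \<open>E\<close>, starting point, right-continuity of
  almost all paths for the discrete topology, the homogeneous Markov property (conditioning on
  the present and on finitely many past times), and \<open>q\<close> being the derivative of the transition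
  function at \<open>0\<close>.
\<close>

definition markov_jump_process ::
    "'s set \<Rightarrow> ('s \<Rightarrow> 's \<Rightarrow> real) \<Rightarrow> ('s \<Rightarrow> 'w measure) \<Rightarrow> (real \<Rightarrow> 'w \<Rightarrow> 's) \<Rightarrow> bool" where
  "markov_jump_process E q P Z \<longleftrightarrow>
     (\<forall>x\<in>E. prob_space (P x) \<and> (\<forall>t\<ge>0. Z t \<in> P x \<rightarrow>\<^sub>M count_space E)) \<and>
     (\<forall>x\<in>E. AE \<omega> in P x. Z 0 \<omega> = x) \<and>
     (\<forall>x\<in>E. AE \<omega> in P x. \<forall>t\<ge>0. \<forall>\<^sub>F s in at_right t. Z s \<omega> = Z t \<omega>) \<and>
     (\<forall>x\<in>E. \<forall>u\<in>E. \<forall>v\<in>E. \<forall>s t. \<forall>(m::nat) (\<tau>::nat \<Rightarrow> real) (\<zeta>::nat \<Rightarrow> 's).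
        0 \<le> s \<longrightarrow> s \<le> t \<longrightarrow> (\<forall>i<m. 0 \<le> \<tau> i \<and> \<tau> i \<le> s \<and> \<zeta> i \<in> E) \<longrightarrow>
        \<P>(\<omega> in P x. Z s \<omega> = u \<and> (\<forall>i<m. Z (\<tau> i) \<omega> = \<zeta> i)) \<noteq> 0 \<longrightarrow>
        \<P>(\<omega> in P x. Z t \<omega> = v \<bar> Z s \<omega> = u \<and> (\<forall>i<m. Z (\<tau> i) \<omega> = \<zeta> i))
          = trans_prob P Z u (t - s) v) \<and>
     (\<forall>x\<in>E. \<forall>y\<in>E.
        ((\<lambda>t. trans_prob P Z x t y) has_real_derivative q x y) (at 0 within {0..}))"

text \<open>
  Regularity: the generator is conservative (and stable, the rates being real numbers), and
  almost surely there are only finitely many jumps in every bounded time interval.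
\<close>

definition regular_process ::
    "'s set \<Rightarrow> ('s \<Rightarrow> 's \<Rightarrow> real) \<Rightarrow> ('s \<Rightarrow> 'w measure) \<Rightarrow> (real \<Rightarrow> 'w \<Rightarrow> 's) \<Rightarrow> bool" where
  "regular_process E q P Z \<longleftrightarrow>
     (\<forall>x\<in>E. ((\<lambda>y. q x y) has_sum (- q x x)) (E - {x})) \<and>
     (\<forall>x\<in>E. AE \<omega> in P x. \<forall>T.
        finite {t. 0 < t \<and> t \<le> T \<and> \<not> (\<forall>\<^sub>F s in at_left t. Z s \<omega> = Z t \<omega>)})"

definition irreducible_process ::
    "'s set \<Rightarrow> ('s \<Rightarrow> 'w measure) \<Rightarrow> (real \<Rightarrow> 'w \<Rightarrow> 's) \<Rightarrow> bool" where
  "irreducible_process E P Z \<longleftrightarrow> (\<forall>x\<in>E. \<forall>y\<in>E. \<exists>t\<ge>0. trans_prob P Z x t y > 0)"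

text \<open>
  First time of being in \<open>x\<close> after having left \<open>x\<close>; it is \<open>\<infinity>\<close> if there is no such time.
\<close>

definition return_time :: "(real \<Rightarrow> 'w \<Rightarrow> 's) \<Rightarrow> 's \<Rightarrow> 'w \<Rightarrow> ennreal" where
  "return_time Z x \<omega> =
     (INF t\<in>{t. 0 < t \<and> Z t \<omega> = x \<and> (\<exists>s. 0 < s \<and> s < t \<and> Z s \<omega> \<noteq> x)}. ennreal t)"

text \<open>
  Absorbing states, for which positive recurrence would need a separate convention, do not occur
  in irreducible processes with more than one state.
\<close>

definition positive_recurrent ::
    "('s \<Rightarrow> 'w measure) \<Rightarrow> (real \<Rightarrow> 'w \<Rightarrow> 's) \<Rightarrow> 's \<Rightarrow> bool" where
  "positive_recurrent P Z x \<longleftrightarrow> (\<integral>\<^sup>+ \<omega>. return_time Z x \<omega> \<partial>P x) < \<infinity>"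

definition ergodic_process ::
    "'s set \<Rightarrow> ('s \<Rightarrow> 'w measure) \<Rightarrow> (real \<Rightarrow> 'w \<Rightarrow> 's) \<Rightarrow> bool" where
  "ergodic_process E P Z \<longleftrightarrow>
     irreducible_process E P Z \<and> (\<forall>x\<in>E. positive_recurrent P Z x)"

definition distribution_on :: "'s set \<Rightarrow> ('s \<Rightarrow> real) \<Rightarrow> bool" where
  "distribution_on E \<alpha> \<longleftrightarrow> (\<forall>x\<in>E. 0 \<le> \<alpha> x) \<and> (\<alpha> has_sum 1) E"

text \<open>Probability of the event \<open>A\<close> when the process has initial distribution \<open>\<alpha>\<close>.\<close>

definition init_prob ::
    "'s set \<Rightarrow> ('s \<Rightarrow> 'w measure) \<Rightarrow> ('s \<Rightarrow> real) \<Rightarrow> ('w \<Rightarrow> bool) \<Rightarrow> real" where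
  "init_prob E P \<alpha> A = (\<Sum>\<^sub>\<infinity>x\<in>E. \<alpha> x * \<P>(\<omega> in P x. A \<omega>))"

definition limiting_distribution ::
    "'s set \<Rightarrow> ('s \<Rightarrow> 'w measure) \<Rightarrow> (real \<Rightarrow> 'w \<Rightarrow> 's) \<Rightarrow> ('s \<Rightarrow> real) \<Rightarrow> bool" where
  "limiting_distribution E P Z \<pi> \<longleftrightarrow> distribution_on E \<pi> \<and>
     (\<forall>\<alpha>. distribution_on E \<alpha> \<longrightarrow>
        (\<forall>y\<in>E. ((\<lambda>t. init_prob E P \<alpha> (\<lambda>\<omega>. Z t \<omega> = y)) \<longlongrightarrow> \<pi> y) at_top))"

definition stationary_distribution ::
    "'s set \<Rightarrow> ('s \<Rightarrow> 'w measure) \<Rightarrow> (real \<Rightarrow> 'w \<Rightarrow> 's) \<Rightarrow> ('s \<Rightarrow> real) \<Rightarrow> bool" where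
  "stationary_distribution E P Z \<pi> \<longleftrightarrow> distribution_on E \<pi> \<and>
     (\<forall>t\<ge>0. \<forall>y\<in>E. init_prob E P \<pi> (\<lambda>\<omega>. Z t \<omega> = y) = \<pi> y)"


section \<open>The queueing-inventory system\<close>

text \<open>
  Locations are the elements of a finite type \<open>'j\<close>. An inventory vector is indexed by
  \<open>'j option\<close>: the component \<open>Some j\<close> is the stock at location \<open>j\<close>, and \<open>None\<close> plays the role
  of the index \<open>J + 1\<close>, i.e. it is the number of orders at the supplier.
\<close>

type_synonym 'j queues = "'j \<Rightarrow> nat"
type_synonym 'j inventory = "'j option \<Rightarrow> nat"
type_synonym 'j state = "'j queues \<times> 'j inventory"

definition inventories :: "('j::finite \<Rightarrow> nat) \<Rightarrow> 'j inventory set" where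
  "inventories b = {k. (\<forall>j. k (Some j) \<le> b j) \<and> k None = (\<Sum>j\<in>UNIV. b j - k (Some j))}"

definition states :: "('j::finite \<Rightarrow> nat) \<Rightarrow> 'j state set" where
  "states b = UNIV \<times> inventories b"

text \<open>
  The moves of one unit \<open>k - e\<^sub>i + e\<^sub>J\<^sub>+\<^sub>1\<close> and \<open>k + e\<^sub>i - e\<^sub>J\<^sub>+\<^sub>1\<close>. They are only used when
  \<open>k\<^sub>i > 0\<close> and \<open>k\<^sub>i < b\<^sub>i\<close>, respectively, so that for \<open>k \<in> K\<close> the subtractions are proper.
\<close>

definition order_unit :: "'j \<Rightarrow> 'j inventory \<Rightarrow> 'j inventory" where
  "order_unit i k = k(Some i := k (Some i) - 1, None := k None + 1)"

definition deliver_unit :: "'j \<Rightarrow> 'j inventory \<Rightarrow> 'j inventory" where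
  "deliver_unit i k = k(Some i := k (Some i) + 1, None := k None - 1)"

definition neediest :: "('j::finite \<Rightarrow> nat) \<Rightarrow> 'j inventory \<Rightarrow> 'j set" where
  "neediest b k = {i. is_arg_max (\<lambda>j. b j - k (Some j)) (\<lambda>_. True) i}"

definition routing :: "('j::finite \<Rightarrow> nat) \<Rightarrow> 'j \<Rightarrow> 'j inventory \<Rightarrow> real" where
  "routing b j k = (if j \<in> neediest b k then 1 / real (card (neediest b k)) else 0)"

text \<open>
  The targets of the transitions listed here are pairwise distinct, so at most one summand is
  nonzero for each pair of states.
\<close>

definition jump_rate :: "('j::finite \<Rightarrow> real) \<Rightarrow> ('j \<Rightarrow> nat \<Rightarrow> real) \<Rightarrow> ('j \<Rightarrow> nat) \<Rightarrow> real \<Rightarrow>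
    'j state \<Rightarrow> 'j state \<Rightarrow> real" where
  "jump_rate lam \<mu> b \<nu> = (\<lambda>(n, k) z'.
     (\<Sum>i\<in>UNIV. if k (Some i) > 0 \<and> z' = (n(i := n i + 1), k) then lam i else 0) +
     (\<Sum>i\<in>UNIV. if n i > 0 \<and> k (Some i) > 0 \<and> z' = (n(i := n i - 1), order_unit i k)
                then \<mu> i (n i) else 0) +
     (\<Sum>i\<in>UNIV. if k (Some i) < b i \<and> z' = (n, deliver_unit i k)
                then \<nu> * routing b i k else 0))"

definition generator :: "('j::finite \<Rightarrow> real) \<Rightarrow> ('j \<Rightarrow> nat \<Rightarrow> real) \<Rightarrow> ('j \<Rightarrow> nat) \<Rightarrow> real \<Rightarrow>
    'j state \<Rightarrow> 'j state \<Rightarrow> real" where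
  "generator lam \<mu> b \<nu> z z' =
     (if z' = z then - (\<Sum>\<^sub>\<infinity>y\<in>states b - {z}. jump_rate lam \<mu> b \<nu> z y)
      else jump_rate lam \<mu> b \<nu> z z')"

definition queue_marginal :: "('j \<Rightarrow> real) \<Rightarrow> ('j \<Rightarrow> nat \<Rightarrow> real) \<Rightarrow> 'j \<Rightarrow> nat \<Rightarrow> real" where
  "queue_marginal lam \<mu> j m =
     (\<Prod>l=1..m. lam j / \<mu> j l) / (\<Sum>m'. \<Prod>l=1..m'. lam j / \<mu> j l)"

definition inventory_equations :: "('j::finite \<Rightarrow> real) \<Rightarrow> ('j \<Rightarrow> nat) \<Rightarrow> real \<Rightarrow>
    ('j inventory \<Rightarrow> real) \<Rightarrow> bool" where
  "inventory_equations lam b \<nu> \<theta> \<longleftrightarrow> (\<forall>k\<in>inventories b.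
     \<theta> k * ((\<Sum>i\<in>UNIV. lam i * of_bool (k (Some i) > 0)) +
            (\<Sum>i\<in>UNIV. \<nu> * routing b i k * of_bool (k (Some i) < b i))) =
     (\<Sum>i\<in>UNIV. \<theta> (deliver_unit i k) * lam i * of_bool (k (Some i) < b i)) +
     (\<Sum>i\<in>UNIV. \<theta> (order_unit i k) * \<nu> * routing b i (order_unit i k) * of_bool (k (Some i) > 0)))"

definition inventory_solution :: "('j::finite \<Rightarrow> real) \<Rightarrow> ('j \<Rightarrow> nat) \<Rightarrow> real \<Rightarrow>
    ('j inventory \<Rightarrow> real) \<Rightarrow> bool" where
  "inventory_solution lam b \<nu> \<theta> \<longleftrightarrow>
     distribution_on (inventories b) \<theta> \<and> inventory_equations lam b \<nu> \<theta>"

end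

theory Submission
  imports Defs "HOL-Library.Diagonal_Subsequence"
begin

text \<open>
  Let \<open>P\<^sub>t\<close> be the transition function and \<open>m(n, k) = w(n) \<theta>(k)\<close>, where \<open>w\<close> is the product of the
  weights \<open>\<Prod> \<lambda>\<^sub>j / \<mu>\<^sub>j(l)\<close>. The product form is a balance computation. Arrivals and services at location
  \<open>i\<close> stop together when the stock there is empty, so the local balance
  \<open>w(n) \<lambda>\<^sub>i = w(n + e\<^sub>i) \<mu>\<^sub>i(n\<^sub>i + 1)\<close> turns a service completion, which also consumes one unit of stock,
  into a demand of rate \<open>\<lambda>\<^sub>i\<close> seen by the inventory alone. What is left of \<open>m Q = 0\<close> is the system of
  equations for \<open>\<theta>\<close> (\<open>product_form_balance\<close>). That system is the stationarity of a finite Markov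
  chain. A solution is a limit of averages of this chain. Every solution is positive, because
  deliveries lead to full stock and orders lead from full stock to every inventory.

  The measure \<open>m\<close> may be infinite and the rates may be unbounded, so \<open>m Q = 0\<close> has to be transferred to
  \<open>P\<^sub>t\<close> with care. By regularity a path visits finitely many states up to time \<open>t\<close>. Hence \<open>P\<^sub>t\<close> is the
  increasing limit of the process killed outside finite sets, and on a finite set a step of
  length \<open>h\<close> enlarges \<open>m\<close> by a factor \<open>1 + \<epsilon> h\<close> at most. This gives \<open>m P\<^sub>t \<le> m\<close> (\<open>subinvariant_tp\<close>).

  If all series converge, then \<open>m\<close> is finite. The expected number of visits to \<open>y\<close> before the return
  to \<open>x\<close> is bounded by a multiple of \<open>m(y)\<close>, so the mean return time is finite
  (\<open>subinvariant_imp_positive_recurrent\<close>).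

  Conversely let the return time \<open>T\<close> to \<open>x\<close> have finite mean. Decomposing at the last visit to \<open>x\<close> on
  grids of mesh \<open>2\<^sup>-\<^sup>k\<close> gives a renewal inequality \<open>1 \<le> p\<^sub>n + C \<Sum> p\<^sub>n\<^sub>-\<^sub>j w\<^sub>j\<close>, where \<open>p\<^sub>n = P\<^sub>n(x, x)\<close> and
  \<open>w\<^sub>j \<le> P(T \<ge> j)\<close> is summable. Therefore \<open>p\<^sub>n\<close> does not vanish on average, and the averages of \<open>P\<^sub>n(x, \<cdot>)\<close>
  accumulate at a nonzero finite measure that is invariant under \<open>P\<^sub>1\<close>. After normalization it is the limit of
  \<open>P\<^sub>n(z, \<cdot>)\<close> for every \<open>z\<close>, and Fatou's lemma in \<open>\<Sum> m(z) P\<^sub>n(z, x) \<le> m(x)\<close> shows that \<open>m\<close> is finite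
  (\<open>positive_recurrent_imp_finite\<close>). The argument uses the Markov property at fixed times only.

  Convergence to an invariant distribution \<open>\<pi>\<close> is obtained from the overlap
  \<open>\<Sum> min (P\<^sub>t(x, y)) (\<pi>(y))\<close>. It never decreases, and it grows by a fixed amount as long as it stays away
  from \<open>1\<close>: since \<open>P\<^sub>t(x, \<cdot>) \<le> \<pi> / \<pi>(x)\<close>, most of the excess on both sides lies in a finite set, from which
  a part of either excess reaches the same point after a fixed time (\<open>overlap_tendsto_1\<close>). As \<open>\<pi>\<close> is
  unique, so is \<open>\<theta>\<close>: every solution of the inventory equations gives a limiting distribution of
  product form.
\<close>

section \<open>Measures and kernels on a countable state space\<close>

definition stochastic_on :: "'s set \<Rightarrow> ('s \<Rightarrow> 's \<Rightarrow> ennreal) \<Rightarrow> bool" where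
  "stochastic_on E p \<longleftrightarrow> (\<forall>x\<in>E. (\<integral>\<^sup>+ y. p x y \<partial>count_space E) = 1)"

text \<open>
  The image \<open>a p\<close> of a measure \<open>a\<close> under a kernel \<open>p\<close>. Values in \<open>ennreal\<close> keep all sums defined, also
  those of infinite measures.
\<close>

definition push :: "'s set \<Rightarrow> ('s \<Rightarrow> ennreal) \<Rightarrow> ('s \<Rightarrow> 's \<Rightarrow> ennreal) \<Rightarrow> 's \<Rightarrow> ennreal" where
  "push E a p y = (\<integral>\<^sup>+ x. a x * p x y \<partial>count_space E)"

lemma push_mono:
  assumes "\<And>x. x \<in> E \<Longrightarrow> a x \<le> a' x"
  shows "push E a p y \<le> push E a' p y"
  unfolding push_def using assms by (intro nn_integral_mono mult_right_mono) auto

lemma push_cong: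
  assumes "\<And>x. x \<in> E \<Longrightarrow> a x = a' x"
  shows "push E a p y = push E a' p y"
  unfolding push_def using assms by (intro nn_integral_cong) auto

lemma push_add: "push E (\<lambda>x. a x + a' x) p y = push E a p y + push E a' p y"
  unfolding push_def by (simp add: distrib_right nn_integral_add)

lemma push_cmult: "push E (\<lambda>x. c * a x) p y = c * push E a p y"
  unfolding push_def by (simp add: mult.assoc nn_integral_cmult)

lemma push_sum: "push E (\<lambda>x. \<Sum>i\<in>I. f i x) p y = (\<Sum>i\<in>I. push E (f i) p y)"
  unfolding push_def by (simp add: sum_distrib_right nn_integral_sum)

lemma push_ge_point:
  assumes "x \<in> E"
  shows "a x * p x y \<le> push E a p y"
  unfolding push_def by (rule nn_integral_ge_point[OF assms])

lemma mass_push: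
  fixes E :: "'s::countable set"
  assumes "stochastic_on E p"
  shows "(\<integral>\<^sup>+ y. push E a p y \<partial>count_space E) = (\<integral>\<^sup>+ x. a x \<partial>count_space E)"
proof -
  have "(\<integral>\<^sup>+ y. push E a p y \<partial>count_space E)
      = (\<integral>\<^sup>+ x. (\<integral>\<^sup>+ y. a x * p x y \<partial>count_space E) \<partial>count_space E)"
    unfolding push_def by (rule nn_integral_count_space_nn_integral) auto
  also have "\<dots> = (\<integral>\<^sup>+ x. a x \<partial>count_space E)"
    using assms by (intro nn_integral_cong) (auto simp: nn_integral_cmult stochastic_on_def)
  finally show ?thesis .
qed

lemma push_push:
  fixes E :: "'s::countable set"
  shows "push E (push E a p) r y = push E a (\<lambda>x. push E (p x) r) y"
proof -
  have "push E (push E a p) r y =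
      (\<integral>\<^sup>+ z. (\<integral>\<^sup>+ x. a x * p x z * r z y \<partial>count_space E) \<partial>count_space E)"
    unfolding push_def by (simp add: nn_integral_multc)
  also have "\<dots> = (\<integral>\<^sup>+ x. (\<integral>\<^sup>+ z. a x * p x z * r z y \<partial>count_space E) \<partial>count_space E)"
    by (rule nn_integral_count_space_nn_integral) auto
  also have "\<dots> = push E a (\<lambda>x. push E (p x) r) y"
    unfolding push_def by (simp add: nn_integral_cmult mult.assoc)
  finally show ?thesis .
qed

lemma count_space_eqI:
  fixes f g :: "'s \<Rightarrow> ennreal"
  assumes le: "\<And>x. x \<in> E \<Longrightarrow> f x \<le> g x"
    and mass: "(\<integral>\<^sup>+ x. g x \<partial>count_space E) \<le> (\<integral>\<^sup>+ x. f x \<partial>count_space E)"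
    and fin: "(\<integral>\<^sup>+ x. f x \<partial>count_space E) < \<infinity>"
    and x: "x \<in> E"
  shows "f x = g x"
proof -
  have "(\<integral>\<^sup>+ x. g x - f x \<partial>count_space E)
      = (\<integral>\<^sup>+ x. g x \<partial>count_space E) - (\<integral>\<^sup>+ x. f x \<partial>count_space E)"
    using fin le by (intro nn_integral_diff) (auto simp: AE_count_space)
  also have "\<dots> = 0"
    using mass fin by (subst diff_eq_0_iff_ennreal) (auto simp: le_less_trans)
  finally have "g x - f x \<le> 0"
    using nn_integral_ge_point[OF x, of "\<lambda>x. g x - f x"] by simp
  then have "g x \<le> f x"
    using nn_integral_ge_point[OF x, of f] fin by (auto simp: diff_eq_0_iff_ennreal top_unique)
  with le[OF x] show ?thesis by simp
qed

text \<open>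
  A stochastic kernel preserves the total mass, so no mass can be lost at any single point.
\<close>

lemma subinvariant_imp_invariant:
  fixes E :: "'s::countable set"
  assumes "stochastic_on E p" and sub: "\<And>y. y \<in> E \<Longrightarrow> push E m p y \<le> m y"
    and "(\<integral>\<^sup>+ x. m x \<partial>count_space E) < \<infinity>" and "y \<in> E"
  shows "push E m p y = m y"
  using assms by (intro count_space_eqI[of E "push E m p" m]) (auto simp: mass_push)

lemma nn_integral_count_space_le:
  fixes f :: "'s::countable \<Rightarrow> ennreal"
  assumes "\<And>F. finite F \<Longrightarrow> F \<subseteq> E \<Longrightarrow> (\<Sum>x\<in>F. f x) \<le> c"
  shows "(\<integral>\<^sup>+ x. f x \<partial>count_space E) \<le> c"
proof -
  define F where "F n = {x \<in> E. to_nat x < n}" for n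
  have fin: "finite (F n)" for n
    by (rule finite_imageD[of to_nat]) (auto simp: F_def inj_on_def intro: finite_subset[of _ "{..<n}"])
  have "f x = (SUP n. f x * indicator (F n) x)" if "x \<in> E" for x
  proof (rule antisym)
    show "f x \<le> (SUP n. f x * indicator (F n) x)"
      by (rule SUP_upper2[of "Suc (to_nat x)"]) (use that in \<open>auto simp: F_def\<close>)
  qed (auto intro!: SUP_least split: split_indicator)
  then have "(\<integral>\<^sup>+ x. f x \<partial>count_space E) = (\<integral>\<^sup>+ x. (SUP n. f x * indicator (F n) x) \<partial>count_space E)"
    by (intro nn_integral_cong) auto
  also have "\<dots> = (SUP n. \<integral>\<^sup>+ x. f x * indicator (F n) x \<partial>count_space E)"
    by (intro nn_integral_monotone_convergence_SUP)
       (auto simp: incseq_def le_fun_def F_def split: split_indicator)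
  also have "\<dots> \<le> c"
  proof (rule SUP_least)
    fix n
    have "(\<integral>\<^sup>+ x. f x * indicator (F n) x \<partial>count_space E) = (\<Sum>x\<in>F n. f x * indicator (F n) x)"
      by (rule nn_integral_count_space') (use fin in \<open>auto simp: F_def\<close>)
    also have "\<dots> = (\<Sum>x\<in>F n. f x)" by (intro sum.cong) auto
    also have "\<dots> \<le> c" by (rule assms[OF fin]) (auto simp: F_def)
    finally show "(\<integral>\<^sup>+ x. f x * indicator (F n) x \<partial>count_space E) \<le> c" .
  qed
  finally show ?thesis .
qed

lemma sum_le_nn_integral_count_space:
  assumes "finite F" "F \<subseteq> E"
  shows "(\<Sum>x\<in>F. f x) \<le> (\<integral>\<^sup>+ x. f x \<partial>count_space E)"
proof -
  have "(\<Sum>x\<in>F. f x) = (\<Sum>x\<in>F. f x * indicator F x)" by (intro sum.cong) auto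
  also have "\<dots> = (\<integral>\<^sup>+ x. f x * indicator F x \<partial>count_space E)"
    by (rule nn_integral_count_space'[symmetric]) (use assms in auto)
  also have "\<dots> \<le> (\<integral>\<^sup>+ x. f x \<partial>count_space E)"
    by (intro nn_integral_mono) (auto split: split_indicator)
  finally show ?thesis .
qed

lemma nn_integral_eq_infsum:
  fixes f :: "'s::countable \<Rightarrow> real"
  assumes f: "f summable_on A" and nn: "\<And>x. x \<in> A \<Longrightarrow> 0 \<le> f x"
  shows "(\<integral>\<^sup>+ x. ennreal (f x) \<partial>count_space A) = ennreal (infsum f A)"
proof (rule antisym)
  show "(\<integral>\<^sup>+ x. ennreal (f x) \<partial>count_space A) \<le> ennreal (infsum f A)"
  proof (rule nn_integral_count_space_le)
    fix F assume F: "finite F" "F \<subseteq> A"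
    have "(\<Sum>x\<in>F. ennreal (f x)) = ennreal (sum f F)" using F nn by (intro sum_ennreal) auto
    also have "\<dots> \<le> ennreal (infsum f A)"
      using F nn by (intro ennreal_leI finite_sum_le_infsum[OF f]) auto
    finally show "(\<Sum>x\<in>F. ennreal (f x)) \<le> ennreal (infsum f A)" .
  qed
  let ?I = "\<integral>\<^sup>+ x. ennreal (f x) \<partial>count_space A"
  show "ennreal (infsum f A) \<le> ?I"
  proof (cases ?I)
    case (real r)
    have "infsum f A \<le> r"
    proof (rule infsum_le_finite_sums[OF f])
      fix F assume F: "finite F" "F \<subseteq> A"
      have "ennreal (sum f F) = (\<Sum>x\<in>F. ennreal (f x))" using F nn by (intro sum_ennreal[symmetric]) auto
      also have "\<dots> \<le> ?I" by (rule sum_le_nn_integral_count_space[OF F])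
      finally show "sum f F \<le> r" using real by (simp add: ennreal_le_iff)
    qed
    then show ?thesis unfolding real by (rule ennreal_leI)
  qed simp
qed

lemma has_sum_of_nn_integral:
  fixes f :: "'s::countable \<Rightarrow> real"
  assumes nn: "\<And>x. x \<in> A \<Longrightarrow> 0 \<le> f x" and c: "0 \<le> c"
    and int: "(\<integral>\<^sup>+ x. ennreal (f x) \<partial>count_space A) = ennreal c"
  shows "(f has_sum c) A"
proof -
  have summ: "f summable_on A"
  proof (rule nonneg_bdd_above_summable_on[OF nn])
    show "bdd_above (sum f ` {F. F \<subseteq> A \<and> finite F})"
    proof (rule bdd_aboveI2)
      fix F assume "F \<in> {F. F \<subseteq> A \<and> finite F}"
      then have F: "finite F" "F \<subseteq> A" by simp_all
      have "ennreal (sum f F) = (\<Sum>x\<in>F. ennreal (f x))"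
        by (rule sum_ennreal[symmetric]) (rule nn, rule subsetD[OF F(2)])
      also have "\<dots> \<le> (\<integral>\<^sup>+ x. ennreal (f x) \<partial>count_space A)" by (rule sum_le_nn_integral_count_space[OF F])
      also have "\<dots> = ennreal c" by (rule int)
      finally show "sum f F \<le> c" using c by (simp only: ennreal_le_iff)
    qed
  qed
  have "ennreal (infsum f A) = ennreal c"
    unfolding int[symmetric] by (rule nn_integral_eq_infsum[OF summ nn, symmetric])
  moreover have "0 \<le> infsum f A" by (rule infsum_nonneg[OF nn])
  ultimately have "infsum f A = c" using c by (simp only: ennreal_inj)
  then show ?thesis using has_sum_infsum[OF summ] by simp
qed

lemma finite_tail:
  fixes f :: "'s::countable \<Rightarrow> ennreal"
  assumes fin: "(\<integral>\<^sup>+ x. f x \<partial>count_space E) < \<infinity>" and e: "0 < e"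
  obtains F where "finite F" "F \<subseteq> E" "(\<integral>\<^sup>+ x. f x * indicator (- F) x \<partial>count_space E) < e"
proof -
  let ?I = "\<integral>\<^sup>+ x. f x \<partial>count_space E"
  have "\<exists>F. finite F \<and> F \<subseteq> E \<and> ?I < (\<Sum>x\<in>F. f x) + e"
  proof (rule ccontr)
    assume "\<not> ?thesis"
    then have *: "(\<Sum>x\<in>F. f x) + e \<le> ?I" if "finite F" "F \<subseteq> E" for F
      using that by (auto simp: not_less)
    from *[of "{}"] have "e \<le> ?I" by simp
    with fin have efin: "e < \<infinity>" by auto
    have "?I \<le> ?I - e"
    proof (rule nn_integral_count_space_le)
      fix F assume "finite F" "F \<subseteq> E"
      from *[OF this] have le: "sum f F + e \<le> ?I" .
      have "sum f F \<le> sum f F + e" by simp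
      with le have "sum f F \<le> ?I" by (rule order_trans[rotated])
      with fin have "sum f F < \<infinity>" by (rule le_less_trans[rotated])
      with le efin fin show "sum f F \<le> ?I - e"
        by (cases "sum f F"; cases e; cases ?I) (auto simp: ennreal_minus simp flip: ennreal_plus)
    qed
    moreover have "?I - e < ?I"
      using \<open>e \<le> ?I\<close> e fin by (metis diff_diff_ennreal ennreal_between infinity_ennreal_def zero_less_iff_neq_zero less_le_trans order_less_irrefl)
    ultimately show False by simp
  qed
  then obtain F where F: "finite F" "F \<subseteq> E" "?I < (\<Sum>x\<in>F. f x) + e" by auto
  have "?I = (\<integral>\<^sup>+ x. f x * indicator F x \<partial>count_space E)
            + (\<integral>\<^sup>+ x. f x * indicator (- F) x \<partial>count_space E)"
    by (subst nn_integral_add[symmetric]) (auto intro!: nn_integral_cong split: split_indicator)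
  also have "(\<integral>\<^sup>+ x. f x * indicator F x \<partial>count_space E) = (\<Sum>x\<in>F. f x)"
    by (subst nn_integral_count_space'[of F]) (use F in \<open>auto split: split_indicator\<close>)
  finally have "(\<Sum>x\<in>F. f x) + (\<integral>\<^sup>+ x. f x * indicator (- F) x \<partial>count_space E) < (\<Sum>x\<in>F. f x) + e"
    using F(3) by simp
  then have "(\<integral>\<^sup>+ x. f x * indicator (- F) x \<partial>count_space E) < e"
    by (meson add_left_mono not_le)
  with F show ?thesis using that by blast
qed

section \<open>Convergence to an invariant distribution\<close>

text \<open>
  One minus the total variation distance, if \<open>a\<close> and \<open>b\<close> are probability distributions.
\<close>

definition overlap :: "'s set \<Rightarrow> ('s \<Rightarrow> ennreal) \<Rightarrow> ('s \<Rightarrow> ennreal) \<Rightarrow> ennreal" where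
  "overlap E a b = (\<integral>\<^sup>+ y. min (a y) (b y) \<partial>count_space E)"

text \<open>
  The common part \<open>min a b\<close> is transported as a whole. In addition, the two excess parts meet at \<open>w\<close>.
\<close>

lemma overlap_push:
  fixes E :: "'s::countable set"
  assumes p: "stochastic_on E p" and w: "w \<in> E"
    and fin: "\<And>x. x \<in> E \<Longrightarrow> a x < \<infinity>" "\<And>x. x \<in> E \<Longrightarrow> b x < \<infinity>"
  shows "overlap E a b + min (push E (\<lambda>x. a x - min (a x) (b x)) p w) (push E (\<lambda>x. b x - min (a x) (b x)) p w)
    \<le> overlap E (push E a p) (push E b p)"
proof -
  let ?c = "\<lambda>x. min (a x) (b x)"
  let ?a = "\<lambda>x. a x - ?c x" and ?b = "\<lambda>x. b x - ?c x"
  let ?m = "\<lambda>y. min (push E ?a p y) (push E ?b p y)"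
  have a: "push E a p y = push E ?c p y + push E ?a p y" for y
    unfolding push_add[symmetric] using fin
    by (intro push_cong) (auto simp: add_diff_inverse_ennreal intro!: add_diff_inverse_ennreal[symmetric])
  have b: "push E b p y = push E ?c p y + push E ?b p y" for y
    unfolding push_add[symmetric] using fin
    by (intro push_cong) (auto simp: add_diff_inverse_ennreal intro!: add_diff_inverse_ennreal[symmetric])
  have "overlap E a b + ?m w \<le> (\<integral>\<^sup>+ y. push E ?c p y \<partial>count_space E) + (\<integral>\<^sup>+ y. ?m y \<partial>count_space E)"
    unfolding overlap_def mass_push[OF p] using nn_integral_ge_point[OF w, of ?m] by (intro add_mono) auto
  also have "\<dots> = (\<integral>\<^sup>+ y. push E ?c p y + ?m y \<partial>count_space E)"
    by (simp add: nn_integral_add)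
  also have "\<dots> \<le> overlap E (push E a p) (push E b p)"
    unfolding overlap_def a b by (intro nn_integral_mono) (auto simp: min_add_distrib_right add_mono)
  finally show ?thesis .
qed

lemma overlap_le_push:
  fixes E :: "'s::countable set"
  assumes "stochastic_on E p"
  shows "overlap E a b \<le> overlap E (push E a p) (push E b p)"
proof -
  have "overlap E a b = (\<integral>\<^sup>+ y. push E (\<lambda>x. min (a x) (b x)) p y \<partial>count_space E)"
    by (simp add: mass_push[OF assms] overlap_def)
  also have "\<dots> \<le> overlap E (push E a p) (push E b p)"
    unfolding overlap_def by (intro nn_integral_mono min.boundedI push_mono) auto
  finally show ?thesis .
qed

lemma overlap_le_1:
  assumes "(\<integral>\<^sup>+ y. b y \<partial>count_space E) = 1"
  shows "overlap E a b \<le> 1"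
  unfolding overlap_def assms[symmetric] by (intro nn_integral_mono) auto

text \<open>
  For probability distributions this bounds the difference of the probabilities of an event by
  \<open>1 - overlap\<close>; it is arranged without subtractions.
\<close>

lemma overlap_event:
  assumes b: "(\<integral>\<^sup>+ y. b y \<partial>count_space E) = 1" and B: "B \<subseteq> E"
  shows "(\<integral>\<^sup>+ y. b y \<partial>count_space B) + overlap E a b \<le> (\<integral>\<^sup>+ y. a y \<partial>count_space B) + 1"
proof -
  have split: "(\<integral>\<^sup>+ y. f y \<partial>count_space E) = (\<integral>\<^sup>+ y. f y \<partial>count_space B) + (\<integral>\<^sup>+ y. f y \<partial>count_space (E - B))"
    for f :: "'a \<Rightarrow> ennreal"
  proof -
    have "(\<integral>\<^sup>+ y. f y \<partial>count_space E) = (\<integral>\<^sup>+ y. f y * indicator B y + f y * indicator (E - B) y \<partial>count_space E)"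
      by (intro nn_integral_cong) (use B in \<open>auto split: split_indicator\<close>)
    also have "\<dots> = (\<integral>\<^sup>+ y. f y * indicator B y \<partial>count_space E) + (\<integral>\<^sup>+ y. f y * indicator (E - B) y \<partial>count_space E)"
      by (rule nn_integral_add) auto
    also have "(\<integral>\<^sup>+ y. f y * indicator B y \<partial>count_space E) = (\<integral>\<^sup>+ y. f y * indicator B y \<partial>count_space B)"
      by (rule nn_integral_count_space_eq) (use B in auto)
    also have "\<dots> = (\<integral>\<^sup>+ y. f y \<partial>count_space B)" by (intro nn_integral_cong) auto
    also have "(\<integral>\<^sup>+ y. f y * indicator (E - B) y \<partial>count_space E) = (\<integral>\<^sup>+ y. f y * indicator (E - B) y \<partial>count_space (E - B))"
      by (rule nn_integral_count_space_eq) (use B in auto)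
    also have "\<dots> = (\<integral>\<^sup>+ y. f y \<partial>count_space (E - B))" by (intro nn_integral_cong) auto
    finally show ?thesis .
  qed
  have "overlap E a b \<le> (\<integral>\<^sup>+ y. a y \<partial>count_space B) + (\<integral>\<^sup>+ y. b y \<partial>count_space (E - B))"
    unfolding overlap_def split by (intro add_mono nn_integral_mono) auto
  then have "(\<integral>\<^sup>+ y. b y \<partial>count_space B) + overlap E a b \<le> (\<integral>\<^sup>+ y. b y \<partial>count_space B)
      + ((\<integral>\<^sup>+ y. a y \<partial>count_space B) + (\<integral>\<^sup>+ y. b y \<partial>count_space (E - B)))"
    by (rule add_left_mono)
  also have "\<dots> = (\<integral>\<^sup>+ y. a y \<partial>count_space B)
      + ((\<integral>\<^sup>+ y. b y \<partial>count_space B) + (\<integral>\<^sup>+ y. b y \<partial>count_space (E - B)))"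
    by (rule add.left_commute)
  also have "\<dots> = (\<integral>\<^sup>+ y. a y \<partial>count_space B) + 1"
    by (simp only: split[of b, symmetric] b)
  finally show ?thesis .
qed

lemma overlap_commute: "overlap E a b = overlap E b a"
  unfolding overlap_def by (simp add: min.commute)

lemma overlap_cong:
  "(\<And>x. x \<in> E \<Longrightarrow> a x = a' x) \<Longrightarrow> (\<And>x. x \<in> E \<Longrightarrow> b x = b' x) \<Longrightarrow> overlap E a b = overlap E a' b'"
  unfolding overlap_def by (intro nn_integral_cong) auto

lemma overlap_tendsto_event:
  assumes o: "((\<lambda>n. overlap E (a n) b) \<longlongrightarrow> 1) G"
    and a: "\<And>n. (\<integral>\<^sup>+ y. a n y \<partial>count_space E) = 1" and b: "(\<integral>\<^sup>+ y. b y \<partial>count_space E) = 1"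
    and B: "B \<subseteq> E"
  shows "((\<lambda>n. \<integral>\<^sup>+ y. a n y \<partial>count_space B) \<longlongrightarrow> (\<integral>\<^sup>+ y. b y \<partial>count_space B)) G"
proof -
  have le1: "(\<integral>\<^sup>+ y. f y \<partial>count_space B) \<le> 1" if "(\<integral>\<^sup>+ y. f y \<partial>count_space E) = 1" for f
  proof -
    have "(\<integral>\<^sup>+ y. f y \<partial>count_space B) = (\<integral>\<^sup>+ y. f y * indicator B y \<partial>count_space B)"
      by (intro nn_integral_cong) auto
    also have "\<dots> = (\<integral>\<^sup>+ y. f y * indicator B y \<partial>count_space E)"
      by (rule nn_integral_count_space_eq) (use B in auto)
    also have "\<dots> \<le> (\<integral>\<^sup>+ y. f y \<partial>count_space E)" by (intro nn_integral_mono) (auto split: split_indicator)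
    finally show ?thesis using that by simp
  qed
  have real: "x = ennreal (enn2real x)" if "x \<le> 1" for x :: ennreal
    by (rule ennreal_enn2real[symmetric]) (use that in \<open>auto intro: le_less_trans[of _ 1]\<close>)
  define r where "r n = enn2real (\<integral>\<^sup>+ y. a n y \<partial>count_space B)" for n
  define s where "s = enn2real (\<integral>\<^sup>+ y. b y \<partial>count_space B)"
  define w where "w n = enn2real (overlap E (a n) b)" for n
  have r: "(\<integral>\<^sup>+ y. a n y \<partial>count_space B) = ennreal (r n)" "0 \<le> r n" for n
    using real[OF le1[OF a]] by (simp_all add: r_def)
  have s: "(\<integral>\<^sup>+ y. b y \<partial>count_space B) = ennreal s" "0 \<le> s"
    using real[OF le1[OF b]] by (simp_all add: s_def)
  have w: "overlap E (a n) b = ennreal (w n)" "0 \<le> w n" for n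
    using real[OF overlap_le_1[OF b]] by (simp_all add: w_def)
  have 1: "s + w n \<le> r n + 1" "r n + w n \<le> s + 1" for n
  proof -
    have "ennreal (s + w n) \<le> ennreal (r n + 1)" "ennreal (r n + w n) \<le> ennreal (s + 1)"
      using overlap_event[OF b B, of "a n"] overlap_event[OF a[of n] B, of b] r(2) s(2) w(2)
      unfolding overlap_commute[of E b] r s w by simp_all
    with r(2)[of n] s(2) show "s + w n \<le> r n + 1" "r n + w n \<le> s + 1"
      by (simp_all only: ennreal_le_iff add_nonneg_nonneg zero_le_one)
  qed
  have "((\<lambda>n. ennreal (w n)) \<longlongrightarrow> ennreal 1) G" using o by (simp add: w)
  then have "(w \<longlongrightarrow> 1) G" using w(2) by (subst (asm) tendsto_ennreal_iff) auto
  then have "((\<lambda>n. s - (1 - w n)) \<longlongrightarrow> s - (1 - 1)) G" "((\<lambda>n. s + (1 - w n)) \<longlongrightarrow> s + (1 - 1)) G"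
    by (intro tendsto_intros; assumption)+
  then have "(r \<longlongrightarrow> s) G"
    by (intro tendsto_sandwich[of "\<lambda>n. s - (1 - w n)" r G "\<lambda>n. s + (1 - w n)"])
       (use 1 in \<open>auto simp: algebra_simps\<close>)
  then show ?thesis unfolding r s by (rule tendsto_ennrealI)
qed

text \<open>
  Mass \<open>2 e\<close>, of which at most \<open>e\<close> lies outside \<open>F\<close>, leaves \<open>e\<close> to be shared by the points of \<open>F\<close>.
\<close>

lemma heavy_point:
  fixes f :: "'s::countable \<Rightarrow> ennreal"
  assumes F: "finite F" "F \<subseteq> E" and e: "0 < e" "e < \<infinity>"
    and mass: "e + e \<le> (\<integral>\<^sup>+ x. f x \<partial>count_space E)"
    and tail: "(\<integral>\<^sup>+ x. f x * indicator (- F) x \<partial>count_space E) \<le> e"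
  obtains u where "u \<in> F" "e / of_nat (card F) \<le> f u"
proof -
  have "(\<integral>\<^sup>+ x. f x \<partial>count_space E) = (\<integral>\<^sup>+ x. f x * indicator F x \<partial>count_space E)
            + (\<integral>\<^sup>+ x. f x * indicator (- F) x \<partial>count_space E)"
    by (subst nn_integral_add[symmetric]) (auto intro!: nn_integral_cong split: split_indicator)
  also have "(\<integral>\<^sup>+ x. f x * indicator F x \<partial>count_space E) = (\<Sum>x\<in>F. f x)"
    by (subst nn_integral_count_space'[of F]) (use F in \<open>auto split: split_indicator\<close>)
  also have "\<dots> + (\<integral>\<^sup>+ x. f x * indicator (- F) x \<partial>count_space E) \<le> (\<Sum>x\<in>F. f x) + e"
    by (rule add_left_mono[OF tail])
  finally have "e + e \<le> (\<Sum>x\<in>F. f x) + e" by (rule order_trans[OF mass])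
  then have le: "e \<le> (\<Sum>x\<in>F. f x)"
    using e by (metis add.commute ennreal_add_left_cancel_le infinity_ennreal_def less_irrefl)
  then have ne: "F \<noteq> {}" using e by auto
  obtain u where u: "u \<in> F" "\<And>x. x \<in> F \<Longrightarrow> f x \<le> f u"
  proof -
    have "Max (f ` F) \<in> f ` F" using F ne by (intro Max_in) auto
    then obtain u where "u \<in> F" "Max (f ` F) = f u" by auto
    with F that[of u] show thesis by (metis Max_ge finite_imageI imageI)
  qed
  have "(\<Sum>x\<in>F. f x) \<le> of_nat (card F) * f u"
    using u by (intro sum_bounded_above) auto
  with le have "e / of_nat (card F) \<le> f u"
    using ne F by (intro divide_le_posI_ennreal) (auto simp: card_gt_0_iff)
  with u show ?thesis using that by blast
qed

text \<open>
  If the overlap with \<open>\<pi>\<close> stayed below \<open>1 - 2 e\<close>, then the excess of \<open>K n x\<close> over \<open>\<pi>\<close> and of \<open>\<pi>\<close> over \<open>K n x\<close>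
  would each have mass \<open>2 e\<close>. Both are dominated by a multiple of \<open>\<pi>\<close>, so each of them has a heavy point in
  a finite set that does not depend on \<open>n\<close>. A fixed number of steps takes every point of this set
  to \<open>x\<close> with positive probability. The overlap would grow by a constant in each such period.
\<close>

lemma overlap_tendsto_1:
  fixes E :: "'s::countable set" and K :: "nat \<Rightarrow> 's \<Rightarrow> 's \<Rightarrow> ennreal"
  assumes stoch: "\<And>n. stochastic_on E (K n)"
    and CK: "\<And>m n x y. x \<in> E \<Longrightarrow> y \<in> E \<Longrightarrow> K (m + n) x y = push E (K m x) (K n) y"
    and inv: "\<And>n y. y \<in> E \<Longrightarrow> push E \<pi> (K n) y = \<pi> y"
    and mass: "(\<integral>\<^sup>+ y. \<pi> y \<partial>count_space E) = 1"
    and pos: "\<And>x y. x \<in> E \<Longrightarrow> y \<in> E \<Longrightarrow> \<exists>N. \<forall>n\<ge>N. 0 < K n x y"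
    and x: "x \<in> E"
  shows "(\<lambda>n. overlap E (K n x) \<pi>) \<longlonglongrightarrow> 1"
proof -
  define w where "w n = overlap E (K n x) \<pi>" for n
  have w_shift: "overlap E (push E (K n x) (K N)) (push E \<pi> (K N)) = w (n + N)" for n N
    unfolding w_def by (rule overlap_cong) (simp_all add: CK x inv)
  have "w n \<le> w (Suc n)" for n
    using overlap_le_push[OF stoch[of 1], of "K n x" \<pi>] w_shift[of n 1] by (simp add: w_def)
  then have "incseq w" by (rule incseq_SucI)
  then have lim: "w \<longlonglongrightarrow> (SUP n. w n)" by (rule LIMSEQ_SUP)
  have w1: "w n \<le> 1" for n unfolding w_def by (rule overlap_le_1[OF mass])
  have massK: "(\<integral>\<^sup>+ y. K n u y \<partial>count_space E) = 1" if "u \<in> E" for n u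
    using stoch that by (auto simp: stochastic_on_def)
  have \<pi>1: "\<pi> y \<le> 1" if "y \<in> E" for y
    using nn_integral_ge_point[OF that, of \<pi>] mass by simp
  have K1: "K n u y \<le> 1" if "u \<in> E" "y \<in> E" for n u y
    using nn_integral_ge_point[OF that(2), of "K n u"] massK[OF that(1), of n] by simp
  have \<pi>x: "0 < \<pi> x"
  proof -
    have "\<exists>y\<in>E. \<pi> y \<noteq> 0"
    proof (rule ccontr)
      assume "\<not> ?thesis"
      then have "(\<integral>\<^sup>+ y. \<pi> y \<partial>count_space E) = (\<integral>\<^sup>+ y. 0 \<partial>count_space E)"
        by (intro nn_integral_cong) auto
      with mass show False by simp
    qed
    then obtain y where y: "y \<in> E" "\<pi> y \<noteq> 0" by auto
    obtain N where "0 < K N y x" using pos[OF y(1) x] by auto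
    with y have "0 < \<pi> y * K N y x" by (simp add: ennreal_zero_less_mult_iff zero_less_iff_neq_zero)
    also have "\<dots> \<le> \<pi> x" using push_ge_point[OF y(1), of \<pi> "K N" x] inv[OF x] by simp
    finally show ?thesis .
  qed
  have "(SUP n. w n) = 1"
  proof (rule ccontr)
    assume "(SUP n. w n) \<noteq> 1"
    moreover have "(SUP n. w n) \<le> 1" by (intro SUP_least w1)
    ultimately have lt: "(SUP n. w n) < 1" by auto
    \<comment> \<open>Half of the limiting deficit: the excess on either side keeps mass \<open>2 e\<close>, and a tail of
      mass \<open>e\<close> may be cut off.\<close>
    define e where "e = ennreal (enn2real (1 - (SUP n. w n)) / 2)"
    have gap: "1 - (SUP n. w n) = e + e"
    proof -
      have "1 - (SUP n. w n) < top" by (rule le_less_trans[of _ 1]) (auto simp: diff_le_self_ennreal)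
      then show ?thesis unfolding e_def by (subst ennreal_plus[symmetric]) auto
    qed
    have e: "0 < e" "e < \<infinity>"
    proof -
      have "0 < 1 - (SUP n. w n)" using lt by (simp add: diff_gr0_ennreal)
      with gap show "0 < e" by (auto simp: zero_less_iff_neq_zero)
    qed (simp add: e_def)
    have gap': "e + e \<le> 1 - w n" for n
      unfolding gap[symmetric] by (intro ennreal_minus_mono SUP_upper) auto
    have dom: "\<pi> x * K n x y \<le> \<pi> y" if "y \<in> E" for n y
      using push_ge_point[OF x, of \<pi> "K n" y] inv[OF that] by simp
    obtain F where F: "finite F" "F \<subseteq> E" "(\<integral>\<^sup>+ y. \<pi> y * indicator (- F) y \<partial>count_space E) < e * \<pi> x"
      using finite_tail[of E \<pi> "e * \<pi> x"] e \<pi>x mass by (auto simp: ennreal_zero_less_mult_iff)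
    have tail\<pi>: "(\<integral>\<^sup>+ y. \<pi> y * indicator (- F) y \<partial>count_space E) \<le> e"
      using F(3) mult_left_mono[OF \<pi>1[OF x], of e] by simp
    \<comment> \<open>The factor \<open>\<pi> x\<close> in the choice of \<open>F\<close> pays for passing from \<open>\<pi>\<close> to \<open>K n x\<close>.\<close>
    have tailK: "(\<integral>\<^sup>+ y. K n x y * indicator (- F) y \<partial>count_space E) \<le> e" for n
    proof (rule ccontr)
      let ?T = "\<integral>\<^sup>+ y. K n x y * indicator (- F) y \<partial>count_space E"
      assume "\<not> ?T \<le> e"
      then have "e * \<pi> x \<le> ?T * \<pi> x" by (intro mult_right_mono) auto
      also have "\<dots> = (\<integral>\<^sup>+ y. (\<pi> x * K n x y) * indicator (- F) y \<partial>count_space E)"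
        by (subst nn_integral_multc[symmetric]) (auto simp: mult_ac)
      also have "\<dots> \<le> (\<integral>\<^sup>+ y. \<pi> y * indicator (- F) y \<partial>count_space E)"
        using dom by (intro nn_integral_mono mult_right_mono) auto
      finally show False using F(3) by simp
    qed
    have "\<exists>N. \<forall>u\<in>F. 0 < K N u x"
    proof -
      have "\<forall>u\<in>F. \<exists>N. \<forall>n\<ge>N. 0 < K n u x" using pos x F by blast
      then obtain N where N: "\<And>u n. u \<in> F \<Longrightarrow> N u \<le> n \<Longrightarrow> 0 < K n u x" by metis
      show ?thesis by (rule exI[of _ "\<Sum>u\<in>F. N u"]) (use F N in \<open>auto intro: member_le_sum\<close>)
    qed
    then obtain N where N: "\<And>u. u \<in> F \<Longrightarrow> 0 < K N u x" by auto
    define \<delta> where "\<delta> = Min (insert 1 ((\<lambda>u. K N u x) ` F))"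
    have \<delta>: "0 < \<delta>" "\<And>u. u \<in> F \<Longrightarrow> \<delta> \<le> K N u x" "\<delta> \<le> 1"
      using F N by (auto simp: \<delta>_def)
    define \<kappa> where "\<kappa> = e / of_nat (card F) * \<delta>"
    have gain: "\<kappa> \<le> push E f (K N) x"
      if f: "e + e \<le> (\<integral>\<^sup>+ y. f y \<partial>count_space E)" "(\<integral>\<^sup>+ y. f y * indicator (- F) y \<partial>count_space E) \<le> e" for f
    proof -
      obtain u where u: "u \<in> F" "e / of_nat (card F) \<le> f u"
        using heavy_point[OF F(1,2) e f] by blast
      then have "\<kappa> \<le> f u * K N u x" unfolding \<kappa>_def using \<delta> by (intro mult_mono) auto
      also have "\<dots> \<le> push E f (K N) x" using u F by (intro push_ge_point) auto
      finally show ?thesis .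
    qed
    have step: "w n + \<kappa> \<le> w (n + N)" for n
    proof -
      let ?a = "\<lambda>y. K n x y - min (K n x y) (\<pi> y)" and ?b = "\<lambda>y. \<pi> y - min (K n x y) (\<pi> y)"
      have "w n < \<infinity>" using w1[of n] by (auto intro: le_less_trans)
      then have "(\<integral>\<^sup>+ y. ?a y \<partial>count_space E) = 1 - w n" "(\<integral>\<^sup>+ y. ?b y \<partial>count_space E) = 1 - w n"
        by (subst nn_integral_diff; force simp: w_def overlap_def massK x mass AE_count_space)+
      moreover have "(\<integral>\<^sup>+ y. ?a y * indicator (- F) y \<partial>count_space E) \<le> e"
        by (rule order_trans[OF nn_integral_mono tailK[of n]]) (auto intro!: mult_right_mono diff_le_self_ennreal)
      moreover have "(\<integral>\<^sup>+ y. ?b y * indicator (- F) y \<partial>count_space E) \<le> e"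
        by (rule order_trans[OF nn_integral_mono tail\<pi>]) (auto intro!: mult_right_mono diff_le_self_ennreal)
      ultimately have "\<kappa> \<le> min (push E ?a (K N) x) (push E ?b (K N) x)"
        using gap'[of n] by (intro min.boundedI gain) auto
      then have "w n + \<kappa> \<le> overlap E (K n x) \<pi> + min (push E ?a (K N) x) (push E ?b (K N) x)"
        unfolding w_def by (rule add_left_mono)
      also have "\<dots> \<le> overlap E (push E (K n x) (K N)) (push E \<pi> (K N))"
        using K1[OF x] \<pi>1 by (intro overlap_push[OF stoch x]) (auto intro: le_less_trans[of _ 1])
      finally show ?thesis by (simp add: w_shift)
    qed
    have grow: "of_nat j * \<kappa> \<le> w (j * N)" for j
    proof (induction j)
      case (Suc j)
      have "of_nat (Suc j) * \<kappa> = of_nat j * \<kappa> + \<kappa>" by (simp add: distrib_right add.commute)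
      also have "\<dots> \<le> w (j * N) + \<kappa>" by (intro add_right_mono Suc.IH)
      also have "\<dots> \<le> w (Suc j * N)" using step[of "j * N"] by (simp add: add.commute)
      finally show ?case .
    qed simp
    have "e + e \<le> (\<integral>\<^sup>+ y. K 0 x y \<partial>count_space E)"
      unfolding massK[OF x] by (rule order_trans[OF gap'[of 0] diff_le_self_ennreal])
    then obtain u where "u \<in> F" using heavy_point[OF F(1,2) e _ tailK[of 0]] by blast
    then have "F \<noteq> {}" by auto
    then have "0 < \<kappa>" using e \<delta> F by (auto simp: \<kappa>_def ennreal_zero_less_mult_iff ennreal_zero_less_divide ennreal_of_nat_eq_real_of_nat)
    moreover have "\<kappa> \<le> 1" using grow[of 1] w1[of "1 * N"] by simp
    ultimately obtain k where k: "\<kappa> = ennreal k" "0 < k"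
      by (cases \<kappa>) (auto simp: top_unique)
    obtain j where "1 < of_nat j * k" using reals_Archimedean3[OF k(2)] by blast
    then have "1 < of_nat j * \<kappa>"
      using k by (auto simp: ennreal_of_nat_eq_real_of_nat ennreal_1[symmetric] ennreal_less_iff simp del: ennreal_1 simp flip: ennreal_mult)
    with grow[of j] w1[of "j * N"] show False by simp
  qed
  with lim show ?thesis by (simp add: w_def[symmetric])
qed

section \<open>Invariant measures as limits of averages\<close>

text \<open>
  The averages are bounded at each point, and a diagonal subsequence converges. Applying the kernel
  shifts the sum by one index, which changes an average by at most \<open>1 / N\<close>. Fatou's lemma leaves an
  inequality, since mass may escape to infinity.
\<close>

lemma cesaro_subinvariant:
  fixes E :: "'s::countable set" and a :: "nat \<Rightarrow> 's \<Rightarrow> ennreal"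
  assumes p: "stochastic_on E p"
    and step: "\<And>n y. y \<in> E \<Longrightarrow> a (Suc n) y = push E (a n) p y"
    and mass: "\<And>n. (\<integral>\<^sup>+ y. a n y \<partial>count_space E) = 1"
  obtains \<rho> r where "strict_mono (r::nat \<Rightarrow> nat)"
    "\<And>y. y \<in> E \<Longrightarrow> (\<lambda>n. (\<Sum>i<r n. a i y) / of_nat (r n)) \<longlonglongrightarrow> \<rho> y"
    "\<And>y. y \<in> E \<Longrightarrow> push E \<rho> p y \<le> \<rho> y" "(\<integral>\<^sup>+ y. \<rho> y \<partial>count_space E) \<le> 1"
proof -
  define A where "A N y = (\<Sum>i<N. a i y) / of_nat N" for N y
  define f where "f N y = (if y \<in> E then enn2real (A N y) else 0)" for N y
  have a1: "a n y \<le> 1" if "y \<in> E" for n y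
    using nn_integral_ge_point[OF that, of "a n"] mass[of n] by simp
  have div_le: "of_nat N / of_nat N \<le> (1::ennreal)" for N
    by (cases "N = 0") (auto simp: ennreal_divide_self ennreal_of_nat_eq_real_of_nat)
  have A1: "A N y \<le> 1" if "y \<in> E" for N y
  proof -
    have "A N y \<le> of_nat N / of_nat N"
      unfolding A_def using a1[OF that] sum_bounded_above[of "{..<N}" "\<lambda>i. a i y" 1] by (intro divide_right_mono_ennreal) auto
    then show ?thesis using div_le by (rule order_trans)
  qed
  have f01: "f N y \<in> {0..1}" for N y
    using enn2real_mono[OF A1[of y N]] by (simp add: f_def)
  let ?P = "\<lambda>n. \<lambda>s. convergent (\<lambda>k. f (s k) (from_nat n))"
  interpret nat: subseqs ?P
  proof (rule subseqs.intro)
    fix n :: nat and s :: "nat \<Rightarrow> nat" assume "strict_mono s"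
    have "seq_compact {0..1::real}" by (intro compact_imp_seq_compact compact_Icc)
    moreover have "\<forall>k. f (s k) (from_nat n) \<in> {0..1}" using f01 by (rule allI)
    ultimately obtain l r where r: "strict_mono (r::nat \<Rightarrow> nat)"
        "((\<lambda>k. f (s k) (from_nat n)) \<circ> r) \<longlonglongrightarrow> l"
      by (rule seq_compactE)
    from r(2) have "convergent (\<lambda>k. f ((s \<circ> r) k) (from_nat n))"
      unfolding comp_def convergent_def by (rule exI)
    with r(1) show "\<exists>r. strict_mono r \<and> convergent (\<lambda>k. f ((s \<circ> r) k) (from_nat n))"
      by (intro exI[of _ r] conjI)
  qed
  define d where "d = nat.diagseq"
  have d: "strict_mono d" unfolding d_def using nat.subseq_diagseq by auto
  have conv: "convergent (\<lambda>k. f (d k) y)" for y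
  proof -
    let ?n = "to_nat y"
    have 1: "?P ?n (nat.seqseq (Suc ?n))" by (rule nat.seqseq_holds)
    have 2: "(\<lambda>k. f ((nat.seqseq (Suc ?n) \<circ> (\<lambda>k. nat.fold_reduce (Suc ?n) k (Suc ?n + k))) k) (from_nat ?n)) =
        (\<lambda>k. f (nat.seqseq (Suc ?n) k) (from_nat ?n)) \<circ> (\<lambda>k. nat.fold_reduce (Suc ?n) k (Suc ?n + k))"
      by auto
    have "?P ?n (d \<circ> ((+) (Suc ?n)))"
      unfolding d_def nat.diagseq_seqseq 2
      by (intro convergent_subseq_convergent 1 nat.subseq_diagonal_rest)
    then obtain L where "(\<lambda>k. f (d (k + Suc ?n)) y) \<longlonglongrightarrow> L"
      by (auto simp: add.commute dest: convergentD)
    then have "(\<lambda>k. f (d k) y) \<longlonglongrightarrow> L" by (rule LIMSEQ_offset)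
    then show ?thesis by (auto simp: convergent_def)
  qed
  define \<rho> where "\<rho> y = ennreal (lim (\<lambda>k. f (d k) y))" for y
  have lim: "(\<lambda>k. A (d k) y) \<longlonglongrightarrow> \<rho> y" if "y \<in> E" for y
  proof -
    have "(\<lambda>k. ennreal (f (d k) y)) \<longlonglongrightarrow> \<rho> y"
      unfolding \<rho>_def using conv[of y] by (intro tendsto_ennrealI) (simp add: convergent_LIMSEQ_iff)
    moreover have "ennreal (f N y) = A N y" for N
      unfolding f_def if_P[OF that] by (rule ennreal_enn2real, rule le_less_trans[OF A1[OF that]]) simp
    ultimately show ?thesis by simp
  qed
  have sub: "push E \<rho> p y \<le> \<rho> y" if y: "y \<in> E" for y
  proof -
    have p1: "p x y < top" if "x \<in> E" for x
    proof -
      have "p x y \<le> 1" using p nn_integral_ge_point[OF y, of "p x"] that by (auto simp: stochastic_on_def)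
      then show ?thesis by (auto intro: le_less_trans)
    qed
    have "push E \<rho> p y = (\<integral>\<^sup>+ x. liminf (\<lambda>k. A (d k) x * p x y) \<partial>count_space E)"
      unfolding push_def
    proof (rule nn_integral_cong)
      fix x assume "x \<in> space (count_space E)"
      then have x: "x \<in> E" by simp
      have "(\<lambda>k. p x y * A (d k) x) \<longlonglongrightarrow> p x y * \<rho> x"
        by (intro ennreal_tendsto_cmult p1 lim x)
      then have "(\<lambda>k. A (d k) x * p x y) \<longlonglongrightarrow> \<rho> x * p x y"
        by (simp only: mult.commute[of "p x y"])
      then show "\<rho> x * p x y = liminf (\<lambda>k. A (d k) x * p x y)"
        by (rule lim_imp_Liminf[OF trivial_limit_sequentially, symmetric])
    qed
    also have "\<dots> \<le> liminf (\<lambda>k. push E (A (d k)) p y)"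
      unfolding push_def by (rule nn_integral_liminf) auto
    also have "\<dots> \<le> liminf (\<lambda>k. A (d k) y + 1 / of_nat (d k))"
    proof (intro Liminf_mono always_eventually allI)
      fix k
      let ?N = "d k"
      have "push E (A ?N) p y = (\<Sum>i<?N. push E (a i) p y) / of_nat ?N"
        unfolding A_def divide_ennreal_def mult.commute[of _ "inverse _"] push_cmult push_sum by simp
      also have "\<dots> = (\<Sum>i<?N. a (Suc i) y) / of_nat ?N" using step[OF y] by simp
      finally have eq: "push E (A ?N) p y = (\<Sum>i<?N. a (Suc i) y) / of_nat ?N" .
      have "(\<Sum>i<?N. a (Suc i) y) \<le> a 0 y + (\<Sum>i<?N. a (Suc i) y)" by simp
      also have "\<dots> = (\<Sum>i<Suc ?N. a i y)" by (simp only: sum.lessThan_Suc_shift)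
      also have "\<dots> \<le> (\<Sum>i<?N. a i y) + 1" using a1[OF y, of ?N] by (simp add: add_left_mono)
      finally have "(\<Sum>i<?N. a (Suc i) y) / of_nat ?N \<le> ((\<Sum>i<?N. a i y) + 1) / of_nat ?N"
        by (rule divide_right_mono_ennreal)
      then show "push E (A ?N) p y \<le> A ?N y + 1 / of_nat ?N"
        by (simp only: eq A_def add_divide_distrib_ennreal)
    qed
    also have "\<dots> = \<rho> y"
    proof -
      have "(\<lambda>k. ennreal (1 / real (d k))) \<longlonglongrightarrow> ennreal 0"
        using LIMSEQ_subseq_LIMSEQ[OF lim_1_over_n d] by (intro tendsto_ennrealI) (auto simp: comp_def)
      moreover have "eventually (\<lambda>k. ennreal (1 / real (d k)) = 1 / of_nat (d k)) sequentially"
        using eventually_gt_at_top[of 0]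
      proof eventually_elim
        case (elim k)
        then have "0 < d k" using seq_suble[OF d, of k] by simp
        then show ?case
          using divide_ennreal[of 1 "real (d k)"] by (simp add: ennreal_of_nat_eq_real_of_nat)
      qed
      ultimately have "(\<lambda>k. 1 / of_nat (d k)) \<longlonglongrightarrow> (0::ennreal)"
        by (auto dest: Lim_transform_eventually)
      with lim[OF y] have "(\<lambda>k. A (d k) y + 1 / of_nat (d k)) \<longlonglongrightarrow> \<rho> y + 0"
        by (rule tendsto_add)
      then show ?thesis using lim_imp_Liminf[OF trivial_limit_sequentially] by simp
    qed
    finally show ?thesis .
  qed
  have "(\<integral>\<^sup>+ y. \<rho> y \<partial>count_space E) = (\<integral>\<^sup>+ y. liminf (\<lambda>k. A (d k) y) \<partial>count_space E)"
    by (intro nn_integral_cong lim_imp_Liminf[symmetric] lim) auto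
  also have "\<dots> \<le> liminf (\<lambda>k. \<integral>\<^sup>+ y. A (d k) y \<partial>count_space E)"
    by (rule nn_integral_liminf) auto
  also have "\<dots> \<le> liminf (\<lambda>k. 1)"
  proof (intro Liminf_mono always_eventually allI)
    fix k
    have "(\<integral>\<^sup>+ y. A (d k) y \<partial>count_space E) = of_nat (d k) / of_nat (d k)"
      unfolding A_def by (simp add: nn_integral_divide nn_integral_sum mass)
    with div_le show "(\<integral>\<^sup>+ y. A (d k) y \<partial>count_space E) \<le> 1" by simp
  qed
  also have "\<dots> = 1" by (simp add: Liminf_const)
  finally show ?thesis by (intro that[of d \<rho>, OF d] lim[unfolded A_def] sub)
qed

text \<open>
  Fatou's lemma for the sums \<open>\<Sum> m(x) K n x y\<close>. It is used with \<open>0 < c\<close> to show that \<open>m\<close> is finite.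
\<close>

lemma subinvariant_mass_bound:
  assumes sub: "\<And>n. push E m (K n) y \<le> m y"
    and lim: "\<And>x. x \<in> E \<Longrightarrow> (\<lambda>n. K n x y) \<longlonglongrightarrow> c"
    and fin: "\<And>x. x \<in> E \<Longrightarrow> m x < \<infinity>"
  shows "(\<integral>\<^sup>+ x. m x \<partial>count_space E) * c \<le> m y"
proof -
  have "(\<integral>\<^sup>+ x. m x \<partial>count_space E) * c = (\<integral>\<^sup>+ x. m x * c \<partial>count_space E)"
    by (simp add: nn_integral_multc)
  also have "\<dots> = (\<integral>\<^sup>+ x. liminf (\<lambda>n. m x * K n x y) \<partial>count_space E)"
    by (intro nn_integral_cong lim_imp_Liminf[symmetric] ennreal_tendsto_cmult lim) (use fin in auto)
  also have "\<dots> \<le> liminf (\<lambda>n. push E m (K n) y)"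
    unfolding push_def by (rule nn_integral_liminf) auto
  also have "\<dots> \<le> liminf (\<lambda>n::nat. m y)"
    using sub by (intro Liminf_mono always_eventually) auto
  also have "\<dots> = m y" by (simp add: Liminf_const)
  finally show ?thesis .
qed

section \<open>The Markov property along a grid of times\<close>

definition depends_up_to :: "nat \<Rightarrow> ((nat \<Rightarrow> 's) \<Rightarrow> bool) \<Rightarrow> bool" where
  "depends_up_to m \<Phi> \<longleftrightarrow> (\<forall>f g. (\<forall>i\<le>m. f i = g i) \<longrightarrow> \<Phi> f = \<Phi> g)"

lemma up_toI:
  assumes "\<And>f g. (\<And>i. i \<le> m \<Longrightarrow> f i = g i) \<Longrightarrow> \<Phi> f = \<Phi> g"
  shows "depends_up_to m \<Phi>"
  unfolding depends_up_to_def by (intro allI impI assms) simp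

lemma up_toD:
  assumes "depends_up_to m \<Phi>" "\<And>i. i \<le> m \<Longrightarrow> f i = g i"
  shows "\<Phi> f = \<Phi> g"
proof -
  from assms(1)[unfolded depends_up_to_def, THEN spec[of _ f], THEN spec[of _ g]] assms(2)
  show ?thesis by simp
qed

lemma depends_up_to_mono:
  assumes "depends_up_to m \<Phi>" "m \<le> n"
  shows "depends_up_to n \<Phi>"
  by (rule up_toI, rule up_toD[OF assms(1)]) (use assms(2) in simp)

lemma depends_up_to_conj:
  assumes "depends_up_to m \<Phi>" "depends_up_to m \<Psi>"
  shows "depends_up_to m (\<lambda>f. \<Phi> f \<and> \<Psi> f)"
proof (rule up_toI)
  fix f g :: "nat \<Rightarrow> 'a" assume eq: "\<And>i. i \<le> m \<Longrightarrow> f i = g i"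
  have "\<Phi> f = \<Phi> g" "\<Psi> f = \<Psi> g"
    by (rule up_toD[OF assms(1) eq], assumption) (rule up_toD[OF assms(2) eq], assumption)
  then show "(\<Phi> f \<and> \<Psi> f) = (\<Phi> g \<and> \<Psi> g)" by simp
qed

lemma depends_up_to_eq: "i \<le> m \<Longrightarrow> depends_up_to m (\<lambda>f. f i = y)"
  by (auto simp: depends_up_to_def)

locale jump_process =
  fixes E :: "'s::countable set" and q :: "'s \<Rightarrow> 's \<Rightarrow> real"
    and P :: "'s \<Rightarrow> 'w measure" and Z :: "real \<Rightarrow> 'w \<Rightarrow> 's"
  assumes mjp: "markov_jump_process E q P Z"
begin

lemma prob_space_P: "x \<in> E \<Longrightarrow> prob_space (P x)"
  using mjp by (auto simp: markov_jump_process_def)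

lemma Z_measurable: "x \<in> E \<Longrightarrow> 0 \<le> t \<Longrightarrow> Z t \<in> P x \<rightarrow>\<^sub>M count_space E"
  using mjp by (auto simp: markov_jump_process_def)

lemma Z_in_E: "x \<in> E \<Longrightarrow> 0 \<le> t \<Longrightarrow> \<omega> \<in> space (P x) \<Longrightarrow> Z t \<omega> \<in> E"
  using measurable_space[OF Z_measurable] by auto

lemma Z_0: "x \<in> E \<Longrightarrow> AE \<omega> in P x. Z 0 \<omega> = x"
  using mjp by (auto simp: markov_jump_process_def)

lemma right_continuous: "x \<in> E \<Longrightarrow> AE \<omega> in P x. \<forall>t\<ge>0. \<forall>\<^sub>F s in at_right t. Z s \<omega> = Z t \<omega>"
  using mjp by (auto simp: markov_jump_process_def)

text \<open>
  The transition function, as a kernel in the sense of \<open>push\<close>.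
\<close>

definition tp :: "real \<Rightarrow> 's \<Rightarrow> 's \<Rightarrow> ennreal" where
  "tp t x y = emeasure (P x) {\<omega> \<in> space (P x). Z t \<omega> = y}"

lemma tp_eq: "x \<in> E \<Longrightarrow> tp t x y = ennreal (trans_prob P Z x t y)"
  unfolding tp_def trans_prob_def
  using finite_measure.emeasure_eq_measure[OF prob_space.finite_measure[OF prob_space_P]] by auto

lemma Z_sets:
  assumes "x \<in> E" "0 \<le> t"
  shows "{\<omega> \<in> space (P x). Z t \<omega> \<in> A} \<in> sets (P x)"
proof -
  have "Z t -` (A \<inter> E) \<inter> space (P x) \<in> sets (P x)"
    by (rule measurable_sets[OF Z_measurable[OF assms]]) auto
  also have "Z t -` (A \<inter> E) \<inter> space (P x) = {\<omega> \<in> space (P x). Z t \<omega> \<in> A}"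
    using Z_in_E[OF assms] by auto
  finally show ?thesis .
qed

lemma Z_eq_sets:
  assumes "x \<in> E" "0 \<le> t"
  shows "{\<omega> \<in> space (P x). Z t \<omega> = y} \<in> sets (P x)"
  using Z_sets[OF assms, of "{y}"] by simp

abbreviation history :: "(nat \<Rightarrow> real) \<Rightarrow> nat \<Rightarrow> 'w \<Rightarrow> 's list" where
  "history \<tau> m \<omega> \<equiv> map (\<lambda>i. Z (\<tau> i) \<omega>) [0..<m]"

lemma history_eq_iff: "history \<tau> m \<omega> = l \<longleftrightarrow> length l = m \<and> (\<forall>i<m. Z (\<tau> i) \<omega> = l ! i)"
  by (auto simp: list_eq_iff_nth_eq)

lemma history_sets:
  assumes x: "x \<in> E" and \<tau>: "\<And>i. i < m \<Longrightarrow> 0 \<le> \<tau> i"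
  shows "{\<omega> \<in> space (P x). \<Phi> (history \<tau> m \<omega>)} \<in> sets (P x)"
proof -
  have "{\<omega> \<in> space (P x). history \<tau> m \<omega> = l} \<in> sets (P x)" for l
  proof (cases "length l = m")
    case True
    have "{\<omega> \<in> space (P x). \<forall>i\<in>{..<m}. Z (\<tau> i) \<omega> = l ! i} \<in> sets (P x)"
    proof (rule sets.sets_Collect_finite_All)
      fix i assume "i \<in> {..<m}"
      then have "0 \<le> \<tau> i" by (intro \<tau>) simp
      then show "{\<omega> \<in> space (P x). Z (\<tau> i) \<omega> = l ! i} \<in> sets (P x)" by (rule Z_eq_sets[OF x])
    qed simp
    also have "{\<omega> \<in> space (P x). \<forall>i\<in>{..<m}. Z (\<tau> i) \<omega> = l ! i} = {\<omega> \<in> space (P x). history \<tau> m \<omega> = l}"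
      unfolding history_eq_iff using True by auto
    finally show ?thesis .
  qed (simp add: history_eq_iff)
  then have "(\<Union>l\<in>{l. \<Phi> l}. {\<omega> \<in> space (P x). history \<tau> m \<omega> = l}) \<in> sets (P x)"
    by (intro sets.countable_UN'') auto
  also have "(\<Union>l\<in>{l. \<Phi> l}. {\<omega> \<in> space (P x). history \<tau> m \<omega> = l}) = {\<omega> \<in> space (P x). \<Phi> (history \<tau> m \<omega>)}"
    by auto
  finally show ?thesis .
qed

lemma markov_point:
  assumes x: "x \<in> E" and uv: "u \<in> E" "v \<in> E" and st: "0 \<le> s" "s \<le> t"
    and \<tau>: "\<And>i. i < m \<Longrightarrow> 0 \<le> \<tau> i \<and> \<tau> i \<le> s"
  shows "emeasure (P x) {\<omega> \<in> space (P x). history \<tau> m \<omega> = l \<and> Z s \<omega> = u \<and> Z t \<omega> = v}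
    = emeasure (P x) {\<omega> \<in> space (P x). history \<tau> m \<omega> = l \<and> Z s \<omega> = u} * tp (t - s) u v"
proof (cases "length l = m \<and> (\<forall>i<m. l ! i \<in> E)")
  case False
  have "Z (\<tau> i) \<omega> \<in> E" if "i < m" "\<omega> \<in> space (P x)" for i \<omega>
    using Z_in_E[OF x _ that(2)] \<tau>[OF that(1)] by blast
  with False have e: "{\<omega> \<in> space (P x). history \<tau> m \<omega> = l \<and> Q \<omega>} = {}" for Q
    unfolding history_eq_iff by fastforce
  show ?thesis unfolding e by simp
next
  case True
  interpret prob_space "P x" by (rule prob_space_P[OF x])
  define A where "A = {\<omega> \<in> space (P x). Z s \<omega> = u \<and> (\<forall>i<m. Z (\<tau> i) \<omega> = l ! i)}"
  define B where "B = {\<omega> \<in> space (P x). Z t \<omega> = v \<and> Z s \<omega> = u \<and> (\<forall>i<m. Z (\<tau> i) \<omega> = l ! i)}"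
  have hA: "{\<omega> \<in> space (P x). history \<tau> m \<omega> = l \<and> Z s \<omega> = u} = A"
    using True by (auto simp: history_eq_iff A_def)
  have hB: "{\<omega> \<in> space (P x). history \<tau> m \<omega> = l \<and> Z s \<omega> = u \<and> Z t \<omega> = v} = B"
    using True by (auto simp: history_eq_iff B_def)
  have Aset: "A \<in> sets (P x)"
  proof -
    have "{\<omega> \<in> space (P x). history \<tau> m \<omega> = l} \<inter> {\<omega> \<in> space (P x). Z s \<omega> = u} \<in> sets (P x)"
      using x st \<tau> by (intro sets.Int history_sets Z_eq_sets) auto
    then show ?thesis unfolding hA[symmetric] by (simp add: Collect_conj_eq Int_ac)
  qed
  have "measure (P x) B = measure (P x) A * trans_prob P Z u (t - s) v"
  proof (cases "measure (P x) A = 0")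
    case True
    have "measure (P x) B \<le> measure (P x) A"
      by (rule finite_measure_mono[OF _ Aset]) (auto simp: A_def B_def)
    with True show ?thesis by (simp add: measure_le_0_iff)
  next
    case neq: False
    have "\<P>(\<omega> in P x. Z t \<omega> = v \<bar> Z s \<omega> = u \<and> (\<forall>i<m. Z (\<tau> i) \<omega> = l ! i)) = trans_prob P Z u (t - s) v"
    proof (rule mjp[unfolded markov_jump_process_def, THEN conjunct2, THEN conjunct2, THEN conjunct2,
          THEN conjunct1, rule_format, OF x uv st])
      show "0 \<le> \<tau> i \<and> \<tau> i \<le> s \<and> l ! i \<in> E" if "i < m" for i
        using \<tau>[OF that] True that by simp
      show "\<P>(\<omega> in P x. Z s \<omega> = u \<and> (\<forall>i<m. Z (\<tau> i) \<omega> = l ! i)) \<noteq> 0"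
        using neq by (simp only: A_def simp_thms)
    qed
    then have "measure (P x) B / measure (P x) A = trans_prob P Z u (t - s) v"
      unfolding cond_prob_def A_def B_def by simp
    with neq show ?thesis by (simp add: field_simps)
  qed
  then show ?thesis unfolding hA hB tp_eq[OF uv(1)] emeasure_eq_measure
    by (simp add: ennreal_mult' trans_prob_def)
qed

text \<open>
  The Markov property for an arbitrary event of finitely many past times, obtained by summing over the
  countably many histories.
\<close>

lemma markov_event:
  assumes x: "x \<in> E" and uv: "u \<in> E" "v \<in> E" and st: "0 \<le> s" "s \<le> t"
    and \<tau>: "\<And>i. i < m \<Longrightarrow> 0 \<le> \<tau> i \<and> \<tau> i \<le> s"
  shows "emeasure (P x) {\<omega> \<in> space (P x). \<Phi> (history \<tau> m \<omega>) \<and> Z s \<omega> = u \<and> Z t \<omega> = v}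
    = emeasure (P x) {\<omega> \<in> space (P x). \<Phi> (history \<tau> m \<omega>) \<and> Z s \<omega> = u} * tp (t - s) u v"
proof -
  have split: "emeasure (P x) {\<omega> \<in> space (P x). \<Phi> (history \<tau> m \<omega>) \<and> Q \<omega>} =
    (\<integral>\<^sup>+ l. emeasure (P x) {\<omega> \<in> space (P x). history \<tau> m \<omega> = l \<and> Q \<omega>} \<partial>count_space {l. \<Phi> l})"
    if Q: "{\<omega> \<in> space (P x). Q \<omega>} \<in> sets (P x)" for Q
  proof -
    have "{\<omega> \<in> space (P x). history \<tau> m \<omega> = l \<and> Q \<omega>} \<in> sets (P x)" for l
      using sets.Int[OF history_sets[OF x, of m \<tau> "\<lambda>h. h = l"] Q] \<tau> by (simp add: Collect_conj_eq Int_ac)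
    then have "emeasure (P x) (\<Union>l\<in>{l. \<Phi> l}. {\<omega> \<in> space (P x). history \<tau> m \<omega> = l \<and> Q \<omega>}) =
      (\<integral>\<^sup>+ l. emeasure (P x) {\<omega> \<in> space (P x). history \<tau> m \<omega> = l \<and> Q \<omega>} \<partial>count_space {l. \<Phi> l})"
      by (intro emeasure_UN_countable) (auto simp: disjoint_family_on_def)
    also have "(\<Union>l\<in>{l. \<Phi> l}. {\<omega> \<in> space (P x). history \<tau> m \<omega> = l \<and> Q \<omega>})
        = {\<omega> \<in> space (P x). \<Phi> (history \<tau> m \<omega>) \<and> Q \<omega>}" by auto
    finally show ?thesis .
  qed
  have sets: "{\<omega> \<in> space (P x). Z s \<omega> = u} \<in> sets (P x)" 
    "{\<omega> \<in> space (P x). Z s \<omega> = u \<and> Z t \<omega> = v} \<in> sets (P x)"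
    using sets.Int[OF Z_eq_sets[OF x, of s u] Z_eq_sets[OF x, of t v]] Z_eq_sets[OF x, of s u] st
    by (auto simp: Collect_conj_eq Int_ac)
  have "emeasure (P x) {\<omega> \<in> space (P x). history \<tau> m \<omega> = l \<and> Z s \<omega> = u \<and> Z t \<omega> = v}
      = emeasure (P x) {\<omega> \<in> space (P x). history \<tau> m \<omega> = l \<and> Z s \<omega> = u} * tp (t - s) u v" for l
    by (rule markov_point[OF x uv st]) (rule \<tau>)
  then show ?thesis
    unfolding split[OF sets(1)] split[OF sets(2)] by (simp only: nn_integral_multc borel_measurable_count_space)
qed

lemma split_state:
  assumes x: "x \<in> E" and s: "0 \<le> s" and A: "{\<omega> \<in> space (P x). Q \<omega>} \<in> sets (P x)"
  shows "emeasure (P x) {\<omega> \<in> space (P x). Q \<omega>}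
    = (\<integral>\<^sup>+ u. emeasure (P x) {\<omega> \<in> space (P x). Q \<omega> \<and> Z s \<omega> = u} \<partial>count_space E)"
proof -
  have "{\<omega> \<in> space (P x). Q \<omega> \<and> Z s \<omega> = u} \<in> sets (P x)" for u
    using sets.Int[OF A Z_eq_sets[OF x s]] by (simp add: Collect_conj_eq Int_ac)
  then have "emeasure (P x) (\<Union>u\<in>E. {\<omega> \<in> space (P x). Q \<omega> \<and> Z s \<omega> = u})
    = (\<integral>\<^sup>+ u. emeasure (P x) {\<omega> \<in> space (P x). Q \<omega> \<and> Z s \<omega> = u} \<partial>count_space E)"
    by (intro emeasure_UN_countable) (auto simp: disjoint_family_on_def)
  also have "(\<Union>u\<in>E. {\<omega> \<in> space (P x). Q \<omega> \<and> Z s \<omega> = u}) = {\<omega> \<in> space (P x). Q \<omega>}"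
    using Z_in_E[OF x s] by auto
  finally show ?thesis .
qed

lemma markov_sum:
  assumes x: "x \<in> E" and v: "v \<in> E" and st: "0 \<le> s" "s \<le> t"
    and \<tau>: "\<And>i. i < m \<Longrightarrow> 0 \<le> \<tau> i \<and> \<tau> i \<le> s"
  shows "emeasure (P x) {\<omega> \<in> space (P x). \<Phi> (history \<tau> m \<omega>) \<and> Z t \<omega> = v}
    = push E (\<lambda>u. emeasure (P x) {\<omega> \<in> space (P x). \<Phi> (history \<tau> m \<omega>) \<and> Z s \<omega> = u}) (tp (t - s)) v"
proof -
  have "{\<omega> \<in> space (P x). \<Phi> (history \<tau> m \<omega>) \<and> Z t \<omega> = v} \<in> sets (P x)"
    using sets.Int[OF history_sets[OF x, of m \<tau> \<Phi>] Z_eq_sets[OF x, of t v]] \<tau> st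
    by (simp add: Collect_conj_eq Int_ac)
  from split_state[OF x st(1) this] show ?thesis
    unfolding push_def using markov_event[OF x _ v st \<tau>, where \<Phi> = \<Phi>]
    by (simp add: conj_ac cong: nn_integral_cong_simp)
qed

lemma tp_CK:
  assumes "x \<in> E" "y \<in> E" "0 \<le> s" "0 \<le> t"
  shows "tp (s + t) x y = push E (tp s x) (tp t) y"
  using markov_sum[OF assms(1,2,3), where t = "s + t" and m = 0 and \<Phi> = "\<lambda>_. True"] assms(4) by (simp add: tp_def[abs_def])

lemma stochastic_tp: "0 \<le> t \<Longrightarrow> stochastic_on E (tp t)"
  unfolding stochastic_on_def tp_def
  using split_state[of _ t "\<lambda>_. True"] prob_space.emeasure_space_1[OF prob_space_P] by simp

lemma tp_le_1: "x \<in> E \<Longrightarrow> tp t x y \<le> 1"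
  unfolding tp_def by (rule prob_space.emeasure_le_1[OF prob_space_P])

lemma tp_0: "x \<in> E \<Longrightarrow> tp 0 x y = (if y = x then 1 else 0)"
proof -
  assume x: "x \<in> E"
  interpret prob_space "P x" by (rule prob_space_P[OF x])
  have "tp 0 x y = emeasure (P x) {\<omega> \<in> space (P x). x = y}"
    unfolding tp_def using Z_0[OF x] Z_eq_sets[OF x, of 0 y] by (intro emeasure_eq_AE) auto
  then show ?thesis by (auto simp: emeasure_space_1)
qed

definition grid_prob :: "'s \<Rightarrow> real \<Rightarrow> ((nat \<Rightarrow> 's) \<Rightarrow> bool) \<Rightarrow> ennreal" where
  "grid_prob x h \<Phi> = emeasure (P x) {\<omega> \<in> space (P x). \<Phi> (\<lambda>i. Z (real i * h) \<omega>)}"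

lemma grid_history:
  assumes "depends_up_to m \<Phi>"
  shows "\<Phi> (\<lambda>i. Z (real i * h) \<omega>) = \<Phi> (\<lambda>i. history (\<lambda>i. real i * h) (Suc m) \<omega> ! i)"
proof (rule up_toD[OF assms])
  fix i assume "i \<le> m"
  then show "Z (real i * h) \<omega> = history (\<lambda>i. real i * h) (Suc m) \<omega> ! i"
    by (subst nth_map) (simp_all del: upt_Suc)
qed

lemma grid_sets:
  assumes "x \<in> E" "0 \<le> h" "depends_up_to m \<Phi>"
  shows "{\<omega> \<in> space (P x). \<Phi> (\<lambda>i. Z (real i * h) \<omega>)} \<in> sets (P x)"
  unfolding grid_history[OF assms(3)] using assms(1,2) by (intro history_sets) auto

lemma grid_mono:
  assumes "x \<in> E" "0 \<le> h" "depends_up_to m \<Psi>" "\<And>f. \<Phi> f \<Longrightarrow> \<Psi> f"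
  shows "grid_prob x h \<Phi> \<le> grid_prob x h \<Psi>"
  unfolding grid_prob_def using assms by (intro emeasure_mono grid_sets) auto

lemma grid_le_1: "x \<in> E \<Longrightarrow> grid_prob x h \<Phi> \<le> 1"
  unfolding grid_prob_def by (rule prob_space.emeasure_le_1[OF prob_space_P])

lemma grid_single: "grid_prob x h (\<lambda>f. f m = y) = tp (real m * h) x y"
  by (simp add: grid_prob_def tp_def)

text \<open>
  Every recursion below is an instance of this one: the last step of the grid chain is independent of
  its past given its present state.
\<close>

lemma grid_step:
  assumes "x \<in> E" "v \<in> E" "0 \<le> h" "depends_up_to m \<Phi>"
  shows "grid_prob x h (\<lambda>f. \<Phi> f \<and> f (Suc m) = v)
    = push E (\<lambda>u. grid_prob x h (\<lambda>f. \<Phi> f \<and> f m = u)) (tp h) v"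
proof -
  have "real i * h \<le> real m * h" if "i < Suc m" for i
    using that assms(3) by (intro mult_right_mono) auto
  then show ?thesis
    using markov_sum[OF assms(1,2), of "real m * h" "real (Suc m) * h" "Suc m" "\<lambda>i. real i * h"
       "\<lambda>l. \<Phi> (\<lambda>i. l ! i)"] assms(3)
    unfolding grid_prob_def grid_history[OF assms(4)]
    by (simp add: algebra_simps del: upt_Suc)
qed

lemma grid_total:
  assumes "x \<in> E" "0 \<le> h" "depends_up_to m \<Phi>"
  shows "grid_prob x h \<Phi> = (\<integral>\<^sup>+ y. grid_prob x h (\<lambda>f. \<Phi> f \<and> f n = y) \<partial>count_space E)"
  unfolding grid_prob_def using assms by (intro split_state grid_sets) auto

text \<open>
  The process starts in \<open>x\<close> almost surely only, so that the restriction to \<open>f 0 = x\<close> is an equality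
  of probabilities and not of events.
\<close>

lemma grid_cong_start:
  assumes "x \<in> E" "0 \<le> h" "depends_up_to m \<Phi>" "depends_up_to n \<Psi>" "\<And>f. f 0 = x \<Longrightarrow> \<Phi> f = \<Psi> f"
  shows "grid_prob x h \<Phi> = grid_prob x h \<Psi>"
  unfolding grid_prob_def
proof (rule emeasure_eq_AE)
  show "AE \<omega> in P x. \<omega> \<in> {\<omega> \<in> space (P x). \<Phi> (\<lambda>i. Z (real i * h) \<omega>)}
      \<longleftrightarrow> \<omega> \<in> {\<omega> \<in> space (P x). \<Psi> (\<lambda>i. Z (real i * h) \<omega>)}"
    using Z_0[OF assms(1)] by eventually_elim (use assms(5) in auto)
qed (use assms in \<open>auto intro: grid_sets\<close>)

lemma grid_sum:
  assumes "x \<in> E" "0 \<le> h" "finite I" "\<And>i. i \<in> I \<Longrightarrow> depends_up_to m (\<Phi> i)"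
    and disj: "\<And>i j f. i \<in> I \<Longrightarrow> j \<in> I \<Longrightarrow> \<Phi> i f \<Longrightarrow> \<Phi> j f \<Longrightarrow> i = j"
  shows "(\<Sum>i\<in>I. grid_prob x h (\<Phi> i)) = grid_prob x h (\<lambda>f. \<exists>i\<in>I. \<Phi> i f)"
proof -
  have "disjoint_family_on (\<lambda>i. {\<omega> \<in> space (P x). \<Phi> i (\<lambda>j. Z (real j * h) \<omega>)}) I"
    unfolding disjoint_family_on_def using disj by blast
  then have "(\<Sum>i\<in>I. grid_prob x h (\<Phi> i)) = emeasure (P x) (\<Union>i\<in>I. {\<omega> \<in> space (P x). \<Phi> i (\<lambda>j. Z (real j * h) \<omega>)})"
    unfolding grid_prob_def using grid_sets[OF assms(1,2) assms(4)] assms(3)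
    by (intro sum_emeasure) blast+
  also have "(\<Union>i\<in>I. {\<omega> \<in> space (P x). \<Phi> i (\<lambda>j. Z (real j * h) \<omega>)}) = {\<omega> \<in> space (P x). \<exists>i\<in>I. \<Phi> i (\<lambda>j. Z (real j * h) \<omega>)}"
    by auto
  finally show ?thesis by (simp add: grid_prob_def)
qed

end

section \<open>Balance equations and subinvariant measures\<close>

text \<open>
  Between consecutive jumps the path is locally constant from both sides, hence constant on a
  connected set. Its values are those at \<open>0\<close> and at the jumps.
\<close>

lemma step_function_finite_range:
  fixes f :: "real \<Rightarrow> 's"
  assumes rc: "\<And>t. 0 \<le> t \<Longrightarrow> \<forall>\<^sub>F s in at_right t. f s = f t"
    and fin: "finite {t. 0 < t \<and> t \<le> T \<and> \<not> (\<forall>\<^sub>F s in at_left t. f s = f t)}"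
  shows "finite (f ` {0..T})"
proof -
  define J where "J = insert 0 {t. 0 < t \<and> t \<le> T \<and> \<not> (\<forall>\<^sub>F s in at_left t. f s = f t)}"
  have J: "finite J" using fin by (simp add: J_def)
  have "f t \<in> f ` J" if t: "t \<in> {0..T}" for t
  proof -
    define c where "c = Max {j \<in> J. j \<le> t}"
    have ne: "finite {j \<in> J. j \<le> t}" "{j \<in> J. j \<le> t} \<noteq> {}" using J t by (auto simp: J_def)
    have c: "c \<in> J" "c \<le> t" using Max_in[OF ne] by (auto simp: c_def)
    have c0: "0 \<le> c" using c by (auto simp: J_def)
    have no_jump: "a \<notin> J" if "c < a" "a \<le> t" for a
      using Max_ge[OF ne(1), of a] that by (auto simp: c_def)
    have "f constant_on {c..t}"
    proof (rule locally_constant_imp_constant)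
      fix a assume a: "a \<in> {c..t}"
      obtain r where r: "a < r" "\<And>s. a < s \<Longrightarrow> s < r \<Longrightarrow> f s = f a"
        using rc[of a] a c0 by (auto simp: eventually_at_right_field)
      obtain l where l: "l < a" "\<And>s. c \<le> s \<Longrightarrow> l < s \<Longrightarrow> s < a \<Longrightarrow> f s = f a"
      proof (cases "a = c")
        case True
        then show ?thesis using that[of "c - 1"] by auto
      next
        case False
        then have "a \<notin> J" using a no_jump by auto
        then have "\<forall>\<^sub>F s in at_left a. f s = f a" using a c0 False t by (auto simp: J_def)
        then show ?thesis using that by (auto simp: eventually_at_left_field)
      qed
      show "\<exists>U. openin (top_of_set {c..t}) U \<and> a \<in> U \<and> (\<forall>x\<in>U. f x = f a)"
      proof (intro exI conjI)
        show "openin (top_of_set {c..t}) ({c..t} \<inter> {l<..<r})" by (intro openin_open_Int) auto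
        show "a \<in> {c..t} \<inter> {l<..<r}" using a l r by auto
        show "\<forall>x\<in>{c..t} \<inter> {l<..<r}. f x = f a"
        proof
          fix x assume x: "x \<in> {c..t} \<inter> {l<..<r}"
          then show "f x = f a" using l(2)[of x] r(2)[of x] by (cases x a rule: linorder_cases) auto
        qed
      qed
    qed simp
    then have "f t = f c" using c by (auto simp: constant_on_def)
    then show ?thesis using c by auto
  qed
  then have "f ` {0..T} \<subseteq> f ` J" by auto
  then show ?thesis using J by (meson finite_imageI finite_subset)
qed

text \<open>
  Two states are required to make \<open>P\<^sub>1(x, x) < 1\<close>, so that the process does leave \<open>x\<close>.
\<close>

locale irreducible_jump_process = jump_process E q P Z
  for E :: "'s::countable set" and q :: "'s \<Rightarrow> 's \<Rightarrow> real"
    and P :: "'s \<Rightarrow> 'w measure" and Z :: "real \<Rightarrow> 'w \<Rightarrow> 's" +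
  assumes reg: "regular_process E q P Z" and irr: "irreducible_process E P Z"
    and two_states: "\<And>x. x \<in> E \<Longrightarrow> \<exists>y\<in>E. y \<noteq> x"
begin

lemma finite_range_path:
  assumes x: "x \<in> E"
  shows "AE \<omega> in P x. \<forall>T. finite ((\<lambda>s. Z s \<omega>) ` {0..T})"
proof -
  have "AE \<omega> in P x. \<forall>T. finite {t. 0 < t \<and> t \<le> T \<and> \<not> (\<forall>\<^sub>F s in at_left t. Z s \<omega> = Z t \<omega>)}"
    using reg x by (auto simp: regular_process_def)
  with right_continuous[OF x] show ?thesis
    by eventually_elim (auto intro!: step_function_finite_range)
qed

lemma trans_prob_0: "x \<in> E \<Longrightarrow> trans_prob P Z x 0 y = (if y = x then 1 else 0)"
  using tp_0[of x y] by (auto simp: tp_eq trans_prob_def split: if_splits)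

lemma trans_prob_derivative:
  assumes "x \<in> E" "y \<in> E"
  shows "((\<lambda>h. (trans_prob P Z x h y - trans_prob P Z x 0 y) / h) \<longlongrightarrow> q x y) (at_right 0)"
proof -
  have "((\<lambda>t. trans_prob P Z x t y) has_real_derivative q x y) (at 0 within {0..})"
    using mjp assms by (auto simp: markov_jump_process_def)
  then show ?thesis by (simp add: has_field_derivative_iff at_within_Ici_at_right)
qed

text \<open>
  At \<open>h = 0\<close> both sides equal \<open>m y\<close>, and the left side has the derivative \<open>\<Sum> m u * q u y \<le> 0\<close>, whereas
  the right side has the positive derivative \<open>e * m y\<close>. Finiteness of \<open>F\<close> makes the bound uniform in \<open>y\<close>.
\<close>

lemma small_time_bound:
  fixes m :: "'s \<Rightarrow> real"
  assumes m: "\<And>x. x \<in> E \<Longrightarrow> 0 < m x" and F: "finite F" "F \<subseteq> E"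
    and gen: "\<And>y. y \<in> F \<Longrightarrow> (\<Sum>u\<in>F. m u * q u y) \<le> 0" and e: "0 < e"
  shows "\<forall>\<^sub>F h in at_right 0. \<forall>y\<in>F. (\<Sum>u\<in>F. ennreal (m u) * tp h u y) \<le> ennreal (1 + e * h) * ennreal (m y)"
proof -
  have "\<forall>\<^sub>F h in at_right 0. (\<Sum>u\<in>F. ennreal (m u) * tp h u y) \<le> ennreal (1 + e * h) * ennreal (m y)"
    if y: "y \<in> F" for y
  proof -
    have my: "0 < m y" using m y F by auto
    have "((\<lambda>h. \<Sum>u\<in>F. m u * ((trans_prob P Z u h y - trans_prob P Z u 0 y) / h)) \<longlongrightarrow> (\<Sum>u\<in>F. m u * q u y)) (at_right 0)"
      using F y by (intro tendsto_sum tendsto_mult_left trans_prob_derivative) auto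
    moreover have "(\<Sum>u\<in>F. m u * q u y) < e * m y"
      using gen[OF y] e my by (meson le_less_trans mult_pos_pos)
    ultimately have "\<forall>\<^sub>F h in at_right 0. (\<Sum>u\<in>F. m u * ((trans_prob P Z u h y - trans_prob P Z u 0 y) / h)) < e * m y"
      by (rule order_tendstoD)
    then show ?thesis using eventually_at_right_less[of "0::real"]
    proof eventually_elim
      case (elim h)
      have 0: "(\<Sum>u\<in>F. m u * trans_prob P Z u 0 y) = m y"
      proof -
        have "(\<Sum>u\<in>F. m u * trans_prob P Z u 0 y) = (\<Sum>u\<in>F. if u = y then m u else 0)"
          using F by (intro sum.cong) (auto simp: trans_prob_0)
        then show ?thesis using F y by simp
      qed
      have "(\<Sum>u\<in>F. m u * ((trans_prob P Z u h y - trans_prob P Z u 0 y) / h))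
          = ((\<Sum>u\<in>F. m u * trans_prob P Z u h y) - (\<Sum>u\<in>F. m u * trans_prob P Z u 0 y)) / h"
        by (simp add: sum_divide_distrib sum_subtractf[symmetric] diff_divide_distrib right_diff_distrib)
      with elim have "(\<Sum>u\<in>F. m u * trans_prob P Z u h y) - m y < e * m y * h"
        unfolding 0 by (simp add: divide_less_eq)
      then have le: "(\<Sum>u\<in>F. m u * trans_prob P Z u h y) \<le> (1 + e * h) * m y" by (simp add: algebra_simps)
      have "(\<Sum>u\<in>F. ennreal (m u) * tp h u y) = (\<Sum>u\<in>F. ennreal (m u * trans_prob P Z u h y))"
      proof (rule sum.cong)
        fix u assume "u \<in> F"
        then have "u \<in> E" using F by auto
        then show "ennreal (m u) * tp h u y = ennreal (m u * trans_prob P Z u h y)"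
          using m[of u] by (simp add: tp_eq ennreal_mult' )
      qed simp
      also have "\<dots> = ennreal (\<Sum>u\<in>F. m u * trans_prob P Z u h y)"
        using F m by (intro sum_ennreal mult_nonneg_nonneg) (auto simp: trans_prob_def less_imp_le)
      also have "\<dots> \<le> ennreal ((1 + e * h) * m y)" by (rule ennreal_leI[OF le])
      also have "\<dots> = ennreal (1 + e * h) * ennreal (m y)" using my by (simp add: ennreal_mult'')
      finally show ?case .
    qed
  qed
  then show ?thesis using F by (simp add: eventually_ball_finite)
qed

text \<open>
  Each step of the chain killed outside \<open>F\<close> multiplies the measure by at most \<open>c\<close>.
\<close>

lemma grid_stay_bound:
  assumes F: "finite F" "F \<subseteq> E" and h: "0 \<le> h"
    and m: "\<And>y. y \<in> F \<Longrightarrow> (\<Sum>u\<in>F. m u * tp h u y) \<le> c * m y" and y: "y \<in> F"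
  shows "(\<Sum>x\<in>F. m x * grid_prob x h (\<lambda>f. (\<forall>k\<le>i. f k \<in> F) \<and> f i = y)) \<le> c ^ i * m y"
  using y
proof (induction i arbitrary: y)
  case 0
  have "(\<Sum>x\<in>F. m x * grid_prob x h (\<lambda>f. (\<forall>k\<le>0. f k \<in> F) \<and> f 0 = y)) \<le> (\<Sum>x\<in>F. if x = y then m x else 0)"
  proof (rule sum_mono)
    fix x assume "x \<in> F"
    then have x: "x \<in> E" using F by auto
    have "grid_prob x h (\<lambda>f. (\<forall>k\<le>0. f k \<in> F) \<and> f 0 = y) \<le> grid_prob x h (\<lambda>f. f 0 = y)"
      by (rule grid_mono[OF x h depends_up_to_eq[of 0 0]]) auto
    also have "\<dots> = (if x = y then 1 else 0)" by (simp add: grid_single tp_0[OF x])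
    finally show "m x * grid_prob x h (\<lambda>f. (\<forall>k\<le>0. f k \<in> F) \<and> f 0 = y) \<le> (if x = y then m x else 0)"
      using mult_left_mono by (fastforce split: if_splits)
  qed
  then show ?case using F 0 by simp
next
  case (Suc i)
  let ?g = "\<lambda>x u. grid_prob x h (\<lambda>f. (\<forall>k\<le>i. f k \<in> F) \<and> f i = u)"
  have step: "grid_prob x h (\<lambda>f. (\<forall>k\<le>Suc i. f k \<in> F) \<and> f (Suc i) = y) = (\<Sum>u\<in>F. ?g x u * tp h u y)"
    if "x \<in> F" for x
  proof -
    have x: "x \<in> E" using F that by auto
    have up: "depends_up_to i (\<lambda>f. \<forall>k\<le>i. f k \<in> F)" by (rule up_toI) simp
    have "(\<lambda>f::nat \<Rightarrow> 's. (\<forall>k\<le>Suc i. f k \<in> F) \<and> f (Suc i) = y) = (\<lambda>f. (\<forall>k\<le>i. f k \<in> F) \<and> f (Suc i) = y)"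
      using Suc.prems by (auto simp: le_Suc_eq)
    then have "grid_prob x h (\<lambda>f. (\<forall>k\<le>Suc i. f k \<in> F) \<and> f (Suc i) = y) = push E (?g x) (tp h) y"
      using grid_step[OF x _ h up, of y] Suc.prems F by auto
    also have "\<dots> = (\<Sum>u\<in>F. ?g x u * tp h u y)"
      unfolding push_def
    proof (rule nn_integral_count_space'[OF F(1) _ F(2)])
      fix u assume u: "u \<notin> F"
      then have "(\<lambda>f::nat \<Rightarrow> 's. (\<forall>k\<le>i. f k \<in> F) \<and> f i = u) = (\<lambda>f. False)" by auto
      then show "?g x u * tp h u y = 0" by (simp add: grid_prob_def)
    qed
    finally show ?thesis .
  qed
  have "(\<Sum>x\<in>F. m x * grid_prob x h (\<lambda>f. (\<forall>k\<le>Suc i. f k \<in> F) \<and> f (Suc i) = y))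
      = (\<Sum>x\<in>F. \<Sum>u\<in>F. m x * ?g x u * tp h u y)"
    using step by (simp add: sum_distrib_left mult.assoc)
  also have "\<dots> = (\<Sum>u\<in>F. (\<Sum>x\<in>F. m x * ?g x u) * tp h u y)"
    by (subst sum.swap) (simp add: sum_distrib_right)
  also have "\<dots> \<le> (\<Sum>u\<in>F. c ^ i * m u * tp h u y)"
    using Suc.IH by (intro sum_mono mult_right_mono) auto
  also have "\<dots> = c ^ i * (\<Sum>u\<in>F. m u * tp h u y)" by (simp add: sum_distrib_left mult.assoc)
  also have "\<dots> \<le> c ^ i * (c * m y)" using m[OF Suc.prems] by (intro mult_left_mono) auto
  finally show ?case by (simp add: mult_ac)
qed

text \<open>
  Staying in \<open>F\<close> at all times \<open>i t / N\<close>, for every \<open>N\<close>. These countably many times keep the event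
  measurable and contain all grids that end in \<open>t\<close>.
\<close>

definition stays :: "'s set \<Rightarrow> real \<Rightarrow> 'w \<Rightarrow> bool" where
  "stays F t \<omega> \<longleftrightarrow> (\<forall>N i. i \<le> N \<longrightarrow> Z (real i * (t / real N)) \<omega> \<in> F)"

lemma stays_sets:
  assumes x: "x \<in> E" and t: "0 \<le> t"
  shows "{\<omega> \<in> space (P x). stays F t \<omega> \<and> Z t \<omega> = y} \<in> sets (P x)"
proof -
  have "{\<omega> \<in> space (P x). Z (real i * (t / real N)) \<omega> \<in> F} \<in> sets (P x)" for i N
    using t by (intro Z_sets x) auto
  then have "{\<omega> \<in> space (P x). i \<le> N \<longrightarrow> Z (real i * (t / real N)) \<omega> \<in> F} \<in> sets (P x)" for i N
    by (cases "i \<le> N") auto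
  then have "{\<omega> \<in> space (P x). stays F t \<omega>} \<in> sets (P x)"
    unfolding stays_def by (intro sets.sets_Collect_countable_All) blast
  from sets.Int[OF this Z_eq_sets[OF x t]] show ?thesis by (simp add: Collect_conj_eq Int_ac)
qed

text \<open>
  With \<open>N\<close> steps of length \<open>t / N\<close> the growth factor is \<open>(1 + e t / N) ^ N \<le> exp (e t)\<close>, and \<open>e\<close> is arbitrary.
\<close>

lemma stays_bound:
  fixes m :: "'s \<Rightarrow> real"
  assumes m: "\<And>x. x \<in> E \<Longrightarrow> 0 < m x" and F: "finite F" "F \<subseteq> E"
    and gen: "\<And>y. y \<in> F \<Longrightarrow> (\<Sum>u\<in>F. m u * q u y) \<le> 0" and t: "0 < t" and y: "y \<in> F"
  shows "(\<Sum>x\<in>F. ennreal (m x) * emeasure (P x) {\<omega> \<in> space (P x). stays F t \<omega> \<and> Z t \<omega> = y}) \<le> ennreal (m y)"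
    (is "?S \<le> _")
proof -
  have bound: "?S \<le> ennreal (exp (e * t) * m y)" if e: "0 < e" for e
  proof -
    obtain d where d: "0 < d" "\<And>h. 0 < h \<Longrightarrow> h < d \<Longrightarrow>
        \<forall>y\<in>F. (\<Sum>u\<in>F. ennreal (m u) * tp h u y) \<le> ennreal (1 + e * h) * ennreal (m y)"
      using small_time_bound[OF m F gen e] by (auto simp: eventually_at_right_field)
    obtain N where N: "t / d < real N" using reals_Archimedean2 by blast
    have N0: "0 < N" using N t d by (metis divide_pos_pos less_trans of_nat_0_less_iff)
    define h where "h = t / real N"
    have h: "0 < h" "h < d" using N N0 t d by (auto simp: h_def field_simps)
    have hN: "real N * h = t" using N0 by (simp add: h_def)
    have stays_grid: "stays F t \<omega> \<Longrightarrow> k \<le> N \<Longrightarrow> Z (real k * h) \<omega> \<in> F" for k \<omega>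
      unfolding stays_def h_def by blast
    have "?S \<le> (\<Sum>x\<in>F. ennreal (m x) * grid_prob x h (\<lambda>f. (\<forall>k\<le>N. f k \<in> F) \<and> f N = y))"
    proof (intro sum_mono mult_left_mono)
      fix x assume "x \<in> F"
      then have x: "x \<in> E" using F by auto
      have "depends_up_to N (\<lambda>f. (\<forall>k\<le>N. f k \<in> F) \<and> f N = y)" by (rule up_toI) simp
      then show "emeasure (P x) {\<omega> \<in> space (P x). stays F t \<omega> \<and> Z t \<omega> = y}
          \<le> grid_prob x h (\<lambda>f. (\<forall>k\<le>N. f k \<in> F) \<and> f N = y)"
        unfolding grid_prob_def using h
        by (intro emeasure_mono grid_sets[OF x]) (auto simp: hN intro: stays_grid)
    qed simp
    also have "\<dots> \<le> ennreal (1 + e * h) ^ N * ennreal (m y)"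
      using h d(2)[OF h] by (intro grid_stay_bound F y) auto
    also have "\<dots> = ennreal ((1 + e * h) ^ N * m y)"
    proof -
      have "0 \<le> 1 + e * h" "0 \<le> m y" using e h m[of y] y F by (auto simp: less_imp_le)
      then show ?thesis by (simp only: ennreal_mult'' ennreal_power)
    qed
    also have "\<dots> \<le> ennreal (exp (e * t) * m y)"
    proof (intro ennreal_leI mult_right_mono)
      have "(1 + (e * t) / real N) ^ N \<le> exp (e * t)"
        using N0 e t by (intro exp_ge_one_plus_x_over_n_power_n) (auto intro: order_trans[of _ 0])
      then show "(1 + e * h) ^ N \<le> exp (e * t)" by (simp add: h_def)
    qed (use m y F in \<open>auto simp: less_imp_le\<close>)
    finally show ?thesis .
  qed
  have "((\<lambda>e. exp (e * t) * m y) \<longlongrightarrow> exp (0 * t) * m y) (at_right 0)"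
    by (intro tendsto_intros)
  then have "((\<lambda>e. ennreal (exp (e * t) * m y)) \<longlongrightarrow> ennreal (m y)) (at_right 0)"
    by (intro tendsto_ennrealI) simp
  then show ?thesis
  proof (rule tendsto_lowerbound)
    show "\<forall>\<^sub>F e in at_right 0. ?S \<le> ennreal (exp (e * t) * m y)"
      using eventually_at_right_less[of "0::real"] by eventually_elim (rule bound)
  qed simp
qed

text \<open>
  Exhausting the state space by finite sets removes the restriction to paths that stay in a finite
  set, because almost every path visits finitely many states up to time \<open>t\<close>.
\<close>

theorem subinvariant_tp:
  fixes m :: "'s \<Rightarrow> real"
  assumes m: "\<And>x. x \<in> E \<Longrightarrow> 0 < m x"
    and gen: "\<And>F y. finite F \<Longrightarrow> F \<subseteq> E \<Longrightarrow> y \<in> F \<Longrightarrow> (\<Sum>u\<in>F. m u * q u y) \<le> 0"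
    and t: "0 \<le> t" and y: "y \<in> E"
  shows "push E (\<lambda>x. ennreal (m x)) (tp t) y \<le> ennreal (m y)"
  unfolding push_def
proof (rule nn_integral_count_space_le)
  fix G assume G: "finite G" "G \<subseteq> E"
  show "(\<Sum>x\<in>G. ennreal (m x) * tp t x y) \<le> ennreal (m y)"
  proof (cases "t = 0")
    case True
    have "(\<Sum>x\<in>G. ennreal (m x) * tp t x y) = (\<Sum>x\<in>G. if x = y then ennreal (m x) else 0)"
      using G True by (intro sum.cong) (auto simp: tp_0)
    then show ?thesis using G by simp
  next
    case False
    with t have t: "0 < t" by simp
    define F where "F n = {x \<in> E. to_nat x < n} \<union> (G \<union> {y})" for n :: nat
    have F: "finite (F n)" "F n \<subseteq> E" for n
    proof -
      have "finite {x \<in> E. to_nat x < n}"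
        by (rule finite_imageD[of to_nat]) (auto simp: inj_on_def intro: finite_subset[of _ "{..<n}"])
      then show "finite (F n)" "F n \<subseteq> E" using G y by (auto simp: F_def)
    qed
    have F_mono: "F n \<subseteq> F n'" if "n \<le> n'" for n n' using that by (auto simp: F_def)
    let ?A = "\<lambda>x n. {\<omega> \<in> space (P x). stays (F n) t \<omega> \<and> Z t \<omega> = y}"
    have lim: "(\<lambda>n. emeasure (P x) (?A x n)) \<longlonglongrightarrow> tp t x y" if x: "x \<in> E" for x
    proof -
      have "(\<lambda>n. emeasure (P x) (?A x n)) \<longlonglongrightarrow> emeasure (P x) (\<Union>n. ?A x n)"
      proof (rule Lim_emeasure_incseq)
        show "range (?A x) \<subseteq> sets (P x)" using stays_sets[OF x] t by auto
        show "incseq (?A x)" using F_mono by (auto simp: incseq_def stays_def) blast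
      qed
      also have "emeasure (P x) (\<Union>n. ?A x n) = tp t x y"
        unfolding tp_def
      proof (rule emeasure_eq_AE)
        show "AE \<omega> in P x. \<omega> \<in> (\<Union>n. ?A x n) \<longleftrightarrow> \<omega> \<in> {\<omega> \<in> space (P x). Z t \<omega> = y}"
          using finite_range_path[OF x]
        proof eventually_elim
          case (elim \<omega>)
          have "\<exists>n. stays (F n) t \<omega>" if \<omega>: "\<omega> \<in> space (P x)"
          proof -
            have "finite ((\<lambda>s. Z s \<omega>) ` {0..t})" using elim by blast
            then have "finite (to_nat ` (\<lambda>s. Z s \<omega>) ` {0..t})" by (rule finite_imageI)
            then obtain n where n: "\<forall>k\<in>to_nat ` (\<lambda>s. Z s \<omega>) ` {0..t}. k < n"
              unfolding finite_nat_set_iff_bounded by auto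
            have "stays (F n) t \<omega>"
              unfolding stays_def
            proof (intro allI impI)
              fix N i :: nat assume "i \<le> N"
              then have s: "real i * (t / real N) \<in> {0..t}"
                using t by (cases "N = 0") (auto simp: field_simps)
              then have "to_nat (Z (real i * (t / real N)) \<omega>) < n" using n by blast
              then show "Z (real i * (t / real N)) \<omega> \<in> F n"
                using Z_in_E[OF x _ \<omega>, of "real i * (t / real N)"] s by (auto simp: F_def)
            qed
            then show ?thesis ..
          qed
          then show ?case by auto
        qed
        show "(\<Union>n. ?A x n) \<in> sets (P x)" using stays_sets[OF x] t by auto
        show "{\<omega> \<in> space (P x). Z t \<omega> = y} \<in> sets (P x)" using Z_eq_sets[OF x] t by auto
      qed
      finally show ?thesis .
    qed
    have "(\<lambda>n. \<Sum>x\<in>G. ennreal (m x) * emeasure (P x) (?A x n)) \<longlonglongrightarrow> (\<Sum>x\<in>G. ennreal (m x) * tp t x y)"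
      using G by (intro tendsto_sum ennreal_tendsto_cmult lim) auto
    then show ?thesis
    proof (rule LIMSEQ_le_const2, intro exI allI impI)
      fix n
      have "(\<Sum>x\<in>G. ennreal (m x) * emeasure (P x) (?A x n)) \<le> (\<Sum>x\<in>F n. ennreal (m x) * emeasure (P x) (?A x n))"
        using F by (intro sum_mono2) (auto simp: F_def)
      also have "\<dots> \<le> ennreal (m y)"
        by (rule stays_bound[OF m F gen[OF F] t]) (auto simp: F_def)
      finally show "(\<Sum>x\<in>G. ennreal (m x) * emeasure (P x) (?A x n)) \<le> ennreal (m y)" .
    qed
  qed
qed

end

section \<open>Return probabilities at small and large times\<close>

context irreducible_jump_process
begin

lemma tp_power_le:
  assumes x: "x \<in> E" and s: "0 \<le> s"
  shows "tp s x x ^ n \<le> tp (real n * s) x x"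
proof (induction n)
  case 0
  then show ?case by (simp add: tp_0 x)
next
  case (Suc n)
  have "tp s x x ^ Suc n = tp s x x ^ n * tp s x x" by (rule power_Suc2)
  also have "\<dots> \<le> tp (real n * s) x x * tp s x x" by (intro mult_right_mono Suc.IH) simp
  also have "\<dots> \<le> push E (tp (real n * s) x) (tp s) x" by (rule push_ge_point[OF x])
  also have "\<dots> = tp (real n * s + s) x x" using x s by (intro tp_CK[symmetric]) auto
  also have "real n * s + s = real (Suc n) * s" by (simp add: algebra_simps)
  finally show ?case .
qed

lemma diagonal_small_time:
  assumes x: "x \<in> E"
  obtains C d where "0 \<le> C" "0 < d" "\<And>h. 0 < h \<Longrightarrow> h < d \<Longrightarrow> 1 - trans_prob P Z x h x \<le> C * h"
proof -
  have "\<forall>\<^sub>F h in at_right 0. q x x - 1 < (trans_prob P Z x h x - trans_prob P Z x 0 x) / h"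
    using trans_prob_derivative[OF x x] by (rule order_tendstoD) simp
  then obtain d where d: "0 < d"
    "\<And>h. 0 < h \<Longrightarrow> h < d \<Longrightarrow> q x x - 1 < (trans_prob P Z x h x - 1) / h"
    using x by (auto simp: eventually_at_right_field trans_prob_0)
  show ?thesis
  proof (rule that[of "\<bar>1 - q x x\<bar>" d])
    fix h assume h: "0 < h" "h < d"
    then have "(q x x - 1) * h < trans_prob P Z x h x - 1" using d(2)[OF h] by (simp add: less_divide_eq)
    then have "1 - trans_prob P Z x h x \<le> (1 - q x x) * h" by (simp add: algebra_simps)
    also have "\<dots> \<le> \<bar>1 - q x x\<bar> * h" using h by (intro mult_right_mono) auto
    finally show "1 - trans_prob P Z x h x \<le> \<bar>1 - q x x\<bar> * h" .
  qed (use d in auto)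
qed

text \<open>
  Split \<open>s\<close> into \<open>N\<close> pieces so short that the probability of being in \<open>x\<close> again after each piece is at
  least \<open>1 / 2\<close>.
\<close>

lemma diagonal_lower_bound:
  assumes x: "x \<in> E"
  obtains c where "0 < c" "\<And>s. 0 \<le> s \<Longrightarrow> s \<le> T \<Longrightarrow> ennreal c \<le> tp s x x"
proof -
  obtain C d where C: "0 \<le> C" "0 < d" "\<And>h. 0 < h \<Longrightarrow> h < d \<Longrightarrow> 1 - trans_prob P Z x h x \<le> C * h"
    using diagonal_small_time[OF x] by blast
  obtain N where N: "max 1 (max (T / d) (T * (2 * C))) < real N" using reals_Archimedean2 by blast
  then have N0: "0 < N" by (auto intro: gr0I)
  show ?thesis
  proof (rule that[of "(1 / 2) ^ N"])
    fix s assume s: "0 \<le> s" "s \<le> T"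
    have half: "ennreal (1 / 2) \<le> tp (s / real N) x x"
    proof (cases "s = 0")
      case True
      then show ?thesis using ennreal_leI[of "1 / 2" 1] by (simp add: tp_0 x)
    next
      case False
      have 1: "s < d * real N" using N s C by (auto simp: field_simps intro: le_less_trans)
      have 2: "C * s * 2 \<le> real N"
      proof -
        have "C * s * 2 \<le> C * T * 2" using s C by (intro mult_right_mono mult_left_mono) auto
        then show ?thesis using N by (simp add: mult_ac)
      qed
      have "1 - trans_prob P Z x (s / real N) x \<le> C * (s / real N)"
        using s False N0 1 by (intro C(3)) (auto simp: field_simps)
      also have "\<dots> \<le> 1 / 2" using 2 N0 by (simp add: field_simps)
      finally have "1 / 2 \<le> trans_prob P Z x (s / real N) x" by simp
      then show ?thesis unfolding tp_eq[OF x] by (rule ennreal_leI)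
    qed
    have "ennreal ((1 / 2) ^ N) = ennreal (1 / 2) ^ N" by (rule ennreal_power[symmetric]) simp
    also have "\<dots> \<le> tp (s / real N) x x ^ N"
      using half by (intro power_mono) simp_all
    also have "\<dots> \<le> tp (real N * (s / real N)) x x" using s by (intro tp_power_le x) auto
    finally show "ennreal ((1 / 2) ^ N) \<le> tp s x x" using N0 by simp
  qed simp
qed

lemma tp_eventually_positive:
  assumes x: "x \<in> E" and y: "y \<in> E"
  shows "\<exists>t0. \<forall>t\<ge>t0. 0 < tp t x y"
proof -
  obtain t0 where t0: "0 \<le> t0" "0 < trans_prob P Z x t0 y"
    using irr x y by (auto simp: irreducible_process_def)
  show ?thesis
  proof (intro exI allI impI)
    fix t assume t: "t0 \<le> t"
    obtain c where c: "0 < c" "ennreal c \<le> tp (t - t0) y y"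
      using diagonal_lower_bound[OF y, of "t - t0"] t by (metis diff_ge_0_iff_ge order_refl)
    have "0 < tp t0 x y" using t0 by (simp add: tp_eq[OF x])
    moreover have "0 < tp (t - t0) y y" using c by (auto intro: less_le_trans[of _ "ennreal c"])
    ultimately have "0 < tp t0 x y * tp (t - t0) y y" by (simp add: ennreal_zero_less_mult_iff)
    also have "\<dots> \<le> push E (tp t0 x) (tp (t - t0)) y" by (rule push_ge_point[OF y])
    also have "\<dots> = tp t x y" using tp_CK[OF x y, of t0 "t - t0"] t t0 by simp
    finally show "0 < tp t x y" .
  qed
qed

lemma tp_eventually_positive_nat:
  assumes "x \<in> E" "y \<in> E"
  shows "\<exists>N. \<forall>n\<ge>N. 0 < tp (real n) x y"
proof -
  obtain t0 where "\<forall>t\<ge>t0. 0 < tp t x y" using tp_eventually_positive[OF assms] by blast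
  moreover obtain N where "t0 \<le> real N" using real_arch_simple by blast
  ultimately show ?thesis by (intro exI[of _ N]) (auto intro: order_trans)
qed

lemma tp_1_less_1:
  assumes x: "x \<in> E"
  shows "tp 1 x x < 1"
proof (rule ccontr)
  assume "\<not> tp 1 x x < 1"
  with tp_le_1[OF x, of 1 x] have one: "tp 1 x x = 1" by simp
  obtain y where y: "y \<in> E" "y \<noteq> x" using two_states[OF x] by blast
  obtain N where N: "0 < tp (real N) x y" using tp_eventually_positive_nat[OF x y(1)] by blast
  have "1 \<le> tp (real N) x x" using tp_power_le[OF x, of 1 N] one by simp
  then have "1 + tp (real N) x y \<le> (\<Sum>z\<in>{x, y}. tp (real N) x z)"
    using y(2) by (simp add: add_right_mono)
  also have "\<dots> \<le> (\<integral>\<^sup>+ z. tp (real N) x z \<partial>count_space E)"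
    using x y by (intro sum_le_nn_integral_count_space) auto
  also have "\<dots> = 1" using stochastic_tp[of "real N"] x by (simp add: stochastic_on_def)
  finally have "1 + tp (real N) x y \<le> 1 + 0" by simp
  then show False using N by (simp only: ennreal_add_left_cancel_le) simp
qed

section \<open>Finite subinvariant measures force positive recurrence\<close>

definition no_return :: "'s \<Rightarrow> nat \<Rightarrow> (nat \<Rightarrow> 's) \<Rightarrow> bool" where
  "no_return x m f \<longleftrightarrow> (\<forall>i j. i < j \<longrightarrow> j \<le> m \<longrightarrow> f i \<noteq> x \<longrightarrow> f j \<noteq> x)"

lemma no_returnI: "(\<And>i j. i < j \<Longrightarrow> j \<le> m \<Longrightarrow> f i \<noteq> x \<Longrightarrow> f j \<noteq> x) \<Longrightarrow> no_return x m f"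
  unfolding no_return_def by (intro allI impI)

lemma no_returnD: "no_return x m f \<Longrightarrow> i < j \<Longrightarrow> j \<le> m \<Longrightarrow> f i \<noteq> x \<Longrightarrow> f j \<noteq> x"
  unfolding no_return_def by (elim allE impE)

lemma up_to_no_return: "depends_up_to m (no_return x m)"
proof (rule up_toI)
  fix f g :: "nat \<Rightarrow> 's" assume eq: "\<And>i. i \<le> m \<Longrightarrow> f i = g i"
  show "no_return x m f = no_return x m g"
    unfolding no_return_def
  proof (intro iff_allI)
    fix i j
    show "(i < j \<longrightarrow> j \<le> m \<longrightarrow> f i \<noteq> x \<longrightarrow> f j \<noteq> x) = (i < j \<longrightarrow> j \<le> m \<longrightarrow> g i \<noteq> x \<longrightarrow> g j \<noteq> x)"
      using eq[of i] eq[of j] by (cases "i < j \<and> j \<le> m") auto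
  qed
qed

lemma no_return_Suc:
  "no_return x (Suc m) f \<longleftrightarrow> no_return x m f \<and> (f (Suc m) = x \<longrightarrow> f m = x)"
proof
  assume *: "no_return x (Suc m) f"
  have "no_return x m f" by (rule no_returnI, rule no_returnD[OF *]) simp_all
  moreover have "f (Suc m) = x \<longrightarrow> f m = x" using no_returnD[OF *, of m "Suc m"] by auto
  ultimately show "no_return x m f \<and> (f (Suc m) = x \<longrightarrow> f m = x)" ..
next
  assume *: "no_return x m f \<and> (f (Suc m) = x \<longrightarrow> f m = x)"
  then have nr: "no_return x m f" ..
  show "no_return x (Suc m) f"
  proof (rule no_returnI)
    fix i j assume ij: "i < j" "j \<le> Suc m" "f i \<noteq> x"
    show "f j \<noteq> x"
    proof (cases "j = Suc m")
      case True
      have "f m \<noteq> x" using ij True no_returnD[OF nr, of i m] by (cases "i = m") auto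
      with * True show ?thesis by auto
    next
      case False
      with ij show ?thesis by (intro no_returnD[OF nr, of i j]) simp_all
    qed
  qed
qed

text \<open>
  Summed over \<open>m\<close> this is the expected occupation of \<open>y\<close>, in grid steps, before the return to \<open>x\<close>.
\<close>

definition away :: "'s \<Rightarrow> real \<Rightarrow> nat \<Rightarrow> 's \<Rightarrow> ennreal" where
  "away x h m y = grid_prob x h (\<lambda>f. no_return x m f \<and> f m = y)"

lemma away_Suc:
  assumes x: "x \<in> E" and y: "y \<in> E" and h: "0 \<le> h"
  shows "away x h (Suc m) y = (if y = x then away x h m x * tp h x x else push E (away x h m) (tp h) y)"
proof (cases "y = x")
  case False
  then have "(\<lambda>f. no_return x (Suc m) f \<and> f (Suc m) = y) = (\<lambda>f. no_return x m f \<and> f (Suc m) = y)"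
    by (auto simp: no_return_Suc)
  then show ?thesis
    using False grid_step[OF x y h up_to_no_return] by (simp add: away_def[abs_def])
next
  case True
  let ?\<Phi> = "\<lambda>f. no_return x m f \<and> f m = x"
  have "(\<lambda>f. no_return x (Suc m) f \<and> f (Suc m) = x) = (\<lambda>f. ?\<Phi> f \<and> f (Suc m) = x)"
    by (auto simp: no_return_Suc)
  then have "away x h (Suc m) x = push E (\<lambda>u. grid_prob x h (\<lambda>f. ?\<Phi> f \<and> f m = u)) (tp h) x"
    unfolding away_def using grid_step[OF x x h depends_up_to_conj[OF up_to_no_return depends_up_to_eq[OF order_refl]]] by simp
  also have "\<dots> = (\<Sum>u\<in>{x}. grid_prob x h (\<lambda>f. ?\<Phi> f \<and> f m = u) * tp h u x)"
    unfolding push_def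
  proof (rule nn_integral_count_space')
    fix u assume "u \<notin> {x}"
    then have "(\<lambda>f. ?\<Phi> f \<and> f m = u) = (\<lambda>f. False)" by auto
    then show "grid_prob x h (\<lambda>f. ?\<Phi> f \<and> f m = u) * tp h u x = 0" by (simp add: grid_prob_def)
  qed (use x in auto)
  finally show ?thesis using True by (simp add: away_def conj_ac)
qed

lemma away_0: "x \<in> E \<Longrightarrow> away x h 0 y = (if y = x then 1 else 0)"
proof -
  assume x: "x \<in> E"
  have "away x h 0 y = grid_prob x h (\<lambda>f. f 0 = y)" by (simp add: away_def no_return_def)
  then show ?thesis using x by (simp add: grid_single tp_0)
qed

lemma away_diag:
  assumes "x \<in> E" "0 \<le> h"
  shows "away x h m x = tp h x x ^ m"
  using assms by (induction m) (simp_all add: away_0 away_Suc power_Suc2 del: power_Suc)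

lemma away_total: "x \<in> E \<Longrightarrow> 0 \<le> h \<Longrightarrow> (\<integral>\<^sup>+ y. away x h m y \<partial>count_space E) = grid_prob x h (no_return x m)"
  unfolding away_def by (rule grid_total[OF _ _ up_to_no_return, symmetric])

text \<open>
  Induction on \<open>M\<close>: away from \<open>x\<close> the occupation satisfies the recursion of \<open>push\<close>, for which a
  multiple of \<open>\<pi>\<close> is an upper solution. At \<open>x\<close> it is the geometric series of the stay before leaving,
  which fixes the multiple.
\<close>

lemma away_sum_bound:
  assumes x: "x \<in> E" and y: "y \<in> E" and sub: "\<And>y. y \<in> E \<Longrightarrow> push E \<pi> (tp 1) y \<le> \<pi> y"
    and C: "\<And>M. (\<Sum>m<M. tp 1 x x ^ m) \<le> C * \<pi> x"
  shows "(\<Sum>m<M. away x 1 m y) \<le> C * \<pi> y"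
  using y
proof (induction M arbitrary: y)
  case (Suc M)
  show ?case
  proof (cases "y = x")
    case True
    then show ?thesis using C[of "Suc M"] by (simp only: away_diag[OF x] zero_le_one)
  next
    case False
    have "(\<Sum>m<Suc M. away x 1 m y) = (\<Sum>m<M. away x 1 (Suc m) y)"
      unfolding sum.lessThan_Suc_shift using False by (simp add: away_0 x)
    also have "\<dots> = push E (\<lambda>u. \<Sum>m<M. away x 1 m u) (tp 1) y"
      using False x Suc.prems by (simp add: away_Suc push_sum[of E _ "{..<M}", symmetric])
    also have "\<dots> \<le> push E (\<lambda>u. C * \<pi> u) (tp 1) y" by (rule push_mono) (rule Suc.IH)
    also have "\<dots> \<le> C * \<pi> y" unfolding push_cmult using sub[OF Suc.prems] by (intro mult_left_mono) auto
    finally show ?thesis .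
  qed
qed simp

text \<open>
  If the grid chain first shows a return at step \<open>m\<close>, then the process has returned by time \<open>m\<close>, and
  the first \<open>m\<close> indicators equal \<open>1\<close>.
\<close>

lemma return_time_le:
  assumes x: "x \<in> E"
  shows "AE \<omega> in P x. return_time Z x \<omega>
    \<le> (\<Sum>m. indicator {\<omega> \<in> space (P x). no_return x m (\<lambda>i. Z (real i * 1) \<omega>)} \<omega>)"
  using Z_0[OF x] AE_space
proof eventually_elim
  case (elim \<omega>)
  let ?n = "\<lambda>m. no_return x m (\<lambda>i. Z (real i * 1) \<omega>)"
  let ?i = "\<lambda>m. indicator {\<omega> \<in> space (P x). no_return x m (\<lambda>i. Z (real i * 1) \<omega>)} \<omega> :: ennreal"
  have i1: "?i k = 1" if "?n k" for k using that elim by simp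
  show ?case
  proof (cases "\<forall>m. ?n m")
    case True
    have "of_nat M \<le> (\<Sum>m. ?i m)" for M
    proof -
      have "of_nat M = (\<Sum>m<M. ?i m)" using True i1 by simp
      also have "\<dots> \<le> (\<Sum>m. ?i m)" by (rule sum_le_suminf) auto
      finally show ?thesis .
    qed
    then have "(SUP M. of_nat M) \<le> (\<Sum>m. ?i m)" by (intro SUP_least)
    then show ?thesis by (simp add: ennreal_SUP_of_nat_eq_top top_unique)
  next
    case False
    then have "\<exists>m. \<not> ?n m" by (simp only: not_all)
    then have "\<exists>m. \<not> ?n m \<and> (\<forall>k<m. \<not> \<not> ?n k)" by (subst (asm) exists_least_iff)
    then obtain m where m: "\<not> ?n m" and less: "\<And>k. k < m \<Longrightarrow> ?n k" by (simp only: not_not) (elim exE conjE, simp only:)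
    have "\<exists>i j. i < j \<and> j \<le> m \<and> Z (real i) \<omega> \<noteq> x \<and> Z (real j) \<omega> = x"
      using m unfolding no_return_def mult_1_right by (simp only: not_all not_imp not_not)
    then obtain i j where ij: "i < j" "j \<le> m" "Z (real i) \<omega> \<noteq> x" "Z (real j) \<omega> = x"
      by (elim exE conjE)
    have "\<not> ?n j"
    proof
      assume "?n j"
      from no_returnD[OF this ij(1)] ij show False by simp
    qed
    with less ij have "j = m" by (meson le_neq_implies_less)
    have "0 < i" using ij elim by (cases i) auto
    then have "return_time Z x \<omega> \<le> ennreal (real m)"
      unfolding return_time_def using ij \<open>j = m\<close> by (intro INF_lower) (auto intro!: exI[of _ "real i"])
    also have "\<dots> = (\<Sum>k<m. ?i k)" using i1 less by (simp add: ennreal_of_nat_eq_real_of_nat)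
    also have "\<dots> \<le> (\<Sum>k. ?i k)" by (rule sum_le_suminf) auto
    finally show ?thesis .
  qed
qed

theorem subinvariant_imp_positive_recurrent:
  assumes x: "x \<in> E" and sub: "\<And>y. y \<in> E \<Longrightarrow> push E \<pi> (tp 1) y \<le> \<pi> y"
    and mass: "(\<integral>\<^sup>+ y. \<pi> y \<partial>count_space E) < \<infinity>" and pos: "0 < \<pi> x"
  shows "positive_recurrent P Z x"
proof -
  have \<pi>x: "\<pi> x < \<infinity>" using nn_integral_ge_point[OF x, of \<pi>] mass by (rule le_less_trans)
  obtain a where a: "tp 1 x x = ennreal a" "0 \<le> a" "a < 1"
    using tp_1_less_1[OF x] by (cases "tp 1 x x") auto
  define C where "C = ennreal (1 / (1 - a)) / \<pi> x"
  obtain p where p: "\<pi> x = ennreal p" "0 < p" using pos \<pi>x by (cases "\<pi> x") auto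
  have C: "C = ennreal (1 / (1 - a) / p)" using p a by (simp add: C_def divide_ennreal)
  then have C\<pi>: "C * \<pi> x = ennreal (1 / (1 - a))" "C < \<infinity>"
    using p a by (simp_all add: ennreal_mult'[symmetric])
  have geo: "(\<Sum>m<M. tp 1 x x ^ m) \<le> C * \<pi> x" for M
  proof -
    have "(\<Sum>m<M. tp 1 x x ^ m) = ennreal (\<Sum>m<M. a ^ m)"
      using a by (simp add: ennreal_power sum_ennreal)
    also have "(\<Sum>m<M. a ^ m) \<le> 1 / (1 - a)"
      using a by (subst sum_gp_strict) (auto simp: divide_right_mono)
    finally show ?thesis unfolding C\<pi>(1) by (simp add: ennreal_leI)
  qed
  have G: "(\<Sum>m<M. grid_prob x 1 (no_return x m)) \<le> C * (\<integral>\<^sup>+ y. \<pi> y \<partial>count_space E)" for M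
  proof -
    have "(\<Sum>m<M. grid_prob x 1 (no_return x m)) = (\<Sum>m<M. \<integral>\<^sup>+ y. away x 1 m y \<partial>count_space E)"
      by (simp add: away_total x)
    also have "\<dots> = (\<integral>\<^sup>+ y. (\<Sum>m<M. away x 1 m y) \<partial>count_space E)" by (simp add: nn_integral_sum)
    also have "\<dots> \<le> (\<integral>\<^sup>+ y. C * \<pi> y \<partial>count_space E)"
      using away_sum_bound[OF x _ sub geo] by (intro nn_integral_mono) auto
    also have "\<dots> = C * (\<integral>\<^sup>+ y. \<pi> y \<partial>count_space E)" by (simp add: nn_integral_cmult)
    finally show ?thesis .
  qed
  let ?A = "\<lambda>m. {\<omega> \<in> space (P x). no_return x m (\<lambda>i. Z (real i * 1) \<omega>)}"
  have A: "?A m \<in> sets (P x)" for m by (rule grid_sets[OF x _ up_to_no_return]) simp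
  have "(\<integral>\<^sup>+ \<omega>. return_time Z x \<omega> \<partial>P x) \<le> (\<integral>\<^sup>+ \<omega>. (\<Sum>m. indicator (?A m) \<omega>) \<partial>P x)"
    by (rule nn_integral_mono_AE[OF return_time_le[OF x]])
  also have "\<dots> = (\<Sum>m. \<integral>\<^sup>+ \<omega>. indicator (?A m) \<omega> \<partial>P x)"
    using A by (intro nn_integral_suminf) auto
  also have "\<dots> = (\<Sum>m. grid_prob x 1 (no_return x m))"
    unfolding grid_prob_def by (simp only: nn_integral_indicator[OF A])
  also have "\<dots> \<le> C * (\<integral>\<^sup>+ y. \<pi> y \<partial>count_space E)"
    unfolding suminf_eq_SUP by (rule SUP_least) (rule G)
  also have "\<dots> < \<infinity>" using C\<pi>(2) mass by (simp add: ennreal_mult_less_top)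
  finally show ?thesis unfolding positive_recurrent_def .
qed

end

section \<open>The last exit before a fixed time\<close>

context irreducible_jump_process
begin

definition avoids :: "'s \<Rightarrow> nat \<Rightarrow> nat \<Rightarrow> (nat \<Rightarrow> 's) \<Rightarrow> bool" where
  "avoids x j l f \<longleftrightarrow> (\<forall>i. j < i \<longrightarrow> i \<le> j + l \<longrightarrow> f i \<noteq> x)"

lemma avoidsD: "avoids x j l f \<Longrightarrow> j < i \<Longrightarrow> i \<le> j + l \<Longrightarrow> f i \<noteq> x"
  unfolding avoids_def by (elim allE impE)

lemma depends_up_to_avoids: "depends_up_to (j + l) (avoids x j l)"
proof (rule up_toI)
  fix f g :: "nat \<Rightarrow> 's" assume eq: "\<And>i. i \<le> j + l \<Longrightarrow> f i = g i"
  show "avoids x j l f = avoids x j l g"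
    unfolding avoids_def
  proof (intro iff_allI)
    fix i
    show "(j < i \<longrightarrow> i \<le> j + l \<longrightarrow> f i \<noteq> x) = (j < i \<longrightarrow> i \<le> j + l \<longrightarrow> g i \<noteq> x)"
      using eq[of i] by (cases "i \<le> j + l") auto
  qed
qed

lemma avoids_Suc: "avoids x j (Suc l) f \<longleftrightarrow> avoids x j l f \<and> f (Suc (j + l)) \<noteq> x"
proof
  assume *: "avoids x j (Suc l) f"
  have "avoids x j l f" unfolding avoids_def by (intro allI impI, rule avoidsD[OF *]) simp_all
  moreover have "f (Suc (j + l)) \<noteq> x" by (rule avoidsD[OF *]) simp_all
  ultimately show "avoids x j l f \<and> f (Suc (j + l)) \<noteq> x" ..
next
  assume *: "avoids x j l f \<and> f (Suc (j + l)) \<noteq> x"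
  show "avoids x j (Suc l) f"
    unfolding avoids_def
  proof (intro allI impI)
    fix i assume "j < i" "i \<le> j + Suc l"
    then show "f i \<noteq> x"
      using * avoidsD[of x j l f i] by (cases "i = Suc (j + l)") simp_all
  qed
qed

lemma avoids_0: "avoids x j 0 = (\<lambda>f. True)"
  unfolding avoids_def by (rule ext) simp

lemma avoids_point_Suc:
  assumes x: "x \<in> E" and y: "y \<in> E" and h: "0 \<le> h" and \<Phi>: "depends_up_to j \<Phi>"
  shows "grid_prob x h (\<lambda>f. (\<Phi> f \<and> f j = x \<and> avoids x j (Suc l) f) \<and> f (j + Suc l) = y)
    = (if y = x then 0 else push E (\<lambda>u. grid_prob x h (\<lambda>f. (\<Phi> f \<and> f j = x \<and> avoids x j l f) \<and> f (j + l) = u)) (tp h) y)"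
proof (cases "y = x")
  case True
  then have "(\<lambda>f. (\<Phi> f \<and> f j = x \<and> avoids x j (Suc l) f) \<and> f (j + Suc l) = y) = (\<lambda>f. False)"
    by (auto simp: avoids_Suc)
  then show ?thesis using True by (simp add: grid_prob_def)
next
  case False
  have eq: "(\<lambda>f. (\<Phi> f \<and> f j = x \<and> avoids x j (Suc l) f) \<and> f (j + Suc l) = y)
      = (\<lambda>f. (\<Phi> f \<and> f j = x \<and> avoids x j l f) \<and> f (Suc (j + l)) = y)"
    using False by (auto simp: avoids_Suc)
  have "depends_up_to (j + l) (\<lambda>f. \<Phi> f \<and> f j = x \<and> avoids x j l f)"
    by (intro depends_up_to_conj depends_up_to_avoids depends_up_to_eq depends_up_to_mono[OF \<Phi>]) simp_all
  from grid_step[OF x y h this] show ?thesis unfolding eq if_not_P[OF False] .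
qed

text \<open>
  Given that the chain is in \<open>x\<close> at index \<open>j\<close>, the following \<open>l\<close> steps avoid \<open>x\<close> as if the chain had
  started there. The two sides satisfy the same recursion in \<open>l\<close>.
\<close>

lemma restart_point:
  assumes x: "x \<in> E" and h: "0 \<le> h" and \<Phi>: "depends_up_to j \<Phi>" and y: "y \<in> E"
  shows "grid_prob x h (\<lambda>f. (\<Phi> f \<and> f j = x \<and> avoids x j l f) \<and> f (j + l) = y)
    = grid_prob x h (\<lambda>f. \<Phi> f \<and> f j = x) * grid_prob x h (\<lambda>f. avoids x 0 l f \<and> f l = y)"
  using y
proof (induction l arbitrary: y)
  case 0
  show ?case
  proof (cases "y = x")
    case True
    then show ?thesis by (simp add: avoids_0 grid_single tp_0 x conj_ac)
  next
    case False
    then have "(\<lambda>f. (\<Phi> f \<and> f j = x \<and> avoids x j 0 f) \<and> f (j + 0) = y) = (\<lambda>f. False)" by auto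
    then show ?thesis using False by (simp add: avoids_0 grid_single tp_0 x grid_prob_def[of _ _ "\<lambda>f. False"])
  qed
next
  case (Suc l)
  let ?c = "grid_prob x h (\<lambda>f. \<Phi> f \<and> f j = x)"
  have rhs: "grid_prob x h (\<lambda>f. avoids x 0 k f \<and> f k = u)
      = grid_prob x h (\<lambda>f. (True \<and> f 0 = x \<and> avoids x 0 k f) \<and> f (0 + k) = u)" for k u
  proof (rule grid_cong_start[OF x h])
    have "depends_up_to k (avoids x 0 k)" using depends_up_to_avoids[of 0 k x] by simp
    then show "depends_up_to k (\<lambda>f. avoids x 0 k f \<and> f k = u)" by (rule depends_up_to_conj[OF _ depends_up_to_eq[OF order_refl]])
    then have "depends_up_to k (\<lambda>f. f 0 = x \<and> (avoids x 0 k f \<and> f k = u))"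
      by (rule depends_up_to_conj[OF depends_up_to_eq[OF le0]])
    then show "depends_up_to k (\<lambda>f. (True \<and> f 0 = x \<and> avoids x 0 k f) \<and> f (0 + k) = u)" by simp
  qed simp
  show ?case
    unfolding rhs avoids_point_Suc[OF x Suc.prems h \<Phi>]
      avoids_point_Suc[OF x Suc.prems h, of 0 "\<lambda>_. True", OF up_toI[OF refl]]
    unfolding rhs[symmetric]
    using Suc.IH by (simp add: push_cmult[symmetric] cong: push_cong)
qed

definition escape :: "'s \<Rightarrow> real \<Rightarrow> nat \<Rightarrow> ennreal" where
  "escape x h l = grid_prob x h (avoids x 0 l)"

lemma restart:
  assumes x: "x \<in> E" and h: "0 \<le> h" and \<Phi>: "depends_up_to j \<Phi>"
  shows "grid_prob x h (\<lambda>f. \<Phi> f \<and> f j = x \<and> avoids x j l f)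
    = grid_prob x h (\<lambda>f. \<Phi> f \<and> f j = x) * escape x h l"
proof -
  have up: "depends_up_to (j + l) (\<lambda>f. \<Phi> f \<and> f j = x \<and> avoids x j l f)"
    by (intro depends_up_to_conj depends_up_to_avoids depends_up_to_eq depends_up_to_mono[OF \<Phi>]) simp_all
  have up0: "depends_up_to l (avoids x 0 l)" using depends_up_to_avoids[of 0 l] by simp
  have "grid_prob x h (\<lambda>f. \<Phi> f \<and> f j = x \<and> avoids x j l f)
      = (\<integral>\<^sup>+ y. grid_prob x h (\<lambda>f. \<Phi> f \<and> f j = x) * grid_prob x h (\<lambda>f. avoids x 0 l f \<and> f l = y) \<partial>count_space E)"
    unfolding grid_total[OF x h up, of "j + l"]
    by (rule nn_integral_cong) (simp only: space_count_space restart_point[OF x h \<Phi>])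
  also have "\<dots> = grid_prob x h (\<lambda>f. \<Phi> f \<and> f j = x) * escape x h l"
    unfolding escape_def grid_total[OF x h up0, of l] by (simp add: nn_integral_cmult)
  finally show ?thesis .
qed

lemma grid_True: "x \<in> E \<Longrightarrow> grid_prob x h (\<lambda>f. True) = 1"
  unfolding grid_prob_def using prob_space.emeasure_space_1[OF prob_space_P] by simp

text \<open>
  Decomposition at the last index at which the chain is in \<open>x\<close>. It exists because the chain starts in \<open>x\<close>.
\<close>

lemma last_exit:
  assumes x: "x \<in> E" and h: "0 \<le> h"
  shows "(\<Sum>j\<le>n. tp (real j * h) x x * escape x h (n - j)) = 1"
proof -
  let ?D = "\<lambda>j f. True \<and> f j = x \<and> avoids x j (n - j) f"
  have up: "depends_up_to n (?D j)" if "j \<in> {..n}" for j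
    using that depends_up_to_avoids[of j "n - j" x] by (intro depends_up_to_conj depends_up_to_eq) (auto intro: up_toI)
  have "(\<Sum>j\<le>n. tp (real j * h) x x * escape x h (n - j)) = (\<Sum>j\<in>{..n}. grid_prob x h (?D j))"
    using restart[OF x h, of _ "\<lambda>_. True"] by (simp add: grid_single up_toI)
  also have "\<dots> = grid_prob x h (\<lambda>f. \<exists>j\<in>{..n}. ?D j f)"
  proof (rule grid_sum[OF x h _ up])
    fix i j f assume *: "i \<in> {..n}" "j \<in> {..n}" "?D i f" "?D j f"
    then show "i = j"
      using avoidsD[of x i "n - i" f j] avoidsD[of x j "n - j" f i]
      by (cases i j rule: linorder_cases) auto
  qed simp_all
  also have "\<dots> = grid_prob x h (\<lambda>f. True)"
  proof (rule grid_cong_start[OF x h])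
    show "depends_up_to n (\<lambda>f. \<exists>j\<in>{..n}. ?D j f)"
      by (rule up_toI, rule bex_cong[OF refl], rule up_toD[OF up]) simp_all
    show "depends_up_to n (\<lambda>f. True)" by (rule up_toI) simp
    fix f :: "nat \<Rightarrow> 's" assume f0: "f 0 = x"
    define j where "j = Max {j. j \<le> n \<and> f j = x}"
    have ne: "finite {j. j \<le> n \<and> f j = x}" "{j. j \<le> n \<and> f j = x} \<noteq> {}" using f0 by auto
    have j: "j \<le> n" "f j = x" using Max_in[OF ne] by (auto simp: j_def)
    have "avoids x j (n - j) f"
      unfolding avoids_def
    proof (intro allI impI notI)
      fix i assume "j < i" "i \<le> j + (n - j)" "f i = x"
      then have "i \<le> j" unfolding j_def using \<open>j \<le> n\<close> by (intro Max_ge[OF ne(1)]) (simp add: j_def)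
      with \<open>j < i\<close> show False by simp
    qed
    then show "(\<exists>j\<in>{..n}. ?D j f) = True" using j by auto
  qed
  finally show ?thesis by (simp add: grid_True x)
qed

lemma no_return_0: "no_return x 0 = (\<lambda>f. True)"
  unfolding no_return_def by (rule ext) simp

text \<open>
  Staying in \<open>x\<close> up to index \<open>j\<close> and avoiding it afterwards are disjoint ways of not having returned.
\<close>

lemma no_return_ge:
  assumes x: "x \<in> E" and h: "0 \<le> h"
  shows "(\<Sum>j\<le>l. tp h x x ^ j * escape x h (l - j)) \<le> grid_prob x h (no_return x l)"
proof -
  let ?D = "\<lambda>j f. no_return x j f \<and> f j = x \<and> avoids x j (l - j) f"
  have up: "depends_up_to l (?D j)" if "j \<in> {..l}" for j
    using that depends_up_to_avoids[of j "l - j" x]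
    by (intro depends_up_to_conj depends_up_to_eq depends_up_to_mono[OF up_to_no_return]) auto
  have "(\<Sum>j\<le>l. tp h x x ^ j * escape x h (l - j)) = (\<Sum>j\<in>{..l}. grid_prob x h (?D j))"
    using restart[OF x h up_to_no_return] away_diag[OF x h] by (simp add: away_def)
  also have "\<dots> = grid_prob x h (\<lambda>f. \<exists>j\<in>{..l}. ?D j f)"
  proof (rule grid_sum[OF x h _ up])
    fix i j f assume *: "i \<in> {..l}" "j \<in> {..l}" "?D i f" "?D j f"
    then show "i = j"
      using avoidsD[of x i "l - i" f j] avoidsD[of x j "l - j" f i]
      by (cases i j rule: linorder_cases) auto
  qed simp_all
  also have "\<dots> \<le> grid_prob x h (no_return x l)"
  proof (rule grid_mono[OF x h up_to_no_return])
    fix f assume "\<exists>j\<in>{..l}. ?D j f"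
    then obtain j where "j \<in> {..l}" "?D j f" by (rule bexE)
    then have j: "j \<le> l" "no_return x j f" "f j = x" "avoids x j (l - j) f" by simp_all
    show "no_return x l f"
    proof (rule no_returnI)
      fix i k assume ik: "i < k" "k \<le> l" "f i \<noteq> x"
      show "f k \<noteq> x"
      proof (cases "k \<le> j")
        case True
        with ik show ?thesis by (intro no_returnD[OF j(2) ik(1)])
      next
        case False
        with ik j(1) have "j < k" "k \<le> j + (l - j)" by simp_all
        with j(4) show ?thesis by (rule avoidsD)
      qed
    qed
  qed
  finally show ?thesis .
qed

lemma escape_antimono:
  assumes "x \<in> E" "0 \<le> h" "l \<le> l'"
  shows "escape x h l' \<le> escape x h l"
proof -
  have "depends_up_to l (avoids x 0 l)" using depends_up_to_avoids[of 0 l x] by simp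
  then show ?thesis
    unfolding escape_def by (rule grid_mono[OF assms(1,2)]) (use assms(3) in \<open>auto simp: avoids_def\<close>)
qed

text \<open>
  The last exit decomposition for a single step.
\<close>

lemma escape_1:
  assumes x: "x \<in> E" and h: "0 \<le> h" and l: "1 \<le> l"
  shows "escape x h l + tp h x x \<le> 1"
proof -
  have "escape x h l + tp h x x \<le> escape x h 1 + tp h x x"
    by (intro add_right_mono escape_antimono x h l)
  also have "\<dots> = (\<Sum>j\<le>1. tp (real j * h) x x * escape x h (1 - j))"
    using x by (simp add: tp_0 escape_def avoids_0 grid_True)
  also have "\<dots> = 1" by (rule last_exit[OF x h])
  finally show ?thesis .
qed

text \<open>
  On a fine grid a single step rarely leaves \<open>x\<close>, so \<open>escape\<close> is small of the order \<open>1 - a\<close>. The bound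
  \<open>no_return_ge\<close> has \<open>l + 1\<close> terms, all at least \<open>a ^ j * escape\<close>, and their geometric series is
  \<open>(1 - a ^ (l + 1)) / (1 - a)\<close>, where \<open>a ^ (l + 1) \<le> a ^ K \<le> p\<close> does not depend on the mesh.
\<close>

lemma escape_le_no_return:
  assumes x: "x \<in> E" and h: "0 \<le> h" and K: "real K * h = 1" and l: "K \<le> Suc l"
    and a: "tp h x x = ennreal a" and p: "tp 1 x x = ennreal p" "0 \<le> a" "0 \<le> p" "a < 1" "p < 1"
  shows "escape x h l \<le> ennreal ((1 - a) / (1 - p)) * grid_prob x h (no_return x l)"
proof -
  obtain r where r: "escape x h l = ennreal r" "0 \<le> r"
    using grid_le_1[OF x, of h "avoids x 0 l"] by (cases "escape x h l") (auto simp: escape_def top_unique)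
  obtain v where v: "grid_prob x h (no_return x l) = ennreal v" "0 \<le> v"
    using grid_le_1[OF x, of h "no_return x l"] by (cases "grid_prob x h (no_return x l)") (auto simp: top_unique)
  have "ennreal ((\<Sum>j\<le>l. a ^ j) * r) = (\<Sum>j\<le>l. tp h x x ^ j * escape x h l)"
    using p r by (simp add: a ennreal_mult ennreal_power sum_ennreal[symmetric] sum_distrib_right sum_nonneg)
  also have "\<dots> \<le> (\<Sum>j\<le>l. tp h x x ^ j * escape x h (l - j))"
    by (intro sum_mono mult_left_mono escape_antimono x h) auto
  also have "\<dots> \<le> ennreal v" using no_return_ge[OF x h, of l] by (simp add: v)
  finally have 1: "(\<Sum>j\<le>l. a ^ j) * r \<le> v" using v by (simp add: ennreal_le_iff)
  have "ennreal (a ^ K) \<le> ennreal p"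
    using tp_power_le[OF x h, of K] p by (simp add: K a ennreal_power)
  then have "a ^ K \<le> p" using p by (simp add: ennreal_le_iff)
  moreover have "a ^ Suc l \<le> a ^ K" using p l by (intro power_decreasing) auto
  ultimately have "1 - p \<le> 1 - a ^ Suc l" by simp
  then have "(1 - p) * r \<le> (1 - a ^ Suc l) * r" using r(2) by (rule mult_right_mono)
  also have "\<dots> = (1 - a) * ((\<Sum>j\<le>l. a ^ j) * r)"
    using sum_gp_basic[of a l] by (simp add: mult.assoc[symmetric])
  also have "\<dots> \<le> (1 - a) * v" using 1 p by (intro mult_left_mono) auto
  finally have "r \<le> (1 - a) / (1 - p) * v" using p by (simp add: field_simps)
  then have "ennreal r \<le> ennreal ((1 - a) / (1 - p) * v)" by (rule ennreal_leI)
  also have "\<dots> = ennreal ((1 - a) / (1 - p)) * ennreal v" by (rule ennreal_mult''[OF v(2)])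
  finally show ?thesis unfolding r v .
qed

text \<open>
  The last exit decomposition on the grid of mesh \<open>1 / K\<close>, collected over time intervals of unit length. In each
  interval, \<open>p\<close> at a grid point is compared with \<open>p\<close> at the end of the interval, and each of the \<open>K\<close> escape
  probabilities is of the order \<open>1 / K\<close>. Hence \<open>C\<close> does not depend on \<open>K\<close>.
\<close>

lemma renewal_inequality:
  assumes x: "x \<in> E"
  obtains C where "C < \<infinity>" "\<forall>\<^sub>F K in sequentially.
    \<forall>n. 1 \<le> tp (real n) x x + C * (\<Sum>j<n. tp (real (n - j)) x x * grid_prob x (1 / real K) (no_return x (j * K)))"
proof -
  obtain p where p: "tp 1 x x = ennreal p" "0 \<le> p" "p < 1"
    using tp_1_less_1[OF x] by (cases "tp 1 x x") auto
  obtain B d where B: "0 \<le> B" "0 < d" "\<And>h. 0 < h \<Longrightarrow> h < d \<Longrightarrow> 1 - trans_prob P Z x h x \<le> B * h"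
    using diagonal_small_time[OF x] by blast
  obtain c where c: "0 < c" "\<And>s. 0 \<le> s \<Longrightarrow> s \<le> 1 \<Longrightarrow> ennreal c \<le> tp s x x"
    using diagonal_lower_bound[OF x, of 1] by blast
  define C where "C = ennreal (B / (1 - p) / c)"
  have "\<forall>n. 1 \<le> tp (real n) x x + C * (\<Sum>j<n. tp (real (n - j)) x x * grid_prob x (1 / real K) (no_return x (j * K)))"
    if K: "K > 0" "1 / d < real K" for K
  proof
    fix n
    define h where "h = 1 / real K"
    have h: "0 < h" "h < d" "real K * h = 1" using K B by (auto simp: h_def field_simps)
    define a where "a = trans_prob P Z x h x"
    have a: "tp h x x = ennreal a" "0 \<le> a" by (simp_all add: a_def tp_eq[OF x] trans_prob_def)
    let ?v = "\<lambda>l. grid_prob x h (no_return x l)"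
    have aB: "1 - a \<le> B * h" unfolding a_def by (rule B(3)[OF h(1,2)])
    have a1: "a < 1"
    proof -
      have "ennreal (a ^ K) \<le> ennreal p"
        using tp_power_le[OF x less_imp_le[OF h(1)], of K] p a by (simp add: h(3) ennreal_power)
      then have "a ^ K < 1" using p by (simp add: ennreal_le_iff)
      then show ?thesis by (metis not_le one_le_power)
    qed
    \<comment> \<open>For \<open>j = 0\<close> the geometric series may still be short, but then the factor \<open>?v 0 = 1\<close> leaves only
      the probability of leaving \<open>x\<close> in one step.\<close>
    have esc: "escape x h (Suc (j * K + i)) \<le> ennreal (B / (1 - p) * h) * ?v (j * K)" if "i < K" for i j
    proof (cases "j = 0")
      case True
      have "escape x h (Suc (j * K + i)) + ennreal a \<le> 1"
        using escape_1[OF x less_imp_le[OF h(1)], of "Suc (j * K + i)"] a by simp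
      then have "escape x h (Suc (j * K + i)) \<le> ennreal (1 - a)"
        using a a1 by (cases "escape x h (Suc (j * K + i))")
           (auto simp: ennreal_plus[symmetric] top_unique simp del: ennreal_plus)
      also have "\<dots> \<le> ennreal (B / (1 - p) * h)"
      proof (rule ennreal_leI)
        have "B * h * (1 - p) \<le> B * h * 1" using B h p by (intro mult_left_mono) auto
        then have "B * h \<le> B / (1 - p) * h" using p by (simp add: field_simps)
        with aB show "1 - a \<le> B / (1 - p) * h" by simp
      qed
      finally show ?thesis
        using True by (simp add: no_return_0 grid_True x)
    next
      case False
      let ?l = "Suc (j * K + i)"
      have "K \<le> j * K" using False by (cases j) auto
      then have "K \<le> Suc ?l" by (rule order_trans) simp
      then have "escape x h ?l \<le> ennreal ((1 - a) / (1 - p)) * ?v ?l"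
        using h p a a1 by (intro escape_le_no_return[OF x, of h K]) auto
      also have "\<dots> \<le> ennreal (B / (1 - p) * h) * ?v (j * K)"
      proof (rule mult_mono)
        show "ennreal ((1 - a) / (1 - p)) \<le> ennreal (B / (1 - p) * h)"
          using aB p by (intro ennreal_leI) (simp add: divide_right_mono)
        show "?v ?l \<le> ?v (j * K)"
        proof (rule grid_mono[OF x less_imp_le[OF h(1)] up_to_no_return])
          fix f assume nr: "no_return x ?l f"
          show "no_return x (j * K) f" by (rule no_returnI, rule no_returnD[OF nr]) simp_all
        qed
      qed auto
      finally show ?thesis .
    qed
    \<comment> \<open>From a grid time to the end of its unit interval the process is in \<open>x\<close> again with
      probability at least \<open>c\<close>.\<close>
    have tpc: "tp (real (n * K - Suc (j * K + i)) * h) x x \<le> tp (real (n - j)) x x * ennreal (1 / c)"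
      if ij: "i < K" "j < n" for i j
    proof -
      let ?s = "real (n * K - Suc (j * K + i)) * h"
      have "Suc (j * K + i) \<le> n * K"
      proof -
        have "Suc (j * K + i) \<le> Suc j * K" using ij by simp
        also have "\<dots> \<le> n * K" using ij by (intro mult_le_mono1) simp
        finally show ?thesis .
      qed
      then have "?s = (real n * real K - (real j * real K + real i + 1)) * h" by (simp add: of_nat_diff)
      also have "\<dots> = real n * (real K * h) - real j * (real K * h) - (real i + 1) * h" by (simp add: algebra_simps)
      also have "\<dots> = real (n - j) - (real i + 1) * h" using ij h by (simp add: of_nat_diff)
      finally have s: "?s = real (n - j) - (real i + 1) * h" .
      have "(real i + 1) * h \<le> real K * h" using ij h by (intro mult_right_mono) auto
      then have rest: "0 \<le> real (n - j) - ?s" "real (n - j) - ?s \<le> 1" using s h by auto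
      have "tp ?s x x * ennreal c \<le> tp ?s x x * tp (real (n - j) - ?s) x x"
        using c(2)[OF rest] by (intro mult_left_mono) auto
      also have "\<dots> \<le> push E (tp ?s x) (tp (real (n - j) - ?s)) x" by (rule push_ge_point[OF x])
      also have "\<dots> = tp (real (n - j)) x x" using tp_CK[OF x x, of ?s "real (n - j) - ?s"] rest h by simp
      finally have "tp ?s x x * ennreal c * ennreal (1 / c) \<le> tp (real (n - j)) x x * ennreal (1 / c)"
        by (rule mult_right_mono) simp
      then show ?thesis using c by (simp add: mult.assoc ennreal_mult'[symmetric])
    qed
    have "1 = (\<Sum>m\<le>n * K. tp (real m * h) x x * escape x h (n * K - m))"
      by (rule last_exit[symmetric, OF x less_imp_le[OF h(1)]])
    also have "\<dots> = (\<Sum>l\<le>n * K. tp (real (n * K - l) * h) x x * escape x h l)"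
      by (rule sum.reindex_bij_witness[of _ "\<lambda>l. n * K - l" "\<lambda>l. n * K - l"]) auto
    also have "\<dots> = tp (real n) x x + (\<Sum>l<n * K. tp (real (n * K - Suc l) * h) x x * escape x h (Suc l))"
    proof -
      have "real (n * K - 0) * h = real n" using h by (simp add: mult.assoc)
      moreover have "escape x h 0 = 1" using x by (simp add: escape_def avoids_0 grid_True)
      ultimately show ?thesis unfolding sum.atMost_shift by (simp only: mult_1_right)
    qed
    also have "(\<Sum>l<n * K. tp (real (n * K - Suc l) * h) x x * escape x h (Suc l))
        = (\<Sum>j<n. \<Sum>l\<in>{j * K..<j * K + K}. tp (real (n * K - Suc l) * h) x x * escape x h (Suc l))"
      by (rule sum.nat_group[symmetric])
    also have "\<dots> = (\<Sum>j<n. \<Sum>i<K. tp (real (n * K - Suc (j * K + i)) * h) x x * escape x h (Suc (j * K + i)))"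
    proof (rule sum.cong[OF refl])
      fix j
      show "(\<Sum>l\<in>{j * K..<j * K + K}. tp (real (n * K - Suc l) * h) x x * escape x h (Suc l))
        = (\<Sum>i<K. tp (real (n * K - Suc (j * K + i)) * h) x x * escape x h (Suc (j * K + i)))"
        by (rule sum.reindex_bij_witness[of _ "\<lambda>i. j * K + i" "\<lambda>l. l - j * K"]) auto
    qed
    also have "\<dots> \<le> (\<Sum>j<n. \<Sum>i<K. (tp (real (n - j)) x x * ennreal (1 / c)) * (ennreal (B / (1 - p) * h) * ?v (j * K)))"
      by (intro sum_mono mult_mono tpc esc) auto
    also have "\<dots> = (\<Sum>j<n. C * (tp (real (n - j)) x x * ?v (j * K)))"
    proof (rule sum.cong)
      fix j
      have "ennreal (real K) * (ennreal (1 / c) * ennreal (B / (1 - p) * h)) = C"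
        using c B p h by (simp add: C_def ennreal_mult'[symmetric] field_simps)
      then have C': "of_nat K * (ennreal (1 / c) * ennreal (B / (1 - p) * h)) = C"
        by (simp add: ennreal_of_nat_eq_real_of_nat)
      have "(\<Sum>i<K. (tp (real (n - j)) x x * ennreal (1 / c)) * (ennreal (B / (1 - p) * h) * ?v (j * K)))
        = (of_nat K * (ennreal (1 / c) * ennreal (B / (1 - p) * h))) * (tp (real (n - j)) x x * ?v (j * K))"
        by (simp add: mult_ac)
      then show "(\<Sum>i<K. (tp (real (n - j)) x x * ennreal (1 / c)) * (ennreal (B / (1 - p) * h) * ?v (j * K)))
          = C * (tp (real (n - j)) x x * ?v (j * K))" unfolding C' .
    qed simp
    finally show "1 \<le> tp (real n) x x + C * (\<Sum>j<n. tp (real (n - j)) x x * grid_prob x (1 / real K) (no_return x (j * K)))"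
      by (simp add: add_left_mono h_def sum_distrib_left)
  qed
  moreover obtain K0 where "1 / d < real K0" using reals_Archimedean2 by blast
  ultimately have "\<forall>\<^sub>F K in sequentially. \<forall>n. 1 \<le> tp (real n) x x
      + C * (\<Sum>j<n. tp (real (n - j)) x x * grid_prob x (1 / real K) (no_return x (j * K)))"
    unfolding eventually_sequentially by (intro exI[of _ "Suc K0"]) auto
  moreover have "C < \<infinity>" by (simp add: C_def)
  ultimately show ?thesis using that by blast
qed

end

section \<open>Positive recurrence forces finite subinvariant measures\<close>

lemma grid_point_between:
  assumes "0 \<le> (\<alpha>::real)" "0 < K" "1 / real K < \<beta> - \<alpha>"
  obtains i :: nat where "\<alpha> < real i * (1 / real K)" "real i * (1 / real K) < \<beta>"
proof
  let ?i = "Suc (nat \<lfloor>\<alpha> * real K\<rfloor>)"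
  have r: "real ?i = real_of_int \<lfloor>\<alpha> * real K\<rfloor> + 1" using assms by simp
  have "\<alpha> * real K < real ?i" unfolding r by linarith
  then show "\<alpha> < real ?i * (1 / real K)" using assms by (simp add: field_simps)
  have "real ?i \<le> \<alpha> * real K + 1" unfolding r by linarith
  also have "\<dots> < \<beta> * real K" using assms by (simp add: field_simps)
  finally show "real ?i * (1 / real K) < \<beta>" using assms by (simp add: field_simps)
qed

context irreducible_jump_process
begin

text \<open>
  Dyadic meshes make the grids nested, so that these events decrease in \<open>k\<close>.
\<close>

definition never_back :: "'s \<Rightarrow> nat \<Rightarrow> nat \<Rightarrow> 'w set" where
  "never_back x j k = {\<omega> \<in> space (P x). no_return x (j * 2 ^ k) (\<lambda>i. Z (real i * (1 / real (2 ^ k))) \<omega>)}"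

lemma never_back_sets: "x \<in> E \<Longrightarrow> never_back x j k \<in> sets (P x)"
  unfolding never_back_def by (rule grid_sets[OF _ _ up_to_no_return]) simp_all

lemma never_back_decseq: "decseq (never_back x j)"
proof (rule decseq_SucI, rule subsetI)
  fix k \<omega> assume \<omega>: "\<omega> \<in> never_back x j (Suc k)"
  have half: "Z (real (2 * i) * (1 / real (2 ^ Suc k))) \<omega> = Z (real i * (1 / real (2 ^ k))) \<omega>" for i
    by simp
  have nr: "no_return x (j * 2 ^ Suc k) (\<lambda>i. Z (real i * (1 / real (2 ^ Suc k))) \<omega>)"
    using \<omega> unfolding never_back_def by blast
  have "no_return x (j * 2 ^ k) (\<lambda>i. Z (real i * (1 / real (2 ^ k))) \<omega>)"
  proof (rule no_returnI)
    fix i l assume il: "i < l" "l \<le> j * 2 ^ k" "Z (real i * (1 / real (2 ^ k))) \<omega> \<noteq> x"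
    have "Z (real (2 * l) * (1 / real (2 ^ Suc k))) \<omega> \<noteq> x"
    proof (rule no_returnD[OF nr])
      show "2 * i < 2 * l" "2 * l \<le> j * 2 ^ Suc k" using il by simp_all
      show "Z (real (2 * i) * (1 / real (2 ^ Suc k))) \<omega> \<noteq> x" unfolding half by (rule il(3))
    qed
    then show "Z (real l * (1 / real (2 ^ k))) \<omega> \<noteq> x" unfolding half .
  qed
  then show "\<omega> \<in> never_back x j k" using \<omega> unfolding never_back_def by blast
qed

text \<open>
  By right-continuity, a visit to \<open>x\<close> before time \<open>j\<close> after an excursion is also seen at dyadic times,
  if the mesh is fine enough.
\<close>

lemma return_time_ge:
  assumes x: "x \<in> E"
  shows "AE \<omega> in P x. \<forall>j. \<omega> \<in> (\<Inter>k. never_back x j k) \<longrightarrow> of_nat j \<le> return_time Z x \<omega>"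
  using right_continuous[OF x]
proof eventually_elim
  case (elim \<omega>)
  have rc: "\<exists>b>t. \<forall>s. t < s \<longrightarrow> s < b \<longrightarrow> Z s \<omega> = Z t \<omega>" if "0 \<le> t" for t
    using elim that by (auto simp: eventually_at_right_field)
  show ?case
  proof (intro allI impI, rule ccontr)
    fix j assume W: "\<omega> \<in> (\<Inter>k. never_back x j k)" and "\<not> of_nat j \<le> return_time Z x \<omega>"
    then have "return_time Z x \<omega> < ennreal (real j)" by (simp add: ennreal_of_nat_eq_real_of_nat)
    then obtain t s where t: "0 < t" "Z t \<omega> = x" "0 < s" "s < t" "Z s \<omega> \<noteq> x" and tj: "ennreal t < ennreal (real j)"
      unfolding return_time_def INF_less_iff by blast
    from tj t have tj: "t < real j" by (simp add: ennreal_less_iff)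
    obtain b where b: "t < b" "\<And>u. t < u \<Longrightarrow> u < b \<Longrightarrow> Z u \<omega> = x" using rc[of t] t by auto
    obtain b' where b': "s < b'" "\<And>u. s < u \<Longrightarrow> u < b' \<Longrightarrow> Z u \<omega> \<noteq> x" using rc[of s] t by auto
    \<comment> \<open>A mesh below \<open>g\<close> puts a grid point into both intervals on which the path is constant.\<close>
    define g where "g = min (min b (real j) - t) (min b' t - s)"
    have g: "0 < g" using b b' t tj by (simp add: g_def)
    obtain k where k: "(1 / 2) ^ k < g" using real_arch_pow_inv[OF g, of "1 / 2"] by auto
    then have k': "1 / real (2 ^ k) < g" by (simp add: power_one_over)
    obtain i where i: "s < real i * (1 / real (2 ^ k))" "real i * (1 / real (2 ^ k)) < min b' t"
      by (rule grid_point_between[of s "2 ^ k" "min b' t"]) (use t k' in \<open>simp_all add: g_def\<close>)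
    obtain l where l: "t < real l * (1 / real (2 ^ k))" "real l * (1 / real (2 ^ k)) < min b (real j)"
      by (rule grid_point_between[of t "2 ^ k" "min b (real j)"]) (use t k' in \<open>simp_all add: g_def\<close>)
    have "real i * (1 / real (2 ^ k)) < real l * (1 / real (2 ^ k))" using i l by linarith
    then have "i < l" by (simp add: divide_less_cancel)
    have "real l < real j * 2 ^ k" using l by (simp add: field_simps)
    then have "real l < real (j * 2 ^ k)" by simp
    then have "l \<le> j * 2 ^ k" by linarith
    have nr: "no_return x (j * 2 ^ k) (\<lambda>i. Z (real i * (1 / real (2 ^ k))) \<omega>)"
      using W unfolding never_back_def by blast
    have "Z (real i * (1 / real (2 ^ k))) \<omega> \<noteq> x" using i by (intro b'(2)) simp_all
    then have "Z (real l * (1 / real (2 ^ k))) \<omega> \<noteq> x" by (rule no_returnD[OF nr \<open>i < l\<close> \<open>l \<le> j * 2 ^ k\<close>])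
    moreover have "Z (real l * (1 / real (2 ^ k))) \<omega> = x" using l by (intro b(2)) simp_all
    ultimately show False by simp
  qed
qed

text \<open>
  On \<open>\<Inter>k. never_back x j k\<close> the return time is at least \<open>j\<close>. Hence the number of positive indices
  for which this event occurs is bounded by the return time.
\<close>

lemma never_back_sum:
  assumes x: "x \<in> E" and rec: "positive_recurrent P Z x"
  obtains S where "S < \<infinity>" "\<And>N. (\<Sum>j<N. emeasure (P x) (\<Inter>k. never_back x j k)) \<le> S"
proof -
  let ?W = "\<lambda>j. \<Inter>k. never_back x j k"
  have W: "?W j \<in> sets (P x)" for j using never_back_sets[OF x] by auto
  have step: "AE \<omega> in P x. (\<Sum>j<N. indicator (?W (Suc j)) \<omega>) \<le> return_time Z x \<omega>" for N
    using return_time_ge[OF x]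
  proof eventually_elim
    case (elim \<omega>)
    show ?case
    proof (induction N)
      case (Suc N)
      show ?case
      proof (cases "\<omega> \<in> ?W (Suc N)")
        case True
        have "(\<Sum>j<Suc N. indicator (?W (Suc j)) \<omega>) \<le> (\<Sum>j<Suc N. 1 :: ennreal)"
          by (intro sum_mono) (simp add: indicator_def)
        also have "\<dots> = of_nat (Suc N)" by simp
        also have "\<dots> \<le> return_time Z x \<omega>" using elim True by blast
        finally show ?thesis .
      next
        case False
        have "(\<Sum>j<Suc N. indicator (?W (Suc j)) \<omega>) = (\<Sum>j<N. indicator (?W (Suc j)) \<omega> :: ennreal) + indicator (?W (Suc N)) \<omega>"
          by (rule sum.lessThan_Suc)
        also have "\<dots> = (\<Sum>j<N. indicator (?W (Suc j)) \<omega>)" unfolding indicator_simps(2)[OF False] by simp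
        also have "\<dots> \<le> return_time Z x \<omega>" by (rule Suc.IH)
        finally show ?thesis .
      qed
    qed simp
  qed
  let ?R = "\<integral>\<^sup>+ \<omega>. return_time Z x \<omega> \<partial>P x"
  have bound: "(\<Sum>j<N. emeasure (P x) (?W (Suc j))) \<le> ?R" for N
  proof -
    have "(\<Sum>j<N. emeasure (P x) (?W (Suc j))) = (\<Sum>j<N. \<integral>\<^sup>+ \<omega>. indicator (?W (Suc j)) \<omega> \<partial>P x)"
      by (simp only: nn_integral_indicator[OF W])
    also have "\<dots> = (\<integral>\<^sup>+ \<omega>. (\<Sum>j<N. indicator (?W (Suc j)) \<omega>) \<partial>P x)"
      by (rule nn_integral_sum[symmetric]) (rule borel_measurable_indicator[OF W])
    also have "\<dots> \<le> ?R" by (rule nn_integral_mono_AE[OF step])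
    finally show ?thesis .
  qed
  show ?thesis
  proof (rule that[of "1 + ?R"])
    show "1 + ?R < \<infinity>" using rec by (simp add: positive_recurrent_def)
    fix N
    have "(\<Sum>j<N. emeasure (P x) (?W j)) \<le> (\<Sum>j<Suc N. emeasure (P x) (?W j))" by simp
    also have "\<dots> = emeasure (P x) (?W 0) + (\<Sum>j<N. emeasure (P x) (?W (Suc j)))"
      by (rule sum.lessThan_Suc_shift)
    also have "\<dots> \<le> 1 + ?R"
      by (rule add_mono[OF prob_space.emeasure_le_1[OF prob_space_P[OF x]] bound])
    finally show "(\<Sum>j<N. emeasure (P x) (?W j)) \<le> 1 + ?R" .
  qed
qed

text \<open>
  The renewal inequality in the limit of fine grids, summed over \<open>n < N\<close>. The double sum is a
  convolution, bounded by the product of the total mass of one factor and the partial sum of the other.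
\<close>

lemma positive_recurrent_average:
  assumes x: "x \<in> E" and rec: "positive_recurrent P Z x"
  obtains D where "D < \<infinity>" "\<And>N. of_nat N \<le> D * (\<Sum>n<N. tp (real (Suc n)) x x)"
proof -
  let ?w = "\<lambda>j. emeasure (P x) (\<Inter>k. never_back x j k)"
  let ?p = "\<lambda>n. tp (real n) x x"
  obtain S where S: "S < \<infinity>" "\<And>N. (\<Sum>j<N. ?w j) \<le> S" using never_back_sum[OF x rec] by blast
  obtain C where C: "C < \<infinity>" and ev: "\<forall>\<^sub>F K in sequentially.
    \<forall>n. 1 \<le> ?p n + C * (\<Sum>j<n. ?p (n - j) * grid_prob x (1 / real K) (no_return x (j * K)))"
    using renewal_inequality[OF x] by blast
  have lim: "(\<lambda>k. grid_prob x (1 / real (2 ^ k)) (no_return x (j * 2 ^ k))) \<longlonglongrightarrow> ?w j" for j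
  proof -
    have "(\<lambda>k. emeasure (P x) (never_back x j k)) \<longlonglongrightarrow> ?w j"
    proof (rule Lim_emeasure_decseq[OF _ never_back_decseq])
      show "range (never_back x j) \<subseteq> sets (P x)" using never_back_sets[OF x] by auto
      fix k show "emeasure (P x) (never_back x j k) \<noteq> \<infinity>"
        by (simp add: finite_measure.emeasure_finite[OF prob_space.finite_measure[OF prob_space_P[OF x]]])
    qed
    then show ?thesis by (simp only: never_back_def grid_prob_def)
  qed
  have p_fin: "?p n < top" for n by (rule le_less_trans[OF tp_le_1[OF x]]) simp
  have renewal: "1 \<le> ?p n + C * (\<Sum>j<n. ?p (n - j) * ?w j)" for n
  proof (rule tendsto_lowerbound)
    show "((\<lambda>k. ?p n + C * (\<Sum>j<n. ?p (n - j) * grid_prob x (1 / real (2 ^ k)) (no_return x (j * 2 ^ k))))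
        \<longlongrightarrow> ?p n + C * (\<Sum>j<n. ?p (n - j) * ?w j)) sequentially"
      using C by (intro tendsto_add tendsto_const ennreal_tendsto_cmult tendsto_sum lim p_fin) simp
    have "strict_mono (\<lambda>k. 2 ^ k :: nat)" by (rule strict_monoI) simp
    from eventually_subseq[OF this ev]
    show "\<forall>\<^sub>F k in sequentially. 1 \<le> ?p n + C * (\<Sum>j<n. ?p (n - j) * grid_prob x (1 / real (2 ^ k)) (no_return x (j * 2 ^ k)))"
      by (rule eventually_mono) blast
  qed simp
  show ?thesis
  proof (rule that[of "1 + C * S"])
    show "1 + C * S < \<infinity>" using C S by (simp add: ennreal_mult_less_top)
    fix N
    have conv: "(\<Sum>n<N. \<Sum>j<Suc n. ?p (Suc n - j) * ?w j) \<le> S * (\<Sum>n<N. ?p (Suc n))"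
    proof -
      have "(\<Sum>n<N. \<Sum>j<Suc n. ?p (Suc n - j) * ?w j) = (\<Sum>n<N. \<Sum>j\<le>n. ?w j * ?p (Suc (n - j)))"
        by (simp only: lessThan_Suc_atMost) (intro sum.cong refl, simp add: Suc_diff_le mult.commute)
      also have "\<dots> = (\<Sum>(j, i)\<in>{(j, i). j + i < N}. ?w j * ?p (Suc i))"
        by (rule sum.triangle_reindex[symmetric])
      also have "\<dots> \<le> (\<Sum>(j, i)\<in>{..<N} \<times> {..<N}. ?w j * ?p (Suc i))"
        by (rule sum_mono2) auto
      also have "\<dots> = (\<Sum>j<N. ?w j) * (\<Sum>i<N. ?p (Suc i))"
        by (simp only: sum.cartesian_product[symmetric] sum_product)
      also have "\<dots> \<le> S * (\<Sum>i<N. ?p (Suc i))" by (rule mult_right_mono[OF S(2)]) simp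
      finally show ?thesis .
    qed
    have "of_nat N = (\<Sum>n<N. 1 :: ennreal)" by simp
    also have "\<dots> \<le> (\<Sum>n<N. ?p (Suc n) + C * (\<Sum>j<Suc n. ?p (Suc n - j) * ?w j))"
      by (rule sum_mono) (rule renewal)
    also have "\<dots> = (\<Sum>n<N. ?p (Suc n)) + C * (\<Sum>n<N. \<Sum>j<Suc n. ?p (Suc n - j) * ?w j)"
      by (simp only: sum.distrib sum_distrib_left)
    also have "\<dots> \<le> (\<Sum>n<N. ?p (Suc n)) + C * (S * (\<Sum>n<N. ?p (Suc n)))"
      by (intro add_left_mono mult_left_mono conv) simp
    also have "\<dots> = (1 + C * S) * (\<Sum>n<N. ?p (Suc n))" by (simp add: distrib_right mult.assoc)
    finally show "of_nat N \<le> (1 + C * S) * (\<Sum>n<N. ?p (Suc n))" .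
  qed
qed

lemma invariant_tp_nat:
  assumes inv: "\<And>y. y \<in> E \<Longrightarrow> push E \<pi> (tp 1) y = \<pi> y" and y: "y \<in> E"
  shows "push E \<pi> (tp (real n)) y = \<pi> y"
  using y
proof (induction n arbitrary: y)
  case 0
  have "push E \<pi> (tp (real 0)) y = (\<Sum>x\<in>{y}. \<pi> x * tp (real 0) x y)"
    unfolding push_def by (rule nn_integral_count_space') (use 0 in \<open>auto simp: tp_0\<close>)
  then show ?case using 0 by (simp add: tp_0)
next
  case (Suc n)
  have "push E \<pi> (tp (real (Suc n))) y = push E \<pi> (\<lambda>x. push E (tp (real n) x) (tp 1)) y"
    unfolding push_def[of E \<pi>]
    by (rule nn_integral_cong) (use tp_CK[of _ y "real n" 1] Suc.prems in \<open>simp add: add.commute\<close>)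
  also have "\<dots> = push E (push E \<pi> (tp (real n))) (tp 1) y" by (rule push_push[symmetric])
  also have "\<dots> = push E \<pi> (tp 1) y" by (rule push_cong) (rule Suc.IH)
  finally show ?case using inv[OF Suc.prems] by simp
qed

text \<open>
  The averages of \<open>P\<^sub>n(x, \<cdot>)\<close> keep a positive amount of mass at \<open>x\<close>, so their limit is not zero.
\<close>

theorem positive_recurrent_imp_invariant:
  assumes x: "x \<in> E" and rec: "positive_recurrent P Z x"
  obtains \<pi> where "(\<integral>\<^sup>+ y. \<pi> y \<partial>count_space E) = 1" "\<And>y. y \<in> E \<Longrightarrow> push E \<pi> (tp 1) y = \<pi> y" "0 < \<pi> x"
proof -
  obtain D where D: "D < \<infinity>" "\<And>N. of_nat N \<le> D * (\<Sum>n<N. tp (real (Suc n)) x x)"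
    using positive_recurrent_average[OF x rec] by blast
  let ?a = "\<lambda>n. tp (real (Suc n)) x"
  have st: "stochastic_on E (tp 1)" by (rule stochastic_tp) simp
  have step: "?a (Suc n) y = push E (?a n) (tp 1) y" if "y \<in> E" for n y
    using tp_CK[OF x that, of "real (Suc n)" 1] by (simp add: algebra_simps)
  have mass: "(\<integral>\<^sup>+ y. ?a n y \<partial>count_space E) = 1" for n
    using stochastic_tp[of "real (Suc n)"] x by (simp add: stochastic_on_def)
  obtain \<rho> r where r: "strict_mono (r::nat \<Rightarrow> nat)"
    and lim: "\<And>y. y \<in> E \<Longrightarrow> (\<lambda>n. (\<Sum>i<r n. ?a i y) / of_nat (r n)) \<longlonglongrightarrow> \<rho> y"
    and sub: "\<And>y. y \<in> E \<Longrightarrow> push E \<rho> (tp 1) y \<le> \<rho> y" and m1: "(\<integral>\<^sup>+ y. \<rho> y \<partial>count_space E) \<le> 1"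
  proof (rule cesaro_subinvariant[where a = ?a, OF st])
    fix \<rho> and r :: "nat \<Rightarrow> nat"
    assume "strict_mono r" "\<And>y. y \<in> E \<Longrightarrow> (\<lambda>n. (\<Sum>i<r n. ?a i y) / of_nat (r n)) \<longlonglongrightarrow> \<rho> y"
      "\<And>y. y \<in> E \<Longrightarrow> push E \<rho> (tp 1) y \<le> \<rho> y" "(\<integral>\<^sup>+ y. \<rho> y \<partial>count_space E) \<le> 1"
    then show thesis by (rule that)
  next
    show "?a (Suc n) y = push E (?a n) (tp 1) y" if "y \<in> E" for n y using that by (rule step)
    show "(\<integral>\<^sup>+ y. ?a n y \<partial>count_space E) = 1" for n by (rule mass)
  qed
  have "1 \<le> D * \<rho> x"
  proof (rule tendsto_lowerbound)
    show "((\<lambda>n. D * ((\<Sum>i<r n. ?a i x) / of_nat (r n))) \<longlongrightarrow> D * \<rho> x) sequentially"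
      using D by (intro ennreal_tendsto_cmult lim x) simp
    show "\<forall>\<^sub>F n in sequentially. 1 \<le> D * ((\<Sum>i<r n. ?a i x) / of_nat (r n))"
      using eventually_gt_at_top[of 0]
    proof eventually_elim
      case (elim n)
      have pos: "0 < r n" using elim seq_suble[OF r, of n] by simp
      have "1 = (of_nat (r n) / of_nat (r n) :: ennreal)"
        using pos by (simp add: ennreal_divide_self ennreal_of_nat_eq_real_of_nat)
      also have "\<dots> \<le> (D * (\<Sum>i<r n. ?a i x)) / of_nat (r n)" by (rule divide_right_mono_ennreal[OF D(2)])
      finally show ?case by (simp only: ennreal_times_divide)
    qed
  qed simp
  then have \<rho>x: "0 < \<rho> x" by (metis mult_zero_right not_one_le_zero zero_less_iff_neq_zero)
  let ?M = "\<integral>\<^sup>+ y. \<rho> y \<partial>count_space E"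
  have M: "0 < ?M" "?M < \<infinity>"
    using nn_integral_ge_point[OF x, of \<rho>] \<rho>x m1 by (auto intro: less_le_trans le_less_trans[of _ 1])
  show ?thesis
  proof (rule that[of "\<lambda>y. inverse ?M * \<rho> y"])
    show "(\<integral>\<^sup>+ y. inverse ?M * \<rho> y \<partial>count_space E) = 1"
    proof -
      have "(\<integral>\<^sup>+ y. inverse ?M * \<rho> y \<partial>count_space E) = ?M * inverse ?M"
        unfolding mult.commute[of "inverse ?M"] by (rule nn_integral_multc) simp
      also have "\<dots> = ?M / ?M" by (simp only: divide_ennreal_def)
      also have "\<dots> = 1" using M by (intro ennreal_divide_self) auto
      finally show ?thesis .
    qed
    show "push E (\<lambda>y. inverse ?M * \<rho> y) (tp 1) y = inverse ?M * \<rho> y" if "y \<in> E" for y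
      unfolding push_cmult using subinvariant_imp_invariant[OF st sub M(2) that] by simp
    show "0 < inverse ?M * \<rho> x" using M \<rho>x by (auto simp: ennreal_zero_less_mult_iff zero_less_iff_neq_zero)
  qed
qed

lemma tp_converges:
  assumes mass: "(\<integral>\<^sup>+ y. \<pi> y \<partial>count_space E) = 1" and inv: "\<And>y. y \<in> E \<Longrightarrow> push E \<pi> (tp 1) y = \<pi> y" 
    and x: "x \<in> E"
  shows "(\<lambda>n. overlap E (tp (real n) x) \<pi>) \<longlonglongrightarrow> 1"
proof (rule overlap_tendsto_1[where K = "\<lambda>n. tp (real n)"])
  show "tp (real (m + n)) x y = push E (tp (real m) x) (tp (real n)) y" if "x \<in> E" "y \<in> E" for m n x y
    using tp_CK[OF that, of "real m" "real n"] by simp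
qed (simp_all add: stochastic_tp invariant_tp_nat[OF inv] mass tp_eventually_positive_nat x)

text \<open>
  The invariant distribution provides a positive limit of \<open>P\<^sub>n(u, x)\<close> for all \<open>u\<close>.
\<close>

theorem positive_recurrent_imp_finite:
  assumes x: "x \<in> E" and rec: "positive_recurrent P Z x"
    and sub: "\<And>n y. y \<in> E \<Longrightarrow> push E m (tp (real n)) y \<le> m y" and fin: "\<And>y. y \<in> E \<Longrightarrow> m y < \<infinity>"
  shows "(\<integral>\<^sup>+ y. m y \<partial>count_space E) < \<infinity>"
proof -
  obtain \<pi> where \<pi>: "(\<integral>\<^sup>+ y. \<pi> y \<partial>count_space E) = 1" "\<And>y. y \<in> E \<Longrightarrow> push E \<pi> (tp 1) y = \<pi> y" "0 < \<pi> x"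
    using positive_recurrent_imp_invariant[OF x rec] by blast
  have lim: "(\<lambda>n. tp (real n) u x) \<longlonglongrightarrow> \<pi> x" if u: "u \<in> E" for u
  proof -
    have "(\<integral>\<^sup>+ y. tp (real n) u y \<partial>count_space E) = 1" for n
      using stochastic_tp[of "real n"] u by (simp add: stochastic_on_def)
    from overlap_tendsto_event[OF tp_converges[OF \<pi>(1,2) u] this \<pi>(1), of "{x}"] x
    show ?thesis by (simp add: nn_integral_count_space_finite)
  qed
  have "(\<integral>\<^sup>+ y. m y \<partial>count_space E) * \<pi> x \<le> m x"
    by (rule subinvariant_mass_bound[where K = "\<lambda>n. tp (real n)"]) (simp_all add: sub x lim fin[simplified])
  also have "\<dots> < \<infinity>" by (rule fin[OF x])
  finally have "(\<integral>\<^sup>+ y. m y \<partial>count_space E) * \<pi> x \<noteq> top" by simp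
  then have "(\<integral>\<^sup>+ y. m y \<partial>count_space E) \<noteq> top" using \<pi>(3) by (metis ennreal_top_mult not_less_zero)
  then show ?thesis by (simp add: top.not_eq_extremum)
qed

text \<open>
  Since the overlap does not decrease in time, its limit along the integers is its limit along the reals.
\<close>

theorem tp_overlap_tendsto:
  assumes mass: "(\<integral>\<^sup>+ y. \<pi> y \<partial>count_space E) = 1"
    and inv: "\<And>t y. 0 \<le> t \<Longrightarrow> y \<in> E \<Longrightarrow> push E \<pi> (tp t) y = \<pi> y" and x: "x \<in> E"
  shows "((\<lambda>t. overlap E (tp t x) \<pi>) \<longlongrightarrow> 1) at_top"
proof (rule tendsto_sandwich)
  have "filterlim (\<lambda>t::real. nat \<lfloor>t\<rfloor>) sequentially at_top"
    by (rule filterlim_compose[OF filterlim_nat_sequentially filterlim_floor_sequentially])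
  from filterlim_compose[OF tp_converges[OF mass inv[of 1] x] this]
  show "((\<lambda>t::real. overlap E (tp (real (nat \<lfloor>t\<rfloor>)) x) \<pi>) \<longlongrightarrow> 1) at_top" by simp
  show "\<forall>\<^sub>F t in at_top. overlap E (tp (real (nat \<lfloor>t\<rfloor>)) x) \<pi> \<le> overlap E (tp t x) \<pi>"
    using eventually_ge_at_top[of 0]
  proof eventually_elim
    case (elim t)
    define n where "n = real (nat \<lfloor>t\<rfloor>)"
    have n: "0 \<le> n" "n \<le> t" using elim by (auto simp: n_def)
    have "overlap E (tp n x) \<pi> \<le> overlap E (push E (tp n x) (tp (t - n))) (push E \<pi> (tp (t - n)))"
      using n by (intro overlap_le_push stochastic_tp) simp
    also have "\<dots> = overlap E (tp t x) \<pi>"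
      by (rule overlap_cong) (use n inv[of "t - n"] tp_CK[OF x, of _ n "t - n"] in simp_all)
    finally show ?case by (simp add: n_def)
  qed
  show "\<forall>\<^sub>F t in at_top. overlap E (tp t x) \<pi> \<le> 1"
    by (rule always_eventually) (simp add: overlap_le_1 mass)
qed simp

section \<open>Limiting and stationary distributions\<close>

lemma distribution_mass:
  assumes "distribution_on E \<alpha>"
  shows "(\<integral>\<^sup>+ x. ennreal (\<alpha> x) \<partial>count_space E) = 1"
proof -
  have "(\<alpha> has_sum 1) E" "\<And>x. x \<in> E \<Longrightarrow> 0 \<le> \<alpha> x" using assms by (auto simp: distribution_on_def)
  then show ?thesis by (subst nn_integral_eq_infsum) (auto simp: summable_on_def infsumI)
qed

lemma ennreal_init_prob:
  assumes \<alpha>: "distribution_on E \<alpha>"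
  shows "ennreal (init_prob E P \<alpha> A)
    = (\<integral>\<^sup>+ x. ennreal (\<alpha> x) * emeasure (P x) {\<omega> \<in> space (P x). A \<omega>} \<partial>count_space E)"
proof -
  have nn: "0 \<le> \<alpha> x" if "x \<in> E" for x using \<alpha> that by (auto simp: distribution_on_def)
  have "\<alpha> summable_on E" using \<alpha> by (auto simp: distribution_on_def summable_on_def)
  then have "(\<lambda>x. \<alpha> x * \<P>(\<omega> in P x. A \<omega>)) summable_on E"
  proof (rule summable_on_comparison_test)
    fix x assume x: "x \<in> E"
    interpret prob_space "P x" by (rule prob_space_P[OF x])
    show "\<alpha> x * \<P>(\<omega> in P x. A \<omega>) \<le> \<alpha> x" using nn[OF x] by (simp add: mult_left_le)
    show "0 \<le> \<alpha> x * \<P>(\<omega> in P x. A \<omega>)" using nn[OF x] by simp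
  qed
  then have "ennreal (init_prob E P \<alpha> A) = (\<integral>\<^sup>+ x. ennreal (\<alpha> x * \<P>(\<omega> in P x. A \<omega>)) \<partial>count_space E)"
    unfolding init_prob_def by (intro nn_integral_eq_infsum[symmetric]) (simp_all add: nn)
  also have "\<dots> = (\<integral>\<^sup>+ x. ennreal (\<alpha> x) * emeasure (P x) {\<omega> \<in> space (P x). A \<omega>} \<partial>count_space E)"
  proof (rule nn_integral_cong)
    fix x assume "x \<in> space (count_space E)"
    then have x: "x \<in> E" by simp
    interpret prob_space "P x" by (rule prob_space_P[OF x])
    show "ennreal (\<alpha> x * \<P>(\<omega> in P x. A \<omega>)) = ennreal (\<alpha> x) * emeasure (P x) {\<omega> \<in> space (P x). A \<omega>}"
      using nn[OF x] by (simp add: ennreal_mult' emeasure_eq_measure)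
  qed
  finally show ?thesis .
qed

lemma init_prob_nonneg: "distribution_on E \<alpha> \<Longrightarrow> 0 \<le> init_prob E P \<alpha> A"
  unfolding init_prob_def by (rule infsum_nonneg) (simp add: distribution_on_def)

text \<open>
  Convergence for a fixed starting point is uniform over events. The mixture over \<open>\<alpha>\<close> converges by
  dominated convergence.
\<close>

theorem init_prob_tendsto:
  assumes \<pi>: "distribution_on E \<pi>" and \<alpha>: "distribution_on E \<alpha>"
    and inv: "\<And>t y. 0 \<le> t \<Longrightarrow> y \<in> E \<Longrightarrow> push E (\<lambda>x. ennreal (\<pi> x)) (tp t) y = ennreal (\<pi> y)"
  shows "((\<lambda>t. init_prob E P \<alpha> (\<lambda>\<omega>. R (Z t \<omega>))) \<longlongrightarrow> (\<Sum>\<^sub>\<infinity>y\<in>{y \<in> E. R y}. \<pi> y)) at_top"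
proof -
  let ?B = "{y \<in> E. R y}"
  let ?e = "\<lambda>t x. emeasure (P x) {\<omega> \<in> space (P x). R (Z t \<omega>)}"
  have nn: "0 \<le> \<pi> x" if "x \<in> E" for x using \<pi> that by (auto simp: distribution_on_def)
  have "\<pi> summable_on E" using \<pi> by (auto simp: distribution_on_def summable_on_def)
  then have sB: "\<pi> summable_on ?B" by (rule summable_on_subset_banach) auto
  have \<pi>B: "(\<integral>\<^sup>+ y. ennreal (\<pi> y) \<partial>count_space ?B) = ennreal (infsum \<pi> ?B)"
    by (rule nn_integral_eq_infsum[OF sB]) (simp add: nn)
  have point: "((\<lambda>t. ?e t x) \<longlongrightarrow> ennreal (infsum \<pi> ?B)) at_top" if x: "x \<in> E" for x
  proof -
    let ?a = "\<lambda>t. tp (max 0 t) x"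
    have "((\<lambda>t. overlap E (?a t) (\<lambda>x. ennreal (\<pi> x))) \<longlongrightarrow> 1) at_top"
    proof (rule Lim_transform_eventually[OF tp_overlap_tendsto[OF distribution_mass[OF \<pi>] inv x]])
      show "\<forall>\<^sub>F t in at_top. overlap E (tp t x) (\<lambda>x. ennreal (\<pi> x)) = overlap E (?a t) (\<lambda>x. ennreal (\<pi> x))"
        using eventually_ge_at_top[of 0] by eventually_elim (simp add: max_def)
    qed
    moreover have "(\<integral>\<^sup>+ y. ?a t y \<partial>count_space E) = 1" for t
      using stochastic_tp[of "max 0 t"] x by (simp add: stochastic_on_def)
    ultimately have "((\<lambda>t. \<integral>\<^sup>+ y. ?a t y \<partial>count_space ?B) \<longlongrightarrow> (\<integral>\<^sup>+ y. ennreal (\<pi> y) \<partial>count_space ?B)) at_top"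
      using distribution_mass[OF \<pi>] by (rule overlap_tendsto_event) auto
    then have "((\<lambda>t. \<integral>\<^sup>+ y. ?a t y \<partial>count_space ?B) \<longlongrightarrow> ennreal (infsum \<pi> ?B)) at_top"
      unfolding \<pi>B .
    then show ?thesis
    proof (rule Lim_transform_eventually)
      show "\<forall>\<^sub>F t in at_top. (\<integral>\<^sup>+ y. ?a t y \<partial>count_space ?B) = ?e t x"
        using eventually_ge_at_top[of 0]
      proof eventually_elim
        case (elim t)
        have "emeasure (P x) (\<Union>y\<in>?B. {\<omega> \<in> space (P x). Z t \<omega> = y})
            = (\<integral>\<^sup>+ y. emeasure (P x) {\<omega> \<in> space (P x). Z t \<omega> = y} \<partial>count_space ?B)"
          by (rule emeasure_UN_countable) (auto intro: Z_eq_sets[OF x elim] simp: disjoint_family_on_def)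
        also have "(\<Union>y\<in>?B. {\<omega> \<in> space (P x). Z t \<omega> = y}) = {\<omega> \<in> space (P x). R (Z t \<omega>)}"
          using Z_in_E[OF x elim] by auto
        finally show ?case using elim by (simp add: tp_def max_def)
      qed
    qed
  qed
  have "((\<lambda>t. ennreal (init_prob E P \<alpha> (\<lambda>\<omega>. R (Z t \<omega>)))) \<longlongrightarrow> ennreal (infsum \<pi> ?B)) at_top"
  proof (rule tendsto_at_topI_sequentially)
    fix X :: "nat \<Rightarrow> real" assume X: "filterlim X at_top sequentially"
    have "(\<lambda>n. \<integral>\<^sup>+ x. ennreal (\<alpha> x) * ?e (X n) x \<partial>count_space E)
        \<longlonglongrightarrow> (\<integral>\<^sup>+ x. ennreal (\<alpha> x) * ennreal (infsum \<pi> ?B) \<partial>count_space E)"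
    proof (rule nn_integral_dominated_convergence[where w = "\<lambda>x. ennreal (\<alpha> x)"])
      show "AE x in count_space E. ennreal (\<alpha> x) * ?e (X n) x \<le> ennreal (\<alpha> x)" for n
        using mult_left_mono[OF prob_space.emeasure_le_1[OF prob_space_P]] by (force simp: AE_count_space)
      show "AE x in count_space E. (\<lambda>n. ennreal (\<alpha> x) * ?e (X n) x) \<longlonglongrightarrow> ennreal (\<alpha> x) * ennreal (infsum \<pi> ?B)"
        unfolding AE_count_space
        by (intro ballI ennreal_tendsto_cmult filterlim_compose[OF point X]) simp_all
      show "(\<integral>\<^sup>+ x. ennreal (\<alpha> x) \<partial>count_space E) < \<infinity>" by (simp add: distribution_mass[OF \<alpha>])
    qed simp_all
    also have "(\<integral>\<^sup>+ x. ennreal (\<alpha> x) * ennreal (infsum \<pi> ?B) \<partial>count_space E) = ennreal (infsum \<pi> ?B)"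
      by (simp add: nn_integral_multc distribution_mass[OF \<alpha>])
    finally show "(\<lambda>n. ennreal (init_prob E P \<alpha> (\<lambda>\<omega>. R (Z (X n) \<omega>)))) \<longlonglongrightarrow> ennreal (infsum \<pi> ?B)"
      unfolding ennreal_init_prob[OF \<alpha>] .
  qed
  then show ?thesis
    by (subst (asm) tendsto_ennreal_iff) (auto intro!: infsum_nonneg always_eventually simp: init_prob_nonneg[OF \<alpha>] nn)
qed

lemma balance_imp_invariant:
  assumes \<pi>: "distribution_on E \<pi>" and pos: "\<And>x. x \<in> E \<Longrightarrow> 0 < \<pi> x"
    and gen: "\<And>F y. finite F \<Longrightarrow> F \<subseteq> E \<Longrightarrow> y \<in> F \<Longrightarrow> (\<Sum>u\<in>F. \<pi> u * q u y) \<le> 0"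
    and t: "0 \<le> t" and y: "y \<in> E"
  shows "push E (\<lambda>x. ennreal (\<pi> x)) (tp t) y = ennreal (\<pi> y)"
  by (rule subinvariant_imp_invariant[OF stochastic_tp[OF t] subinvariant_tp[OF pos gen t] _ y])
     (simp_all add: distribution_mass[OF \<pi>])

theorem balance_imp_limiting:
  assumes \<pi>: "distribution_on E \<pi>" and pos: "\<And>x. x \<in> E \<Longrightarrow> 0 < \<pi> x"
    and gen: "\<And>F y. finite F \<Longrightarrow> F \<subseteq> E \<Longrightarrow> y \<in> F \<Longrightarrow> (\<Sum>u\<in>F. \<pi> u * q u y) \<le> 0"
  shows "limiting_distribution E P Z \<pi>" "stationary_distribution E P Z \<pi>"
proof -
  show "limiting_distribution E P Z \<pi>"
    unfolding limiting_distribution_def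
  proof (intro conjI allI impI ballI \<pi>)
    fix \<alpha> y assume \<alpha>: "distribution_on E \<alpha>" and y: "y \<in> E"
    have "{z \<in> E. z = y} = {y}" using y by auto
    then have "(\<Sum>\<^sub>\<infinity>z\<in>{z \<in> E. z = y}. \<pi> z) = \<pi> y" by simp
    with init_prob_tendsto[OF \<pi> \<alpha> balance_imp_invariant[OF \<pi> pos gen], of "\<lambda>z. z = y"]
    show "((\<lambda>t. init_prob E P \<alpha> (\<lambda>\<omega>. Z t \<omega> = y)) \<longlongrightarrow> \<pi> y) at_top" by simp
  qed
  show "stationary_distribution E P Z \<pi>"
    unfolding stationary_distribution_def
  proof (intro conjI allI impI ballI \<pi>)
    fix t :: real and y assume t: "0 \<le> t" and y: "y \<in> E"
    have "ennreal (init_prob E P \<pi> (\<lambda>\<omega>. Z t \<omega> = y)) = ennreal (\<pi> y)"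
      using balance_imp_invariant[OF \<pi> pos gen t y] unfolding ennreal_init_prob[OF \<pi>] push_def tp_def .
    then show "init_prob E P \<pi> (\<lambda>\<omega>. Z t \<omega> = y) = \<pi> y"
      using init_prob_nonneg[OF \<pi>] pos[OF y] by (simp add: ennreal_inj less_imp_le)
  qed
qed

text \<open>
  Start the process in \<open>\<pi>'\<close>: the distribution at time \<open>t\<close> tends to \<open>\<pi>\<close>.
\<close>

lemma limiting_unique:
  assumes lim: "limiting_distribution E P Z \<pi>"
    and other: "limiting_distribution E P Z \<pi>' \<or> stationary_distribution E P Z \<pi>'" and y: "y \<in> E"
  shows "\<pi>' y = \<pi> y"
proof -
  have d: "distribution_on E \<pi>'"
    using other by (auto simp: limiting_distribution_def stationary_distribution_def)
  let ?f = "\<lambda>t. init_prob E P \<pi>' (\<lambda>\<omega>. Z t \<omega> = y)"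
  have 1: "(?f \<longlongrightarrow> \<pi> y) at_top" using lim d y by (auto simp: limiting_distribution_def)
  from other have 2: "(?f \<longlongrightarrow> \<pi>' y) at_top"
  proof
    assume "stationary_distribution E P Z \<pi>'"
    then have "\<pi>' y = ?f t" if "0 \<le> t" for t
      using that y by (simp add: stationary_distribution_def)
    then have "\<forall>\<^sub>F t in at_top. \<pi>' y = ?f t"
      by (rule eventually_mono[OF eventually_ge_at_top[of 0]])
    then show ?thesis by (rule Lim_transform_eventually[OF tendsto_const])
  qed (use d y in \<open>auto simp: limiting_distribution_def\<close>)
  show ?thesis by (rule tendsto_unique[OF _ 2 1]) simp
qed

end

section \<open>The inventory component\<close>

lemma order_unit_apply [simp]:
  "order_unit i k None = k None + 1" "order_unit i k (Some j) = (if j = i then k (Some i) - 1 else k (Some j))"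
  by (auto simp: order_unit_def)

lemma deliver_unit_apply [simp]:
  "deliver_unit i k None = k None - 1" "deliver_unit i k (Some j) = (if j = i then k (Some i) + 1 else k (Some j))"
  by (auto simp: deliver_unit_def)

lemma inventory_eqI:
  fixes k :: "'j option \<Rightarrow> 'a"
  shows "k None = k' None \<Longrightarrow> (\<And>j. k (Some j) = k' (Some j)) \<Longrightarrow> k = k'"
  by (rule ext) (metis not_None_eq)

lemma supplier_pos:
  assumes "k \<in> inventories b" "k (Some i) < b i"
  shows "0 < k None"
proof -
  have "b i - k (Some i) \<le> (\<Sum>j\<in>UNIV. b j - k (Some j))" by (rule member_le_sum) auto
  then show ?thesis using assms by (auto simp: inventories_def)
qed

lemma sum_change_one:
  fixes f g :: "'j::finite \<Rightarrow> nat"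
  assumes "f i = Suc (g i)" "\<And>j. j \<noteq> i \<Longrightarrow> f j = g j"
  shows "(\<Sum>j\<in>UNIV. f j) = Suc (\<Sum>j\<in>UNIV. g j)"
proof -
  have "(\<Sum>j\<in>UNIV. f j) = f i + (\<Sum>j\<in>UNIV - {i}. f j)" by (rule sum.remove) auto
  also have "(\<Sum>j\<in>UNIV - {i}. f j) = (\<Sum>j\<in>UNIV - {i}. g j)" using assms(2) by (intro sum.cong) auto
  also have "f i + \<dots> = Suc (g i + (\<Sum>j\<in>UNIV - {i}. g j))" using assms(1) by simp
  also have "g i + (\<Sum>j\<in>UNIV - {i}. g j) = (\<Sum>j\<in>UNIV. g j)" by (rule sum.remove[symmetric]) auto
  finally show ?thesis .
qed

lemma order_unit_in:
  assumes k: "k \<in> inventories b" and i: "0 < k (Some i)"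
  shows "order_unit i k \<in> inventories b"
proof -
  have le: "k (Some j) \<le> b j" for j using k by (auto simp: inventories_def)
  have "(\<Sum>j\<in>UNIV. b j - order_unit i k (Some j)) = Suc (\<Sum>j\<in>UNIV. b j - k (Some j))"
    by (rule sum_change_one[where i = i]) (use i le[of i] in auto)
  then show ?thesis using k by (auto simp: inventories_def intro: le_trans[OF diff_le_self])
qed

lemma deliver_unit_in:
  assumes k: "k \<in> inventories b" and i: "k (Some i) < b i"
  shows "deliver_unit i k \<in> inventories b"
proof -
  have "(\<Sum>j\<in>UNIV. b j - k (Some j)) = Suc (\<Sum>j\<in>UNIV. b j - deliver_unit i k (Some j))"
    by (rule sum_change_one[where i = i]) (use i in auto)
  then show ?thesis using k i by (auto simp: inventories_def)
qed

text \<open>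
  Orders and deliveries are inverse moves. This exchanges sums over targets for sums over sources.
\<close>

lemma order_iff:
  assumes k: "k \<in> inventories b" and k': "k' \<in> inventories b"
  shows "(0 < k (Some i) \<and> k' = order_unit i k) \<longleftrightarrow> (k' (Some i) < b i \<and> k = deliver_unit i k')"
proof
  assume *: "0 < k (Some i) \<and> k' = order_unit i k"
  have "k (Some i) \<le> b i" using k by (auto simp: inventories_def)
  with * have "k' (Some i) < b i" by auto
  moreover from * have "k = deliver_unit i k'" by (intro inventory_eqI) auto
  ultimately show "k' (Some i) < b i \<and> k = deliver_unit i k'" ..
next
  assume *: "k' (Some i) < b i \<and> k = deliver_unit i k'"
  then have "0 < k' None" using supplier_pos[OF k'] by blast
  with * have "k' = order_unit i k" by (intro inventory_eqI) auto
  moreover from * have "0 < k (Some i)" by auto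
  ultimately show "0 < k (Some i) \<and> k' = order_unit i k" by (intro conjI)
qed

lemma finite_inventories: "finite (inventories b)"
proof (rule finite_subset)
  show "inventories b \<subseteq> PiE UNIV (\<lambda>_. {..\<Sum>j\<in>UNIV. b j})"
  proof
    fix k assume k: "k \<in> inventories b"
    have "k o' \<le> (\<Sum>j\<in>UNIV. b j)" for o'
    proof (cases o')
      case None
      then show ?thesis using k by (auto simp: inventories_def intro: sum_mono)
    next
      case (Some j)
      have "k (Some j) \<le> b j" using k by (auto simp: inventories_def)
      also have "\<dots> \<le> (\<Sum>j\<in>UNIV. b j)" by (rule member_le_sum) auto
      finally show ?thesis using Some by simp
    qed
    then show "k \<in> PiE UNIV (\<lambda>_. {..\<Sum>j\<in>UNIV. b j})" by auto
  qed
qed (auto intro: finite_PiE)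

definition full_stock :: "('j::finite \<Rightarrow> nat) \<Rightarrow> 'j inventory" where
  "full_stock b = (\<lambda>x. case x of None \<Rightarrow> 0 | Some j \<Rightarrow> b j)"

lemma full_stock_in: "full_stock b \<in> inventories b"
  by (simp add: full_stock_def inventories_def)

lemma full_stock_unique:
  assumes "k \<in> inventories b" "\<And>i. \<not> k (Some i) < b i"
  shows "k = full_stock b"
  using assms by (intro inventory_eqI) (auto simp: full_stock_def inventories_def not_less intro: antisym)

lemma neediest_nonempty: "neediest b k \<noteq> {}"
proof -
  have "Max (range (\<lambda>j. b j - k (Some j))) \<in> range (\<lambda>j. b j - k (Some j))" by (rule Max_in) auto
  then obtain i where i: "Max (range (\<lambda>j. b j - k (Some j))) = b i - k (Some i)" by (rule rangeE)
  have "b j - k (Some j) \<le> b i - k (Some i)" for j unfolding i[symmetric] by (rule Max_ge) simp_all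
  then have "i \<in> neediest b k" by (auto simp: neediest_def is_arg_max_def not_less)
  then show ?thesis by auto
qed

lemma routing_bounds: "0 \<le> routing b i k" "routing b i k \<le> 1"
proof -
  show "0 \<le> routing b i k" by (simp add: routing_def)
  have "1 \<le> card (neediest b k)" using neediest_nonempty by (simp add: Suc_le_eq card_gt_0_iff)
  then show "routing b i k \<le> 1" by (simp add: routing_def divide_le_eq)
qed

text \<open>
  A location with maximal deficit has positive deficit as soon as some location has.
\<close>

lemma delivery_possible:
  assumes i: "k (Some i) < b i"
  obtains j where "k (Some j) < b j" "0 < routing b j k"
proof -
  obtain j where j: "j \<in> neediest b k" using neediest_nonempty by blast
  then have "\<not> b j - k (Some j) < b i - k (Some i)" by (auto simp: neediest_def is_arg_max_def)
  with i have "k (Some j) < b j" by linarith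
  moreover have "0 < routing b j k" using j by (auto simp: routing_def card_gt_0_iff)
  ultimately show ?thesis using that by blast
qed

lemma mult_if: "(c::real) * (if A then x else 0) = (if A then c * x else 0)"
  by simp

locale queueing_inventory =
  fixes lam :: "'j::finite \<Rightarrow> real" and \<mu> :: "'j \<Rightarrow> nat \<Rightarrow> real" and b :: "'j \<Rightarrow> nat" and \<nu> :: real
  assumes lam_pos: "\<And>j. 0 < lam j" and mu_pos: "\<And>j n. 1 \<le> n \<Longrightarrow> 0 < \<mu> j n" and nu_pos: "0 < \<nu>"
begin

definition order_rate :: "'j inventory \<Rightarrow> real" where
  "order_rate k = (\<Sum>i\<in>UNIV. lam i * of_bool (0 < k (Some i))) + (\<Sum>i\<in>UNIV. \<nu> * routing b i k * of_bool (k (Some i) < b i))"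

text \<open>
  The transition rates of the inventory alone, in which every location with stock loses units at
  rate \<open>lam i\<close>.
\<close>

definition inv_rate :: "'j inventory \<Rightarrow> 'j inventory \<Rightarrow> real" where
  "inv_rate k k' = (\<Sum>i\<in>UNIV. if 0 < k (Some i) \<and> k' = order_unit i k then lam i else 0)
     + (\<Sum>i\<in>UNIV. if k (Some i) < b i \<and> k' = deliver_unit i k then \<nu> * routing b i k else 0)"

definition inv_inflow :: "('j inventory \<Rightarrow> real) \<Rightarrow> 'j inventory \<Rightarrow> real" where
  "inv_inflow \<theta> k = (\<Sum>i\<in>UNIV. \<theta> (deliver_unit i k) * lam i * of_bool (k (Some i) < b i)) +
     (\<Sum>i\<in>UNIV. \<theta> (order_unit i k) * \<nu> * routing b i (order_unit i k) * of_bool (k (Some i) > 0))"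

lemma inventory_equations_iff:
  "inventory_equations lam b \<nu> \<theta> \<longleftrightarrow> (\<forall>k\<in>inventories b. \<theta> k * order_rate k = inv_inflow \<theta> k)"
  by (simp add: inventory_equations_def order_rate_def inv_inflow_def)

lemma sum_single:
  assumes "finite A" "G \<Longrightarrow> t \<in> A"
  shows "(\<Sum>z\<in>A. if G \<and> z = t then f z else (0::real)) = (if G then f t else 0)"
proof (cases G)
  case True
  then show ?thesis using assms by simp
qed simp

lemma inv_rate_row:
  assumes k: "k \<in> inventories b"
  shows "(\<Sum>k'\<in>inventories b. inv_rate k k') = order_rate k"
proof -
  have "(\<Sum>k'\<in>inventories b. inv_rate k k') =
     (\<Sum>i\<in>UNIV. \<Sum>k'\<in>inventories b. if 0 < k (Some i) \<and> k' = order_unit i k then lam i else 0)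
     + (\<Sum>i\<in>UNIV. \<Sum>k'\<in>inventories b. if k (Some i) < b i \<and> k' = deliver_unit i k then \<nu> * routing b i k else 0)"
    unfolding inv_rate_def sum.distrib by (intro arg_cong2[of _ _ _ _ "(+)"] sum.swap)
  also have "\<dots> = order_rate k"
    unfolding order_rate_def
    by (intro arg_cong2[of _ _ _ _ "(+)"] sum.cong refl; subst sum_single)
       (auto simp: finite_inventories intro: order_unit_in[OF k] deliver_unit_in[OF k])
  finally show ?thesis .
qed

lemma inv_rate_column:
  assumes k': "k' \<in> inventories b"
  shows "(\<Sum>k\<in>inventories b. \<theta> k * inv_rate k k') = inv_inflow \<theta> k'"
proof -
  have "(\<Sum>k\<in>inventories b. \<theta> k * inv_rate k k') =
     (\<Sum>k\<in>inventories b. (\<Sum>i\<in>UNIV. if k' (Some i) < b i \<and> k = deliver_unit i k' then \<theta> k * lam i else 0)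
     + (\<Sum>i\<in>UNIV. if 0 < k' (Some i) \<and> k = order_unit i k' then \<theta> k * (\<nu> * routing b i k) else 0))"
  proof (rule sum.cong[OF refl])
    fix k assume k: "k \<in> inventories b"
    show "\<theta> k * inv_rate k k' = (\<Sum>i\<in>UNIV. if k' (Some i) < b i \<and> k = deliver_unit i k' then \<theta> k * lam i else 0)
     + (\<Sum>i\<in>UNIV. if 0 < k' (Some i) \<and> k = order_unit i k' then \<theta> k * (\<nu> * routing b i k) else 0)"
      unfolding inv_rate_def distrib_left sum_distrib_left
    proof (intro arg_cong2[of _ _ _ _ "(+)"] sum.cong refl)
      fix i
      show "\<theta> k * (if 0 < k (Some i) \<and> k' = order_unit i k then lam i else 0)
          = (if k' (Some i) < b i \<and> k = deliver_unit i k' then \<theta> k * lam i else 0)"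
        unfolding order_iff[OF k k'] by (rule mult_if)
      show "\<theta> k * (if k (Some i) < b i \<and> k' = deliver_unit i k then \<nu> * routing b i k else 0)
          = (if 0 < k' (Some i) \<and> k = order_unit i k' then \<theta> k * (\<nu> * routing b i k) else 0)"
        unfolding order_iff[OF k' k, symmetric] by (rule mult_if)
    qed
  qed
  also have "\<dots> = (\<Sum>i\<in>UNIV. \<Sum>k\<in>inventories b. if k' (Some i) < b i \<and> k = deliver_unit i k' then \<theta> k * lam i else 0)
     + (\<Sum>i\<in>UNIV. \<Sum>k\<in>inventories b. if 0 < k' (Some i) \<and> k = order_unit i k' then \<theta> k * (\<nu> * routing b i k) else 0)"
    unfolding sum.distrib by (intro arg_cong2[of _ _ _ _ "(+)"] sum.swap)
  also have "\<dots> = inv_inflow \<theta> k'"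
    unfolding inv_inflow_def
    by (intro arg_cong2[of _ _ _ _ "(+)"] sum.cong refl; subst sum_single)
       (auto simp: finite_inventories mult.assoc intro: order_unit_in[OF k'] deliver_unit_in[OF k'])
  finally show ?thesis .
qed

lemma delivery_rate_nonneg: "0 \<le> \<nu> * routing b i k"
  by (rule mult_nonneg_nonneg[OF less_imp_le[OF nu_pos] routing_bounds(1)])

lemma inv_rate_nonneg: "0 \<le> inv_rate k k'"
  unfolding inv_rate_def
  by (intro add_nonneg_nonneg sum_nonneg) (simp_all add: less_imp_le[OF lam_pos] delivery_rate_nonneg)

text \<open>
  Uniformization: \<open>I + Q / L\<close> is a stochastic matrix on a finite set if \<open>L\<close> exceeds all exit rates. Its
  averages started from full stock have a limit point, no mass escapes from a finite set, and
  invariance under \<open>I + Q / L\<close> is the system of equations.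
\<close>

theorem inventory_solution_exists: "\<exists>\<theta>. inventory_solution lam b \<nu> \<theta>"
proof -
  let ?K = "inventories b"
  \<comment> \<open>An upper bound of all exit rates, as \<open>routing\<close> is at most \<open>1\<close>.\<close>
  define L where "L = (\<Sum>i\<in>UNIV. lam i) + (\<Sum>i\<in>(UNIV::'j set). \<nu>)"
  have L: "0 < L" unfolding L_def using lam_pos nu_pos by (intro add_pos_pos sum_pos) auto
  have out: "order_rate k \<le> L" for k
  proof -
    have "\<nu> * routing b i k * of_bool (k (Some i) < b i) \<le> \<nu> * 1 * 1" for i
      using routing_bounds[of b i k] nu_pos by (intro mult_mono) auto
    moreover have "lam i * of_bool (0 < k (Some i)) \<le> lam i * 1" for i
      using lam_pos[of i] by (intro mult_left_mono) auto
    ultimately show ?thesis unfolding order_rate_def L_def by (intro add_mono sum_mono) auto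
  qed
  define p where "p k k' = (if k' = k then 1 - order_rate k / L else 0) + inv_rate k k' / L" for k k'
  have p0: "0 \<le> p k k'" for k k'
    using out[of k] L inv_rate_nonneg[of k k'] by (auto simp: p_def intro!: add_nonneg_nonneg)
  have row: "(\<Sum>k'\<in>?K. p k k') = 1" if k: "k \<in> ?K" for k
    using k finite_inventories[of b] L
    by (simp add: p_def sum.distrib sum_divide_distrib[symmetric] inv_rate_row)
  have st: "stochastic_on ?K (\<lambda>k k'. ennreal (p k k'))"
    unfolding stochastic_on_def
    using row p0 by (simp add: nn_integral_count_space_finite finite_inventories sum_ennreal)
  define a where "a n = rec_nat (\<lambda>k. if k = full_stock b then 1 else 0)
     (\<lambda>_ f. push ?K f (\<lambda>k k'. ennreal (p k k'))) n" for n
  have step: "a (Suc n) k = push ?K (a n) (\<lambda>k k'. ennreal (p k k')) k" for n k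
    by (simp add: a_def)
  have mass: "(\<integral>\<^sup>+ k. a n k \<partial>count_space ?K) = 1" for n
  proof (induction n)
    case 0
    show ?case using full_stock_in[of b]
      by (simp add: a_def nn_integral_count_space_finite finite_inventories)
  next
    case (Suc n)
    then show ?case using mass_push[OF st, of "a n"] by (simp add: step)
  qed
  obtain \<rho> and r :: "nat \<Rightarrow> nat" where r: "strict_mono r"
    and lim: "\<And>k. k \<in> ?K \<Longrightarrow> (\<lambda>n. (\<Sum>i<r n. a i k) / of_nat (r n)) \<longlonglongrightarrow> \<rho> k"
    and sub: "\<And>k. k \<in> ?K \<Longrightarrow> push ?K \<rho> (\<lambda>k k'. ennreal (p k k')) k \<le> \<rho> k"
    and le1: "(\<integral>\<^sup>+ k. \<rho> k \<partial>count_space ?K) \<le> 1"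
  proof (rule cesaro_subinvariant[where a = a, OF st])
    fix \<rho> and r :: "nat \<Rightarrow> nat"
    assume "strict_mono r" "\<And>k. k \<in> ?K \<Longrightarrow> (\<lambda>n. (\<Sum>i<r n. a i k) / of_nat (r n)) \<longlonglongrightarrow> \<rho> k"
      "\<And>k. k \<in> ?K \<Longrightarrow> push ?K \<rho> (\<lambda>k k'. ennreal (p k k')) k \<le> \<rho> k" "(\<integral>\<^sup>+ k. \<rho> k \<partial>count_space ?K) \<le> 1"
    then show thesis by (rule that)
  next
    show "a (Suc n) k = push ?K (a n) (\<lambda>k k'. ennreal (p k k')) k" if "k \<in> ?K" for n k by (rule step)
    show "(\<integral>\<^sup>+ k. a n k \<partial>count_space ?K) = 1" for n by (rule mass)
  qed
  have "(\<lambda>n. \<Sum>k\<in>?K. (\<Sum>i<r n. a i k) / of_nat (r n)) \<longlonglongrightarrow> (\<Sum>k\<in>?K. \<rho> k)"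
    by (rule tendsto_sum[OF lim])
  moreover have "\<forall>\<^sub>F n in sequentially. (\<Sum>k\<in>?K. (\<Sum>i<r n. a i k) / of_nat (r n)) = 1"
    using eventually_gt_at_top[of 0]
  proof eventually_elim
    case (elim n)
    have pos: "0 < r n" using elim seq_suble[OF r, of n] by simp
    have m: "(\<Sum>k\<in>?K. a i k) = 1" for i
      using mass[of i] by (simp add: nn_integral_count_space_finite finite_inventories)
    have "(\<Sum>k\<in>?K. (\<Sum>i<r n. a i k) / of_nat (r n)) = (\<Sum>k\<in>?K. \<Sum>i<r n. a i k) / of_nat (r n)"
      unfolding divide_ennreal_def by (rule sum_distrib_right[symmetric])
    also have "(\<Sum>k\<in>?K. \<Sum>i<r n. a i k) = (\<Sum>i<r n. \<Sum>k\<in>?K. a i k)" by (rule sum.swap)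
    also have "\<dots> = of_nat (r n)" by (simp add: m)
    also have "\<dots> / of_nat (r n) = 1" using pos by (simp add: ennreal_divide_self ennreal_of_nat_eq_real_of_nat)
    finally show ?case .
  qed
  ultimately have "(\<lambda>n::nat. 1) \<longlonglongrightarrow> (\<Sum>k\<in>?K. \<rho> k)" by (rule Lim_transform_eventually)
  then have sum1: "(\<Sum>k\<in>?K. \<rho> k) = 1" by (simp add: LIMSEQ_const_iff)
  then have mass1: "(\<integral>\<^sup>+ k. \<rho> k \<partial>count_space ?K) = 1"
    by (simp add: nn_integral_count_space_finite finite_inventories)
  define \<theta> where "\<theta> k = enn2real (\<rho> k)" for k
  have \<rho>: "\<rho> k = ennreal (\<theta> k)" if "k \<in> ?K" for k
    using nn_integral_ge_point[OF that, of \<rho>] unfolding mass1 \<theta>_def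
    by (intro ennreal_enn2real[symmetric]) (rule le_less_trans, assumption, simp)
  have \<theta>0: "0 \<le> \<theta> k" for k by (simp add: \<theta>_def)
  have "(\<Sum>k\<in>?K. \<rho> k) = (\<Sum>k\<in>?K. ennreal (\<theta> k))" by (rule sum.cong[OF refl \<rho>])
  also have "\<dots> = ennreal (\<Sum>k\<in>?K. \<theta> k)" using \<theta>0 by (intro sum_ennreal)
  finally have "ennreal (\<Sum>k\<in>?K. \<theta> k) = 1" using sum1 by simp
  then have "(\<Sum>k\<in>?K. \<theta> k) = 1" by (rule ennreal_eq_1[THEN iffD1])
  then have dist: "distribution_on ?K \<theta>"
    using \<theta>0 finite_inventories[of b] by (auto simp: distribution_on_def has_sum_finite_iff)
  have "\<theta> k' * order_rate k' = inv_inflow \<theta> k'" if k': "k' \<in> ?K" for k'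
  proof -
    have "push ?K \<rho> (\<lambda>k k'. ennreal (p k k')) k' = \<rho> k'"
      by (rule subinvariant_imp_invariant[OF st sub _ k']) (simp_all add: mass1)
    moreover have "push ?K \<rho> (\<lambda>k k'. ennreal (p k k')) k' = (\<Sum>k\<in>?K. ennreal (\<theta> k * p k k'))"
      unfolding push_def nn_integral_count_space_finite[OF finite_inventories]
      by (rule sum.cong[OF refl]) (simp add: \<rho> \<theta>0 p0 ennreal_mult)
    moreover have "(\<Sum>k\<in>?K. ennreal (\<theta> k * p k k')) = ennreal (\<Sum>k\<in>?K. \<theta> k * p k k')"
      using \<theta>0 p0 by (intro sum_ennreal) auto
    ultimately have "ennreal (\<Sum>k\<in>?K. \<theta> k * p k k') = ennreal (\<theta> k')" by (simp add: \<rho>[OF k'])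
    then have "(\<Sum>k\<in>?K. \<theta> k * p k k') = \<theta> k'"
      using \<theta>0 p0 by (subst (asm) ennreal_inj) (auto intro!: sum_nonneg)
    moreover have "(\<Sum>k\<in>?K. \<theta> k * p k k') = \<theta> k' * (1 - order_rate k' / L) + inv_inflow \<theta> k' / L"
    proof -
      have "(\<Sum>k\<in>?K. \<theta> k * p k k') = (\<Sum>k\<in>?K. (if k = k' then \<theta> k * (1 - order_rate k / L) else 0)) + (\<Sum>k\<in>?K. \<theta> k * inv_rate k k') / L"
        unfolding p_def sum_divide_distrib sum.distrib[symmetric]
        by (rule sum.cong[OF refl]) (auto simp: distrib_left)
      then show ?thesis using k' finite_inventories[of b] by (simp add: inv_rate_column)
    qed
    ultimately show ?thesis using L by (simp add: field_simps)
  qed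
  with dist show ?thesis by (auto simp: inventory_solution_def inventory_equations_iff)
qed

text \<open>
  By the equations, positivity passes along every transition of positive rate. From any inventory,
  deliveries lead to full stock, and every inventory is reached from full stock by orders.
\<close>

theorem inventory_solution_pos:
  assumes sol: "inventory_solution lam b \<nu> \<theta>" and k: "k \<in> inventories b"
  shows "0 < \<theta> k"
proof -
  let ?K = "inventories b"
  have \<theta>0: "0 \<le> \<theta> k" if "k \<in> ?K" for k
    using sol that by (auto simp: inventory_solution_def distribution_on_def)
  have eq: "\<theta> k' * order_rate k' = (\<Sum>k\<in>?K. \<theta> k * inv_rate k k')" if "k' \<in> ?K" for k'
    using sol that by (simp add: inventory_solution_def inventory_equations_iff inv_rate_column)
  have move: "0 < \<theta> k'" if k: "k \<in> ?K" "0 < \<theta> k" and k': "k' \<in> ?K" and r: "0 < inv_rate k k'" for k k'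
  proof -
    have "0 < \<theta> k * inv_rate k k'" using k r by simp
    also have "\<dots> \<le> (\<Sum>k\<in>?K. \<theta> k * inv_rate k k')"
      using k \<theta>0 inv_rate_nonneg finite_inventories by (intro member_le_sum) auto
    also have "\<dots> = \<theta> k' * order_rate k'" by (rule eq[OF k', symmetric])
    finally show ?thesis using \<theta>0[OF k'] by (cases "\<theta> k' = 0") auto
  qed
  have rate_deliver: "0 < inv_rate k (deliver_unit i k)" if "k (Some i) < b i" "0 < routing b i k" for i k
  proof -
    have "0 < (if k (Some i) < b i \<and> deliver_unit i k = deliver_unit i k then \<nu> * routing b i k else 0)"
      using that nu_pos by simp
    also have "\<dots> \<le> (\<Sum>j\<in>UNIV. if k (Some j) < b j \<and> deliver_unit i k = deliver_unit j k then \<nu> * routing b j k else 0)"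
      by (intro member_le_sum[where f = "\<lambda>j. if k (Some j) < b j \<and> deliver_unit i k = deliver_unit j k then \<nu> * routing b j k else 0"])
         (simp_all add: delivery_rate_nonneg)
    finally show ?thesis unfolding inv_rate_def
      by (intro add_nonneg_pos sum_nonneg) (simp_all add: less_imp_le[OF lam_pos])
  qed
  have rate_order: "0 < inv_rate k (order_unit i k)" if "0 < k (Some i)" for i k
  proof -
    have "0 < (if 0 < k (Some i) \<and> order_unit i k = order_unit i k then lam i else 0)"
      using that lam_pos by simp
    also have "\<dots> \<le> (\<Sum>j\<in>UNIV. if 0 < k (Some j) \<and> order_unit i k = order_unit j k then lam j else 0)"
      by (intro member_le_sum[where f = "\<lambda>j. if 0 < k (Some j) \<and> order_unit i k = order_unit j k then lam j else 0"])
         (simp_all add: less_imp_le[OF lam_pos])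
    finally show ?thesis unfolding inv_rate_def
      by (intro add_pos_nonneg sum_nonneg) (simp_all add: delivery_rate_nonneg)
  qed
  have up: "0 < \<theta> (full_stock b)" if "k \<in> ?K" "0 < \<theta> k" for k
    using that
  proof (induction "k None" arbitrary: k rule: less_induct)
    case less
    show ?case
    proof (cases "\<exists>i. k (Some i) < b i")
      case True
      then obtain i where "k (Some i) < b i" ..
      then obtain j where j: "k (Some j) < b j" "0 < routing b j k" by (rule delivery_possible)
      have "deliver_unit j k None < k None" using supplier_pos[OF less.prems(1) j(1)] by simp
      then show ?thesis
        using deliver_unit_in[OF less.prems(1) j(1)] move[OF less.prems _ rate_deliver[OF j]]
        by (intro less.hyps) auto
    next
      case False
      then show ?thesis using full_stock_unique[OF less.prems(1)] less.prems(2) by auto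
    qed
  qed
  have "\<exists>k\<in>?K. \<theta> k \<noteq> 0"
  proof (rule ccontr)
    assume "\<not> ?thesis"
    then have "(\<Sum>k\<in>?K. \<theta> k) = 0" by simp
    moreover have "(\<Sum>k\<in>?K. \<theta> k) = 1"
      using sol finite_inventories[of b] by (auto simp: inventory_solution_def distribution_on_def has_sum_finite_iff)
    ultimately show False by simp
  qed
  then obtain k0 where k0: "k0 \<in> ?K" "\<theta> k0 \<noteq> 0" by auto
  then have "0 < \<theta> k0" using \<theta>0[OF k0(1)] by simp
  then have full: "0 < \<theta> (full_stock b)" by (rule up[OF k0(1)])
  show ?thesis using k
  proof (induction "k None" arbitrary: k rule: less_induct)
    case less
    show ?case
    proof (cases "\<exists>i. k (Some i) < b i")
      case True
      then obtain i where i: "k (Some i) < b i" ..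
      let ?k = "deliver_unit i k"
      have *: "0 < ?k (Some i)" "k = order_unit i ?k"
        using order_iff[OF deliver_unit_in[OF less.prems i] less.prems, of i] i by auto
      have "0 < \<theta> ?k" using supplier_pos[OF less.prems i] deliver_unit_in[OF less.prems i] by (intro less.hyps) auto
      moreover have "0 < inv_rate ?k k"
      proof -
        have "0 < inv_rate ?k (order_unit i ?k)" by (rule rate_order) (rule *(1))
        then show ?thesis unfolding *(2)[symmetric] .
      qed
      ultimately show ?thesis by (rule move[OF deliver_unit_in[OF less.prems i] _ less.prems])
    next
      case False
      then show ?thesis using full_stock_unique[OF less.prems] full by auto
    qed
  qed
qed

end

section \<open>The product form\<close>

lemma has_sum_finite_family:
  fixes f :: "'i \<Rightarrow> 'a \<Rightarrow> real"
  assumes "finite I" "\<And>i. i \<in> I \<Longrightarrow> (f i has_sum s i) A"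
  shows "((\<lambda>z. \<Sum>i\<in>I. f i z) has_sum (\<Sum>i\<in>I. s i)) A"
  using assms by (induction I rule: finite_induct) (simp_all add: has_sum_add)

lemma has_sum_if_eq:
  assumes "G \<Longrightarrow> t \<in> A"
  shows "((\<lambda>z. if G \<and> z = t then c else 0) has_sum (if G then c else (0::real))) A"
proof (cases G)
  case True
  then show ?thesis using assms by (intro has_sum_finite_neutralI[of "{t}"]) auto
qed simp

lemma sum_if_eq_le:
  assumes "finite A" "G \<Longrightarrow> 0 \<le> f t"
  shows "(\<Sum>z\<in>A. if G \<and> z = t then f z else (0::real)) \<le> (if G then f t else 0)"
proof (cases "G \<and> t \<in> A")
  case True
  then show ?thesis using assms(1) by simp
next
  case False
  then have "(\<Sum>z\<in>A. if G \<and> z = t then f z else 0) = 0" by (intro sum.neutral) auto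
  then show ?thesis using assms(2) by simp
qed

lemma mult_of_bool: "c * of_bool A = (if A then c else (0::real))"
  by simp

lemma fun_upd_step_iff:
  fixes n n' :: "'j \<Rightarrow> nat"
  shows "n' = n(i := n i + 1) \<longleftrightarrow> 0 < n' i \<and> n = n'(i := n' i - 1)"
proof
  assume "0 < n' i \<and> n = n'(i := n' i - 1)"
  then show "n' = n(i := n i + 1)" by (intro ext) auto
qed auto

context queueing_inventory
begin

text \<open>
  Local balance between arrivals and services at each single location.
\<close>

definition balanced :: "('j queues \<Rightarrow> real) \<Rightarrow> bool" where
  "balanced w \<longleftrightarrow> (\<forall>n i. w n * lam i = w (n(i := n i + 1)) * \<mu> i (n i + 1))"

lemma balanced_down:
  assumes "balanced w" "0 < n i"
  shows "w (n(i := n i - 1)) * lam i = w n * \<mu> i (n i)"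
  using assms(1)[unfolded balanced_def, rule_format, of "n(i := n i - 1)" i] assms(2) by simp

lemma balanced_prod:
  assumes v: "\<And>i p. v i p * lam i = v i (Suc p) * \<mu> i (Suc p)"
  shows "balanced (\<lambda>n. \<Prod>j\<in>UNIV. v j (n j))"
  unfolding balanced_def
proof (intro allI)
  fix n :: "'j queues" and i
  let ?r = "\<Prod>j\<in>UNIV - {i}. v j (n j)"
  have 1: "(\<Prod>j\<in>UNIV. v j (n j)) = v i (n i) * ?r" by (rule prod.remove) auto
  have "(\<Prod>j\<in>UNIV. v j ((n(i := n i + 1)) j)) = v i (n i + 1) * (\<Prod>j\<in>UNIV - {i}. v j ((n(i := n i + 1)) j))"
    by (subst prod.remove[of _ i]) auto
  also have "(\<Prod>j\<in>UNIV - {i}. v j ((n(i := n i + 1)) j)) = ?r" by (rule prod.cong) auto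
  finally have 2: "(\<Prod>j\<in>UNIV. v j ((n(i := n i + 1)) j)) = v i (Suc (n i)) * ?r" by simp
  have "v i (n i) * ?r * lam i = v i (n i) * lam i * ?r" by simp
  also have "\<dots> = v i (Suc (n i)) * ?r * \<mu> i (n i + 1)" unfolding v by simp
  finally show "(\<Prod>j\<in>UNIV. v j (n j)) * lam i = (\<Prod>j\<in>UNIV. v j ((n(i := n i + 1)) j)) * \<mu> i (n i + 1)"
    unfolding 1 2 .
qed

definition service_rate :: "'j state \<Rightarrow> real" where
  "service_rate y = (\<Sum>i\<in>UNIV. if 0 < fst y i \<and> 0 < snd y (Some i) then \<mu> i (fst y i) else 0)"

lemma jump_rate_row:
  assumes y: "(n, k) \<in> states b"
  shows "((\<lambda>z. jump_rate lam \<mu> b \<nu> (n, k) z) has_sum (order_rate k + service_rate (n, k))) (states b - {(n, k)})"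
proof -
  let ?A = "states b - {(n, k)}"
  have k: "k \<in> inventories b" using y by (simp add: states_def)
  have "((\<lambda>z. \<Sum>i\<in>UNIV. if 0 < k (Some i) \<and> z = (n(i := n i + 1), k) then lam i else 0)
      has_sum (\<Sum>i\<in>UNIV. if 0 < k (Some i) then lam i else 0)) ?A"
  proof (rule has_sum_finite_family[OF finite], rule has_sum_if_eq)
    fix i
    have "n(i := n i + 1) \<noteq> n" by (metis fun_upd_same n_not_Suc_n Suc_eq_plus1)
    then show "(n(i := n i + 1), k) \<in> ?A" using k by (simp add: states_def)
  qed
  moreover have "((\<lambda>z. \<Sum>i\<in>UNIV. if (0 < n i \<and> 0 < k (Some i)) \<and> z = (n(i := n i - 1), order_unit i k) then \<mu> i (n i) else 0)
      has_sum (\<Sum>i\<in>UNIV. if 0 < n i \<and> 0 < k (Some i) then \<mu> i (n i) else 0)) ?A"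
  proof (rule has_sum_finite_family[OF finite], rule has_sum_if_eq)
    fix i assume i: "0 < n i \<and> 0 < k (Some i)"
    have "order_unit i k None \<noteq> k None" by simp
    then have "order_unit i k \<noteq> k" by metis
    then show "(n(i := n i - 1), order_unit i k) \<in> ?A" using order_unit_in[OF k] i by (simp add: states_def)
  qed
  moreover have "((\<lambda>z. \<Sum>i\<in>UNIV. if k (Some i) < b i \<and> z = (n, deliver_unit i k) then \<nu> * routing b i k else 0)
      has_sum (\<Sum>i\<in>UNIV. if k (Some i) < b i then \<nu> * routing b i k else 0)) ?A"
  proof (rule has_sum_finite_family[OF finite], rule has_sum_if_eq)
    fix i assume i: "k (Some i) < b i"
    have "deliver_unit i k (Some i) \<noteq> k (Some i)" by simp
    then have "deliver_unit i k \<noteq> k" by metis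
    then show "(n, deliver_unit i k) \<in> ?A" using deliver_unit_in[OF k i] by (simp add: states_def)
  qed
  ultimately have "((\<lambda>z. (\<Sum>i\<in>UNIV. if 0 < k (Some i) \<and> z = (n(i := n i + 1), k) then lam i else 0)
      + (\<Sum>i\<in>UNIV. if (0 < n i \<and> 0 < k (Some i)) \<and> z = (n(i := n i - 1), order_unit i k) then \<mu> i (n i) else 0)
      + (\<Sum>i\<in>UNIV. if k (Some i) < b i \<and> z = (n, deliver_unit i k) then \<nu> * routing b i k else 0))
    has_sum ((\<Sum>i\<in>UNIV. if 0 < k (Some i) then lam i else 0)
      + (\<Sum>i\<in>UNIV. if 0 < n i \<and> 0 < k (Some i) then \<mu> i (n i) else 0)
      + (\<Sum>i\<in>UNIV. if k (Some i) < b i then \<nu> * routing b i k else 0))) ?A"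
    by (intro has_sum_add)
  moreover have "(\<Sum>i\<in>UNIV. if 0 < k (Some i) then lam i else 0)
      + (\<Sum>i\<in>UNIV. if 0 < n i \<and> 0 < k (Some i) then \<mu> i (n i) else 0)
      + (\<Sum>i\<in>UNIV. if k (Some i) < b i then \<nu> * routing b i k else 0) = order_rate k + service_rate (n, k)"
    by (simp only: order_rate_def service_rate_def mult_of_bool fst_conv snd_conv ac_simps)
  ultimately show ?thesis
    by (simp only: jump_rate_def case_prod_conv conj_assoc)
qed

lemma generator_diag:
  assumes y: "(n, k) \<in> states b"
  shows "generator lam \<mu> b \<nu> (n, k) (n, k) = - (order_rate k + service_rate (n, k))"
  using infsumI[OF jump_rate_row[OF y]] by (simp add: generator_def)

lemma arrival_iff:
  fixes n n' :: "'j queues" and k k' :: "'j inventory"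
  shows "(0 < k (Some i) \<and> (n', k') = (n(i := n i + 1), k))
    \<longleftrightarrow> ((0 < n' i \<and> 0 < k' (Some i)) \<and> (n, k) = (n'(i := n' i - 1), k'))"
  unfolding prod.inject using fun_upd_step_iff[of n' n i] by blast

lemma service_iff:
  fixes n n' :: "'j queues" and k k' :: "'j inventory"
  assumes "k \<in> inventories b" "k' \<in> inventories b"
  shows "(0 < n i \<and> 0 < k (Some i) \<and> (n', k') = (n(i := n i - 1), order_unit i k))
    \<longleftrightarrow> (k' (Some i) < b i \<and> (n, k) = (n'(i := n' i + 1), deliver_unit i k'))"
  unfolding prod.inject using order_iff[OF assms, of i] fun_upd_step_iff[of n n' i] by blast

lemma delivery_iff:
  fixes n n' :: "'j queues" and k k' :: "'j inventory"
  assumes "k \<in> inventories b" "k' \<in> inventories b"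
  shows "(k (Some i) < b i \<and> (n', k') = (n, deliver_unit i k))
    \<longleftrightarrow> (0 < k' (Some i) \<and> (n, k) = (n', order_unit i k'))"
  unfolding prod.inject using order_iff[OF assms(2,1), of i] by blast

text \<open>
  The inflow into \<open>(n, k)\<close> has three parts. Arrivals balance the outflow by services, through \<open>balanced\<close>
  at \<open>n - e\<^sub>i\<close>. Services are turned, through \<open>balanced\<close> at \<open>n\<close>, into demands of rate \<open>lam i\<close>, and together
  with the deliveries they form the inflow of the inventory equations at \<open>k\<close>. A finite set \<open>F\<close> may
  miss some of the sources, which leaves an inequality.
\<close>

theorem product_form_balance:
  assumes w: "balanced w" "\<And>n. 0 \<le> w n" and \<theta>: "inventory_solution lam b \<nu> \<theta>"
    and F: "finite F" "F \<subseteq> states b" and y: "y \<in> F"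
  shows "(\<Sum>u\<in>F. w (fst u) * \<theta> (snd u) * generator lam \<mu> b \<nu> u y) \<le> 0"
proof -
  obtain n' k' where y': "y = (n', k')" by (cases y)
  have k': "k' \<in> inventories b" and ys: "(n', k') \<in> states b" using y y' F by (auto simp: states_def)
  have \<theta>0: "0 \<le> \<theta> k" if "k \<in> inventories b" for k
    using \<theta> that by (auto simp: inventory_solution_def distribution_on_def)
  let ?m = "\<lambda>u. w (fst u) * \<theta> (snd u)"
  let ?A = "\<lambda>i u. if (0 < n' i \<and> 0 < k' (Some i)) \<and> u = (n'(i := n' i - 1), k') then ?m u * lam i else 0"
  let ?B = "\<lambda>i u. if k' (Some i) < b i \<and> u = (n'(i := n' i + 1), deliver_unit i k') then ?m u * \<mu> i (fst u i) else 0"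
  let ?C = "\<lambda>i u. if 0 < k' (Some i) \<and> u = (n', order_unit i k') then ?m u * (\<nu> * routing b i (snd u)) else 0"
  have rate: "?m u * jump_rate lam \<mu> b \<nu> u y = (\<Sum>i\<in>UNIV. ?A i u) + (\<Sum>i\<in>UNIV. ?B i u) + (\<Sum>i\<in>UNIV. ?C i u)"
    if u: "u \<in> states b" for u
  proof -
    obtain n k where u': "u = (n, k)" by (cases u)
    have k: "k \<in> inventories b" using u u' by (simp add: states_def)
    show ?thesis
      unfolding u' y' jump_rate_def case_prod_conv distrib_left sum_distrib_left
      unfolding mult_if arrival_iff service_iff[OF k k'] delivery_iff[OF k k'] fst_conv snd_conv ..
  qed
  have fin: "finite (F - {y})" using F by simp
  have "(\<Sum>u\<in>F - {y}. ?m u * generator lam \<mu> b \<nu> u y)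
      = (\<Sum>u\<in>F - {y}. (\<Sum>i\<in>UNIV. ?A i u) + (\<Sum>i\<in>UNIV. ?B i u) + (\<Sum>i\<in>UNIV. ?C i u))"
    using F rate by (intro sum.cong refl) (auto simp: generator_def)
  also have "\<dots> = (\<Sum>i\<in>UNIV. \<Sum>u\<in>F - {y}. ?A i u) + (\<Sum>i\<in>UNIV. \<Sum>u\<in>F - {y}. ?B i u) + (\<Sum>i\<in>UNIV. \<Sum>u\<in>F - {y}. ?C i u)"
    unfolding sum.distrib by (intro arg_cong2[of _ _ _ _ "(+)"] sum.swap)
  also have "\<dots> \<le> (\<Sum>i\<in>UNIV. if 0 < n' i \<and> 0 < k' (Some i) then ?m (n'(i := n' i - 1), k') * lam i else 0)
     + (\<Sum>i\<in>UNIV. if k' (Some i) < b i then ?m (n'(i := n' i + 1), deliver_unit i k') * \<mu> i (fst (n'(i := n' i + 1), deliver_unit i k') i) else 0)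
     + (\<Sum>i\<in>UNIV. if 0 < k' (Some i) then ?m (n', order_unit i k') * (\<nu> * routing b i (snd (n', order_unit i k'))) else 0)"
  proof (intro add_mono sum_mono)
    fix i :: 'j
    show "(\<Sum>u\<in>F - {y}. ?A i u) \<le> (if 0 < n' i \<and> 0 < k' (Some i) then ?m (n'(i := n' i - 1), k') * lam i else 0)"
      by (rule sum_if_eq_le[OF fin]) (simp add: w(2) \<theta>0[OF k'] less_imp_le[OF lam_pos])
    show "(\<Sum>u\<in>F - {y}. ?B i u) \<le> (if k' (Some i) < b i then ?m (n'(i := n' i + 1), deliver_unit i k') * \<mu> i (fst (n'(i := n' i + 1), deliver_unit i k') i) else 0)"
      by (rule sum_if_eq_le[OF fin, where f = "\<lambda>u. ?m u * \<mu> i (fst u i)"])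
         (simp add: w(2) \<theta>0[OF deliver_unit_in[OF k']] less_imp_le[OF mu_pos])
    show "(\<Sum>u\<in>F - {y}. ?C i u) \<le> (if 0 < k' (Some i) then ?m (n', order_unit i k') * (\<nu> * routing b i (snd (n', order_unit i k'))) else 0)"
      by (rule sum_if_eq_le[OF fin, where f = "\<lambda>u. ?m u * (\<nu> * routing b i (snd u))"])
         (simp add: w(2) \<theta>0[OF order_unit_in[OF k']] delivery_rate_nonneg)
  qed
  also have "(\<Sum>i\<in>UNIV. if 0 < n' i \<and> 0 < k' (Some i) then ?m (n'(i := n' i - 1), k') * lam i else 0)
      = (w n' * \<theta> k') * service_rate (n', k')"
    unfolding service_rate_def sum_distrib_left
  proof (rule sum.cong[OF refl])
    fix i
    show "(if 0 < n' i \<and> 0 < k' (Some i) then ?m (n'(i := n' i - 1), k') * lam i else 0)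
      = w n' * \<theta> k' * (if 0 < fst (n', k') i \<and> 0 < snd (n', k') (Some i) then \<mu> i (fst (n', k') i) else 0)"
      using balanced_down[OF w(1), of n' i] by auto
  qed
  also have "(\<Sum>i\<in>UNIV. if k' (Some i) < b i then ?m (n'(i := n' i + 1), deliver_unit i k') * \<mu> i (fst (n'(i := n' i + 1), deliver_unit i k') i) else 0)
      = w n' * (\<Sum>i\<in>UNIV. \<theta> (deliver_unit i k') * lam i * of_bool (k' (Some i) < b i))"
    unfolding sum_distrib_left
  proof (rule sum.cong[OF refl])
    fix i
    show "(if k' (Some i) < b i then ?m (n'(i := n' i + 1), deliver_unit i k') * \<mu> i (fst (n'(i := n' i + 1), deliver_unit i k') i) else 0)
      = w n' * (\<theta> (deliver_unit i k') * lam i * of_bool (k' (Some i) < b i))"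
      using w(1)[unfolded balanced_def, rule_format, of n' i] by auto
  qed
  also have "(\<Sum>i\<in>UNIV. if 0 < k' (Some i) then ?m (n', order_unit i k') * (\<nu> * routing b i (snd (n', order_unit i k'))) else 0)
      = w n' * (\<Sum>i\<in>UNIV. \<theta> (order_unit i k') * \<nu> * routing b i (order_unit i k') * of_bool (k' (Some i) > 0))"
    unfolding sum_distrib_left by (rule sum.cong[OF refl]) auto
  also have "w n' * \<theta> k' * service_rate (n', k')
      + w n' * (\<Sum>i\<in>UNIV. \<theta> (deliver_unit i k') * lam i * of_bool (k' (Some i) < b i))
      + w n' * (\<Sum>i\<in>UNIV. \<theta> (order_unit i k') * \<nu> * routing b i (order_unit i k') * of_bool (k' (Some i) > 0))
      = w n' * \<theta> k' * service_rate (n', k') + w n' * inv_inflow \<theta> k'"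
    by (simp add: inv_inflow_def distrib_left)
  also have "inv_inflow \<theta> k' = \<theta> k' * order_rate k'"
    using \<theta> k' by (simp add: inventory_solution_def inventory_equations_iff)
  finally have inflow: "(\<Sum>u\<in>F - {y}. ?m u * generator lam \<mu> b \<nu> u y)
      \<le> w n' * \<theta> k' * (order_rate k' + service_rate (n', k'))"
    by (simp add: algebra_simps)
  have "(\<Sum>u\<in>F. ?m u * generator lam \<mu> b \<nu> u y)
      = ?m y * generator lam \<mu> b \<nu> y y + (\<Sum>u\<in>F - {y}. ?m u * generator lam \<mu> b \<nu> u y)"
    using F(1) y by (rule sum.remove)
  also have "?m y * generator lam \<mu> b \<nu> y y = - (w n' * \<theta> k' * (order_rate k' + service_rate (n', k')))"
    unfolding y' generator_diag[OF ys] fst_conv snd_conv by (rule mult_minus_right)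
  finally show ?thesis using inflow by simp
qed

definition weight :: "'j \<Rightarrow> nat \<Rightarrow> real" where
  "weight j m = (\<Prod>l=1..m. lam j / \<mu> j l)"

lemma weight_pos: "0 < weight j m"
  unfolding weight_def using lam_pos mu_pos by (intro prod_pos) auto

lemma weight_step: "weight j m * lam j = weight j (Suc m) * \<mu> j (Suc m)"
  using mu_pos[of "Suc m" j] by (simp add: weight_def)

lemma queue_marginal_eq: "queue_marginal lam \<mu> j m = weight j m / (\<Sum>m. weight j m)"
  by (simp add: queue_marginal_def weight_def)

lemma weights_balanced: "balanced (\<lambda>n. \<Prod>j\<in>UNIV. weight j (n j))"
  by (rule balanced_prod) (rule weight_step)

lemma marginals_balanced: "balanced (\<lambda>n. \<Prod>j\<in>UNIV. queue_marginal lam \<mu> j (n j))"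
  by (rule balanced_prod) (simp add: queue_marginal_eq weight_step)

text \<open>
  Restrict the sum to full stock and to queues that are empty except at location \<open>j\<close>.
\<close>

lemma finite_mass_imp_summable:
  assumes \<theta>: "inventory_solution lam b \<nu> \<theta>"
    and fin: "(\<integral>\<^sup>+ u. ennreal ((\<Prod>j\<in>UNIV. weight j (fst u j)) * \<theta> (snd u)) \<partial>count_space (states b)) < \<infinity>"
  shows "summable (weight j)"
proof -
  let ?f = "\<lambda>u. (\<Prod>j\<in>UNIV. weight j (fst u j)) * \<theta> (snd u)"
  let ?e = "\<lambda>m. ((\<lambda>_. 0)(j := m), full_stock b)"
  have pos: "0 < \<theta> (full_stock b)" by (rule inventory_solution_pos[OF \<theta> full_stock_in])
  have fe: "?f (?e m) = weight j m * \<theta> (full_stock b)" for m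
  proof -
    have "(\<Prod>i\<in>UNIV. weight i (((\<lambda>_. 0)(j := m)) i)) = (\<Prod>i\<in>UNIV. if i = j then weight j m else 1)"
      by (rule prod.cong) (auto simp: weight_def)
    then show ?thesis by simp
  qed
  obtain M where M: "(\<integral>\<^sup>+ u. ennreal (?f u) \<partial>count_space (states b)) = ennreal M" "0 \<le> M"
    using fin by (cases "\<integral>\<^sup>+ u. ennreal (?f u) \<partial>count_space (states b)") auto
  have "(\<Sum>m<N. weight j m) \<le> M / \<theta> (full_stock b)" for N
  proof -
    have inj: "inj_on ?e {..<N}" by (rule inj_onI) (metis Pair_inject fun_upd_same)
    have nn: "0 \<le> weight j m * \<theta> (full_stock b)" for m using weight_pos[of j m] pos by simp
    have "ennreal (\<Sum>m<N. weight j m * \<theta> (full_stock b)) = (\<Sum>m<N. ennreal (?f (?e m)))"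
      unfolding fe using nn by (intro sum_ennreal[symmetric])
    also have "\<dots> = (\<Sum>u\<in>?e ` {..<N}. ennreal (?f u))" by (subst sum.reindex[OF inj]) simp
    also have "\<dots> \<le> ennreal M"
      unfolding M(1)[symmetric] by (rule sum_le_nn_integral_count_space) (auto simp: states_def full_stock_in)
    finally have "(\<Sum>m<N. weight j m * \<theta> (full_stock b)) \<le> M" using M(2) by (simp add: ennreal_le_iff)
    then show ?thesis using pos by (simp add: sum_distrib_right[symmetric] pos_le_divide_eq)
  qed
  then show ?thesis
    using weight_pos by (intro summableI_nonneg_bounded) (auto simp: less_imp_le)
qed

context
  assumes summ: "\<And>j. summable (weight j)"
begin

lemma normalizer_pos: "0 < (\<Sum>m. weight j m)"
  by (rule suminf_pos[OF summ weight_pos])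

lemma queue_marginal_pos: "0 < queue_marginal lam \<mu> j m"
  unfolding queue_marginal_eq using weight_pos normalizer_pos by simp

lemma queue_marginal_mass: "(\<integral>\<^sup>+ m. ennreal (queue_marginal lam \<mu> j m) \<partial>count_space UNIV) = 1"
proof -
  have "(\<lambda>m. weight j m / (\<Sum>m. weight j m)) sums ((\<Sum>m. weight j m) / (\<Sum>m. weight j m))"
    by (rule sums_divide[OF summable_sums[OF summ]])
  then have "queue_marginal lam \<mu> j sums 1"
    using normalizer_pos[of j] by (simp add: queue_marginal_eq[abs_def])
  then have "(\<Sum>m. ennreal (queue_marginal lam \<mu> j m)) = ennreal 1"
    by (intro suminf_ennreal_eq less_imp_le[OF queue_marginal_pos])
  then show ?thesis by (simp add: nn_integral_count_space_nat)
qed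

text \<open>
  The product is the law of independent queue lengths.
\<close>

lemma queues_has_sum: "((\<lambda>n. \<Prod>j\<in>UNIV. queue_marginal lam \<mu> j (n j)) has_sum 1) UNIV"
proof -
  define p where "p j = embed_pmf (queue_marginal lam \<mu> j)" for j
  have p: "pmf (p j) m = queue_marginal lam \<mu> j m" for j m
    unfolding p_def by (rule pmf_embed_pmf[OF less_imp_le[OF queue_marginal_pos] queue_marginal_mass])
  have eq: "pmf (Pi_pmf UNIV 0 p) n = (\<Prod>j\<in>UNIV. queue_marginal lam \<mu> j (n j))" for n
    by (subst pmf_Pi') (auto simp: p)
  have "(\<integral>\<^sup>+ n. ennreal (pmf (Pi_pmf UNIV 0 p) n) \<partial>count_space UNIV) = ennreal 1"
    using measure_pmf.emeasure_space_1[of "Pi_pmf UNIV 0 p"] by (simp add: nn_integral_pmf)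
  then have "(pmf (Pi_pmf UNIV 0 p) has_sum 1) UNIV" by (intro has_sum_of_nn_integral) simp_all
  then show ?thesis by (simp only: eq[abs_def] eta_contract_eq cong: has_sum_cong)
qed

lemma queues_pos: "0 < (\<Prod>j\<in>UNIV. queue_marginal lam \<mu> j (n j))"
  by (intro prod_pos) (simp add: queue_marginal_pos)

lemma product_form_distribution:
  assumes \<theta>: "inventory_solution lam b \<nu> \<theta>"
  shows "distribution_on (states b) (\<lambda>u. (\<Prod>j\<in>UNIV. queue_marginal lam \<mu> j (fst u j)) * \<theta> (snd u))"
proof -
  have \<theta>0: "0 \<le> \<theta> k" if "k \<in> inventories b" for k
    using \<theta> that by (auto simp: inventory_solution_def distribution_on_def)
  have \<theta>1: "(\<theta> has_sum 1) (inventories b)" using \<theta> by (auto simp: inventory_solution_def distribution_on_def)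
  let ?\<xi> = "\<lambda>n. \<Prod>j\<in>UNIV. queue_marginal lam \<mu> j (n j)"
  let ?f = "\<lambda>u. ?\<xi> (fst u) * \<theta> (snd u)"
  have row: "((\<lambda>k. ?f (n, k)) has_sum ?\<xi> n) (inventories b)" for n
    using has_sum_cmult_right[OF \<theta>1, of "?\<xi> n"] by simp
  have nn: "0 \<le> ?f (n, k)" if "k \<in> inventories b" for n k
    using \<theta>0[OF that] less_imp_le[OF queues_pos[of n]] by simp
  have "?f summable_on (Sigma UNIV (\<lambda>_. inventories b))"
    using queues_has_sum by (intro summable_on_SigmaI[OF row] nn) (auto simp: summable_on_def)
  then have "(?f has_sum 1) (Sigma UNIV (\<lambda>_. inventories b))"
    by (rule has_sum_SigmaI[OF row queues_has_sum])
  then show ?thesis using nn by (auto simp: distribution_on_def states_def)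
qed

end

end

section \<open>Ergodicity of the queueing-inventory process\<close>

theorem theorem3:
  fixes lam :: "'j::finite \<Rightarrow> real"
    and \<mu> :: "'j \<Rightarrow> nat \<Rightarrow> real"
    and b :: "'j \<Rightarrow> nat"
    and \<nu> :: real
    and P :: "'j state \<Rightarrow> 'w measure"
    and Z :: "real \<Rightarrow> 'w \<Rightarrow> 'j state"
  assumes "CARD('j) > 1"
    and "\<And>j. lam j > 0"
    and "\<And>j n. n \<ge> 1 \<Longrightarrow> \<mu> j n > 0"
    and "\<And>j. b j \<ge> 1"
    and "\<nu> > 0"
    and "markov_jump_process (states b) (generator lam \<mu> b \<nu>) P Z"
    and "irreducible_process (states b) P Z"
    and "regular_process (states b) (generator lam \<mu> b \<nu>) P Z"
  shows "(ergodic_process (states b) P Z \<longleftrightarrow>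
            (\<forall>j. summable (\<lambda>m. \<Prod>l=1..m. lam j / \<mu> j l))) \<and>
         (ergodic_process (states b) P Z \<longrightarrow>
            (\<exists>\<theta> \<xi> \<pi>.
               inventory_solution lam b \<nu> \<theta> \<and>
               (\<forall>\<theta>'. inventory_solution lam b \<nu> \<theta>' \<longrightarrow> (\<forall>k\<in>inventories b. \<theta>' k = \<theta> k)) \<and>
               (\<forall>n. \<xi> n = (\<Prod>j\<in>UNIV. queue_marginal lam \<mu> j (n j))) \<and>
               (\<forall>n. \<forall>k\<in>inventories b. \<pi> (n, k) = \<xi> n * \<theta> k) \<and>
               limiting_distribution (states b) P Z \<pi> \<and>
               stationary_distribution (states b) P Z \<pi> \<and>
               (\<forall>\<pi>'. limiting_distribution (states b) P Z \<pi>' \<or>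
                     stationary_distribution (states b) P Z \<pi>' \<longrightarrow>
                     (\<forall>z\<in>states b. \<pi>' z = \<pi> z)) \<and>
               (\<forall>\<alpha>. distribution_on (states b) \<alpha> \<longrightarrow>
                  (\<forall>n. ((\<lambda>t. init_prob (states b) P \<alpha> (\<lambda>\<omega>. fst (Z t \<omega>) = n))
                          \<longlongrightarrow> \<xi> n) at_top) \<and>
                  (\<forall>k\<in>inventories b.
                     ((\<lambda>t. init_prob (states b) P \<alpha> (\<lambda>\<omega>. snd (Z t \<omega>) = k))
                          \<longlongrightarrow> \<theta> k) at_top))))"
proof -
  interpret queueing_inventory lam \<mu> b \<nu>
    by (rule queueing_inventory.intro) (fact assms(2), fact assms(3), fact assms(5))
  let ?E = "states b" and ?q = "generator lam \<mu> b \<nu>"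
  interpret jump: irreducible_jump_process ?E ?q P Z
  proof
    show "\<exists>y\<in>?E. y \<noteq> x" if "x \<in> ?E" for x
    proof
      show "((\<lambda>j. Suc (fst x j)), snd x) \<noteq> x" by (metis fst_conv n_not_Suc_n)
      show "((\<lambda>j. Suc (fst x j)), snd x) \<in> ?E" using that by (auto simp: states_def)
    qed
  qed (fact assms(6), fact assms(8), fact assms(7))
  obtain \<theta> where \<theta>: "inventory_solution lam b \<nu> \<theta>" using inventory_solution_exists ..
  have weight_eq: "(\<lambda>m. \<Prod>l=1..m. lam j / \<mu> j l) = weight j" for j
    by (rule ext) (simp add: weight_def)
  have necessary: "summable (weight j)" if erg: "ergodic_process ?E P Z" for j
  proof -
    let ?m = "\<lambda>u. (\<Prod>j\<in>UNIV. weight j (fst u j)) * \<theta> (snd u)"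
    let ?x = "((\<lambda>_. 0), full_stock b) :: 'j state"
    have x: "?x \<in> ?E" by (simp add: states_def full_stock_in)
    have w: "0 < (\<Prod>j\<in>UNIV. weight j (n j))" for n by (rule prod_pos) (simp add: weight_pos)
    have m: "0 < ?m u" if "u \<in> ?E" for u
      using that inventory_solution_pos[OF \<theta>] w by (auto simp: states_def)
    \<comment> \<open>The unnormalized product is subinvariant whether or not the series converge.\<close>
    have "(\<integral>\<^sup>+ u. ennreal (?m u) \<partial>count_space ?E) < \<infinity>"
    proof (rule jump.positive_recurrent_imp_finite[OF x])
      show "positive_recurrent P Z ?x" using erg x by (auto simp: ergodic_process_def)
      show "push ?E (\<lambda>u. ennreal (?m u)) (jump.tp (real n)) y \<le> ennreal (?m y)" if "y \<in> ?E" for n y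
        by (rule jump.subinvariant_tp[OF m _ _ that])
           (simp_all only: product_form_balance[OF weights_balanced less_imp_le[OF w] \<theta>] of_nat_0_le_iff)
    qed simp
    then show ?thesis by (rule finite_mass_imp_summable[OF \<theta>])
  qed
  \<comment> \<open>Stated for every solution \<open>\<theta>\<close>, since the uniqueness of \<open>\<theta>\<close> follows by comparing the limits.\<close>
  have product: "limiting_distribution ?E P Z \<pi>" "stationary_distribution ?E P Z \<pi>"
     "distribution_on ?E \<pi>" "\<And>u. u \<in> ?E \<Longrightarrow> 0 < \<pi> u"
     "\<And>t y. 0 \<le> t \<Longrightarrow> y \<in> ?E \<Longrightarrow> push ?E (\<lambda>u. ennreal (\<pi> u)) (jump.tp t) y = ennreal (\<pi> y)"
    if summ: "\<And>j. summable (weight j)" and \<theta>: "inventory_solution lam b \<nu> \<theta>"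
      and \<pi>: "\<pi> = (\<lambda>u. (\<Prod>j\<in>UNIV. queue_marginal lam \<mu> j (fst u j)) * \<theta> (snd u))" for \<theta> \<pi>
  proof -
    show dist: "distribution_on ?E \<pi>" unfolding \<pi> by (rule product_form_distribution[OF summ \<theta>])
    show pos: "0 < \<pi> u" if "u \<in> ?E" for u
      using that inventory_solution_pos[OF \<theta>] queues_pos[OF summ] by (auto simp: states_def \<pi>)
    have bal: "(\<Sum>u\<in>F. \<pi> u * ?q u y) \<le> 0" if "finite F" "F \<subseteq> ?E" "y \<in> F" for F y
      unfolding \<pi> by (rule product_form_balance[OF marginals_balanced less_imp_le[OF queues_pos[OF summ]] \<theta> that])
    show "limiting_distribution ?E P Z \<pi>" "stationary_distribution ?E P Z \<pi>"
      by (rule jump.balance_imp_limiting[OF dist pos bal]; assumption)+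
    show "push ?E (\<lambda>u. ennreal (\<pi> u)) (jump.tp t) y = ennreal (\<pi> y)" if "0 \<le> t" "y \<in> ?E" for t y
      by (rule jump.balance_imp_invariant[OF dist pos bal that])
  qed
  have sufficient: "ergodic_process ?E P Z" if summ: "\<And>j. summable (weight j)"
  proof -
    define \<pi> where "\<pi> = (\<lambda>u. (\<Prod>j\<in>UNIV. queue_marginal lam \<mu> j (fst u j)) * \<theta> (snd u))"
    note \<pi> = product[OF summ \<theta> \<pi>_def]
    have "positive_recurrent P Z x" if x: "x \<in> ?E" for x
    proof (rule jump.subinvariant_imp_positive_recurrent[OF x])
      show "push ?E (\<lambda>u. ennreal (\<pi> u)) (jump.tp 1) y \<le> ennreal (\<pi> y)" if "y \<in> ?E" for y
        using \<pi>(5)[of 1, OF _ that] by simp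
      show "(\<integral>\<^sup>+ u. ennreal (\<pi> u) \<partial>count_space ?E) < \<infinity>" by (simp add: jump.distribution_mass[OF \<pi>(3)])
      show "0 < ennreal (\<pi> x)" using \<pi>(4)[OF x] by simp
    qed
    then show ?thesis using assms(7) by (simp add: ergodic_process_def)
  qed
  show ?thesis
    unfolding weight_eq
  proof (intro conjI impI)
    show "ergodic_process ?E P Z \<longleftrightarrow> (\<forall>j. summable (weight j))"
    proof
      assume "ergodic_process ?E P Z"
      then show "\<forall>j. summable (weight j)" by (intro allI necessary)
    next
      assume "\<forall>j. summable (weight j)"
      then show "ergodic_process ?E P Z" by (intro sufficient) (rule spec)
    qed
    assume erg: "ergodic_process ?E P Z"
    note summ = necessary[OF erg]
    let ?\<xi> = "\<lambda>n. \<Prod>j\<in>UNIV. queue_marginal lam \<mu> j (n j)"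
    define \<pi> where "\<pi> = (\<lambda>u. ?\<xi> (fst u) * \<theta> (snd u))"
    note \<pi> = product[OF summ \<theta> \<pi>_def]
    have unique: "\<pi>' z = \<pi> z"
      if "limiting_distribution ?E P Z \<pi>' \<or> stationary_distribution ?E P Z \<pi>'" "z \<in> ?E" for \<pi>' z
      by (rule jump.limiting_unique[OF \<pi>(1) that])
    have \<theta>_unique: "\<theta>' k = \<theta> k" if \<theta>': "inventory_solution lam b \<nu> \<theta>'" and k: "k \<in> inventories b" for \<theta>' k
    proof -
      have z: "((\<lambda>_. 0), k) \<in> ?E" using k by (simp add: states_def)
      have eq: "?\<xi> (\<lambda>_. 0) * \<theta>' k = ?\<xi> (\<lambda>_. 0) * \<theta> k"
        using unique[OF disjI1[OF product(1)[OF summ \<theta>' refl]] z] unfolding \<pi>_def fst_conv snd_conv .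
      have "?\<xi> (\<lambda>_. 0) \<noteq> 0" by (rule less_imp_neq[OF queues_pos[OF summ], symmetric])
      with eq show ?thesis by (rule mult_left_cancel[THEN iffD1, rotated])
    qed
    have \<theta>1: "(\<theta> has_sum 1) (inventories b)" using \<theta> by (auto simp: inventory_solution_def distribution_on_def)
    have queue_part: "(\<Sum>\<^sub>\<infinity>u\<in>{u \<in> ?E. fst u = n}. \<pi> u) = ?\<xi> n" for n
    proof -
      have eq: "{u \<in> ?E. fst u = n} = Pair n ` inventories b" by (auto simp: states_def)
      have inj: "inj_on (Pair n) (inventories b)" by (rule inj_onI) simp
      have "((\<lambda>k. \<pi> (n, k)) has_sum (?\<xi> n * 1)) (inventories b)"
        unfolding \<pi>_def fst_conv snd_conv by (rule has_sum_cmult_right[OF \<theta>1])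
      then show ?thesis unfolding eq infsum_reindex[OF inj] comp_def by (simp add: infsumI)
    qed
    have inventory_part: "(\<Sum>\<^sub>\<infinity>u\<in>{u \<in> ?E. snd u = k}. \<pi> u) = \<theta> k" if k: "k \<in> inventories b" for k
    proof -
      have eq: "{u \<in> ?E. snd u = k} = (\<lambda>n. (n, k)) ` UNIV" using k by (auto simp: states_def)
      have inj: "inj_on (\<lambda>n. (n, k)) UNIV" by (rule inj_onI) simp
      have "((\<lambda>n. \<pi> (n, k)) has_sum (1 * \<theta> k)) UNIV"
        unfolding \<pi>_def fst_conv snd_conv by (rule has_sum_cmult_left[OF queues_has_sum[OF summ]])
      then show ?thesis unfolding eq infsum_reindex[OF inj] comp_def by (simp add: infsumI)
    qed
    have marginals: "((\<lambda>t. init_prob ?E P \<alpha> (\<lambda>\<omega>. fst (Z t \<omega>) = n)) \<longlongrightarrow> ?\<xi> n) at_top"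
      "k \<in> inventories b \<Longrightarrow> ((\<lambda>t. init_prob ?E P \<alpha> (\<lambda>\<omega>. snd (Z t \<omega>) = k)) \<longlongrightarrow> \<theta> k) at_top"
      if \<alpha>: "distribution_on ?E \<alpha>" for \<alpha> n k
      using jump.init_prob_tendsto[OF \<pi>(3) \<alpha> \<pi>(5), where R = "\<lambda>u. fst u = n"]
        jump.init_prob_tendsto[OF \<pi>(3) \<alpha> \<pi>(5), where R = "\<lambda>u. snd u = k"]
      by (simp_all add: queue_part inventory_part)
    show "\<exists>\<theta> \<xi> \<pi>. inventory_solution lam b \<nu> \<theta> \<and>
               (\<forall>\<theta>'. inventory_solution lam b \<nu> \<theta>' \<longrightarrow> (\<forall>k\<in>inventories b. \<theta>' k = \<theta> k)) \<and>
               (\<forall>n. \<xi> n = (\<Prod>j\<in>UNIV. queue_marginal lam \<mu> j (n j))) \<and>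
               (\<forall>n. \<forall>k\<in>inventories b. \<pi> (n, k) = \<xi> n * \<theta> k) \<and>
               limiting_distribution (states b) P Z \<pi> \<and>
               stationary_distribution (states b) P Z \<pi> \<and>
               (\<forall>\<pi>'. limiting_distribution (states b) P Z \<pi>' \<or>
                     stationary_distribution (states b) P Z \<pi>' \<longrightarrow>
                     (\<forall>z\<in>states b. \<pi>' z = \<pi> z)) \<and>
               (\<forall>\<alpha>. distribution_on (states b) \<alpha> \<longrightarrow>
                  (\<forall>n. ((\<lambda>t. init_prob (states b) P \<alpha> (\<lambda>\<omega>. fst (Z t \<omega>) = n))
                          \<longlongrightarrow> \<xi> n) at_top) \<and>
                  (\<forall>k\<in>inventories b.
                     ((\<lambda>t. init_prob (states b) P \<alpha> (\<lambda>\<omega>. snd (Z t \<omega>) = k))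
                          \<longlongrightarrow> \<theta> k) at_top))"
    proof (rule exI[of _ \<theta>], rule exI[of _ ?\<xi>], rule exI[of _ \<pi>], intro conjI allI impI ballI)
      show "\<pi> (n, k) = ?\<xi> n * \<theta> k" for n k by (simp add: \<pi>_def)
    qed (fact \<theta> \<pi>(1,2) refl | rule \<theta>_unique unique marginals; assumption)+
  qed
qed

end
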